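(* Every Extreme Harmonic algorithm $\mathcal A$ has asymptotic competitive ratio $\mathcal R^\infty_{\mathcal A}\ge 1.5762$.
   Context: Online bin packing: a finite sequence $\sigma$ of items with sizes in $(0,1]$ arrives one by one; each must be irrevocably assigned to a bin of capacity $1$ before the next one becomes available. $\mathcal A(\sigma)$ is the number of bins used by $\mathcal A$ on $\sigma$, $\mathrm{opt}(\sigma)$ the offline optimum, and $\mathcal R^{\infty}_{\mathcal A}=\limsup_{n\to\infty}\sup_\sigma\{\mathcal A(\sigma)/\mathrm{opt}(\sigma) : \mathrm{opt}(\sigma)=n\}$. Sizes in $(2/3,1]$, $(1/2,2/3]$, $(1/3,1/2]$, $(0,1/3]$ are called huge, large, medium, small, respectively. PARAMETERS of an Extreme Harmonic algorithm: an integer $N$; thresholds $1=t_1>t_2>\dots>t_N>0$; spaces $\mathrm{redspace}_1\le\dots\le\mathrm{redspace}_K$ forming a set $D$ (and $\mathrm{redspace}_0=0$); fractions $\mathrm{red}_j$; functions $\mathrm{leaves},\mathrm{needs}:\{1,\dots,N\}\to\{0,\dots,K\}$. An item has type $j<N$ if its size is in $(t_{j+1},t_j]$, type $N$ if its size is in $(0,t_N]$; $s(p)$ and $t(p)$ denote size and type of item $p$. No type interval contains $1/2,1/3$ or $2/3$ as an inner point, so types are huge, large, medium or small. $\mathrm{bluefit}_j=\lfloor1/t_j\rfloor$; $\mathrm{needs}(j)=0$ iff $\mathrm{red}_j=0$; if $\mathrm{red}_j>0$ then $\mathrm{redfit}_j=\lfloor\mathrm{redspace}_{\mathrm{needs}(j)}/t_j\rfloor\ge1$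 (it equals $1$ for medium types); if $\mathrm{leaves}(j)>0$ then $\mathrm{redspace}_{\mathrm{leaves}(j)}\le1-\mathrm{bluefit}_jt_j$. Required: (a) if $j$ is small with $\mathrm{red}_j>0$ then $\mathrm{redspace}_{\mathrm{needs}(j)}\le1/3$; if $i$ is medium then $\mathrm{redspace}_{\mathrm{leaves}(i)}<1/3$, and $1/3<\mathrm{redspace}_{\mathrm{needs}(i)}$ if $\mathrm{red}_i>0$; (b) for $x>1/3$: $x\in D$ iff $x=t_i$ for some $i$; (c) $0\le\mathrm{red}_i<1/3$ for all $i$; (d) $t_1=1,t_2=2/3,t_3=1/2$, $\mathrm{red}_1=\mathrm{red}_2=\mathrm{red}_N=0$, types $1$ and $N$ are packed in pure blue bins (so $\mathrm{leaves}(1)=\mathrm{leaves}(N)=0$), $1/3\in D$ and $\mathrm{redspace}_{\mathrm{leaves}(2)}=1/3$; (e) for any two consecutive thresholds $t_i,t_{i+1}$ in the medium range, $t_i-t_{i+1}<t_N<1/100$. BINS. Items may be blue, red, uncolored, or bonus. A bin holds at most $\mathrm{bluefit}_i$ blue items (if these have type $i$) and at most $\mathrm{redfit}_j$ red items (if these have type $j$). A bin is blue-open (red-open) if it contains at least one blue (red) item but fewer than this maximum; bins with a bonus item are considered mixed and not open. Pure blue bins only ever contain blue items of one type; a mixed bin contains items of two types (blue of one, red of the other); an unmixed bin contains items of one type and is not pure blue. An unmixed bin is red-compatible with a new item $p$ if either (i) it contains blue or uncolored items of type $i$, $p$ is small, and $\mathrm{leaves}(i)\ge\mathrm{needs}(t(p))$,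 or (ii) it contains a large item of size $x$, $p$ is medium, and $s(p)\le1-x$. An unmixed bin is blue-compatible with $p$ if either (i) it contains red items of type $j$ and $\mathrm{leaves}(t(p))\ge\mathrm{needs}(j)$, or (ii) it contains one red or uncolored medium item of size $x$, $p$ is large, and $s(p)\le1-x$. PACK$(p,c)$ for $p$ of type $i$ and $c\in\{\text{red},\text{blue}\}$: place $p$ in the first available kind of bin among: a $c$-open bin with items of type $i$ and color $c$; a $c$-compatible unmixed bin (it becomes mixed, and the colors of its items become fixed: $p$ gets color $c$, a previously uncolored item gets the opposite color); a new bin (pure blue if $\mathrm{leaves}(i)=0$ and $c$ is blue, else unmixed). If $p$ was packed into a new bin, is medium and $\mathrm{red}_i>0$, it gets no color; otherwise it gets color $c$. MAIN LOOP. Type $N$ items are packed by Next Fit in separate bins. Counters $n^i,n^i_{\mathrm{red}},n^i_{\mathrm{bonus}}$ start at $0$. When an item $p$ of type $i<N$ arrives: $n^i\gets n^i+1$. Case A: $n^i_{\mathrm{red}}<\lfloor\mathrm{red}_in^i\rfloor$. If $n^i_{\mathrm{bonus}}>0$, or if $\mathrm{redspace}_{\mathrm{needs}(i)}\le1/3$ and $n^j_{\mathrm{bonus}}>0$ for some $j$: let $b$ be a bonus item, of type $i$ if $n^i_{\mathrm{bonus}}>0$ and of some type $j$ with $n^j_{\mathrm{bonus}}>0$ otherwise; decrease $n^{t(b)}_{\mathrm{bonus}}$ by $1$; from now on label $b$ as ($\mathrm{redfit}_i$ items of) type $i$ colored red, no longer bonus; increase $n^i$ and $n^i_{\mathrm{red}}$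 by $\mathrm{redfit}_i$; call PACK$(p,\text{blue})$. Otherwise call PACK$(p,\text{red})$ and $n^i_{\mathrm{red}}\gets n^i_{\mathrm{red}}+1$. Case B: otherwise. If $p$ is medium, $\mathrm{red}_i>0$ and some bin is red-compatible with $p$: place $p$ in such a bin, label it a bonus item (no color, no mark), $n^i\gets n^i-1$, $n^i_{\mathrm{bonus}}\gets n^i_{\mathrm{bonus}}+1$. Otherwise call PACK$(p,\text{blue})$. Afterwards run MARK-AND-COLOR for every medium type $i$ with $\mathrm{red}_i>0$. Arbitrary tie-breaking is allowed. MARK-AND-COLOR for type $i$, with marks $\mathcal N,\mathcal B,\mathcal R$ and counters $n^i(\mathcal M),n^i_{\mathrm{red}}(\mathcal M)$ (number of items, respectively red items, of type $i$ with mark $\mathcal M$, initially $0$): (1) If there is an unmarked blue item in a bin with a marked blue item, give it the same mark $\mathcal M$ and increase $n^i(\mathcal M)$ by $1$. (2) Let $x$ be the minimum integer with $\lfloor(n^i(\mathcal R)+2x+1)\mathrm{red}_i\rfloor>n^i_{\mathrm{red}}(\mathcal R)$. If there are $x$ uncolored non-bonus items and one unmarked red or bonus item in a mixed bin, mark these $x+1$ items $\mathcal R$ (preferring a bonus item, which is then colored red, with $n^i_{\mathrm{bonus}}$ decreased by $1$), color the $x$ uncolored items blue, increase $n^i(\mathcal R)$ by $x+1$ and $n^i_{\mathrm{red}}(\mathcal R)$ by $1$. (3) Let $x$ be the minimum integer with $\lfloor(n^i(\mathcal B)+x+1)\mathrm{red}_i\rfloor>n^i_{\mathrm{red}}(\mathcal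 B)$. If there are an uncolored non-bonus item and a set of mixed bins with two unmarked blue items each, containing $x'\in\{x,x+1\}$ blue items in total, mark these items $\mathcal B$, color the uncolored item red (marked $\mathcal B$), increase $n^i(\mathcal B)$ by $x'+1$ and $n^i_{\mathrm{red}}(\mathcal B)$ by $1$. (4) Let $x$ be the minimum integer with $\lfloor(n^i(\mathcal N)+2x+1)\mathrm{red}_i\rfloor>n^i_{\mathrm{red}}(\mathcal N)$. If there are $x+1$ uncolored non-bonus items, mark the $x$ largest uncolored items and the smallest uncolored item $\mathcal N$, color the smallest red and the other $x$ blue, increase $n^i(\mathcal N)$ by $x+1$ and $n^i_{\mathrm{red}}(\mathcal N)$ by $1$. *)

theory Defs
  imports "HOL-Analysis.Analysis"
begin

section \<open>Online bin packing and the asymptotic competitive ratio\<close>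

definition valid_input :: "real list \<Rightarrow> bool" where
  "valid_input \<sigma> \<longleftrightarrow> (\<forall>s\<in>set \<sigma>. 0 < s \<and> s \<le> 1)"

definition packable :: "real list \<Rightarrow> nat \<Rightarrow> bool" where
  "packable \<sigma> m \<longleftrightarrow>
     (\<exists>f :: nat \<Rightarrow> nat. (\<forall>k<length \<sigma>. f k < m) \<and>
        (\<forall>B<m. (\<Sum>k \<in> {k. k < length \<sigma> \<and> f k = B}. \<sigma> ! k) \<le> 1))"

definition opt :: "real list \<Rightarrow> nat" where
  "opt \<sigma> = (LEAST m. packable \<sigma> m)"

definition asymptotic_ratio :: "(real list \<Rightarrow> nat) \<Rightarrow> ereal" where
  "asymptotic_ratio cost =
     limsup (\<lambda>n. SUP \<sigma> \<in> {\<sigma>. valid_input \<sigma> \<and> opt \<sigma> = n}. ereal (real (cost \<sigma>) / real (opt \<sigma>)))"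

definition large :: "real \<Rightarrow> bool" where
  "large s \<longleftrightarrow> 1/2 < s \<and> s \<le> 2/3"

definition medium :: "real \<Rightarrow> bool" where
  "medium s \<longleftrightarrow> 1/3 < s \<and> s \<le> 1/2"

definition small :: "real \<Rightarrow> bool" where
  "small s \<longleftrightarrow> 0 < s \<and> s \<le> 1/3"


section \<open>Parameters\<close>

text \<open>
  The families are total functions on \<^typ>\<open>nat\<close>; only the thresholds, fractions, etc. with index in
  \<open>{1..ntypes}\<close> and the red spaces with index in \<open>{0..nspaces}\<close> matter.
\<close>

record eh_params =
  ntypes :: nat
  thr :: "nat \<Rightarrow> real"
  nspaces :: nat
  redspace :: "nat \<Rightarrow> real"
  redfrac :: "nat \<Rightarrow> real"
  leaves :: "nat \<Rightarrow> nat"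
  needs :: "nat \<Rightarrow> nat"

definition type_of :: "eh_params \<Rightarrow> real \<Rightarrow> nat" where
  "type_of P s =
     (if s \<le> thr P (ntypes P) then ntypes P
      else (THE j. 1 \<le> j \<and> j < ntypes P \<and> thr P (Suc j) < s \<and> s \<le> thr P j))"

text \<open>
  No type interval has \<open>1/2\<close>, \<open>1/3\<close> or \<open>2/3\<close> as an inner point, so a type is large, medium or small
  according to its upper threshold, which belongs to the interval.
\<close>

definition medium_type :: "eh_params \<Rightarrow> nat \<Rightarrow> bool" where
  "medium_type P j \<longleftrightarrow> medium (thr P j)"

definition small_type :: "eh_params \<Rightarrow> nat \<Rightarrow> bool" where
  "small_type P j \<longleftrightarrow> small (thr P j)"

definition bluefit :: "eh_params \<Rightarrow> nat \<Rightarrow> nat" where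
  "bluefit P j = nat \<lfloor>1 / thr P j\<rfloor>"

definition redfit :: "eh_params \<Rightarrow> nat \<Rightarrow> nat" where
  "redfit P j = nat \<lfloor>redspace P (needs P j) / thr P j\<rfloor>"

definition red_spaces :: "eh_params \<Rightarrow> real set" where
  "red_spaces P = redspace P ` {1..nspaces P}"

definition eh_params_ok :: "eh_params \<Rightarrow> bool" where
  "eh_params_ok P \<longleftrightarrow>
     (let N = ntypes P; t = thr P; K = nspaces P; D = red_spaces P in
      3 \<le> N \<and>
      (\<forall>i\<in>{1..<N}. t (Suc i) < t i) \<and> 0 < t N \<and>
      (\<forall>k\<in>{1..<K}. redspace P k \<le> redspace P (Suc k)) \<and> redspace P 0 = 0 \<and>
      (\<forall>j\<in>{1..N}. leaves P j \<le> K \<and> needs P j \<le> K) \<and>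
      (\<forall>c\<in>{1/2, 1/3, 2/3}. (\<forall>j\<in>{1..<N}. \<not> (t (Suc j) < c \<and> c < t j)) \<and> \<not> (0 < c \<and> c < t N)) \<and>
      (\<forall>j\<in>{1..N}. needs P j = 0 \<longleftrightarrow> redfrac P j = 0) \<and>
      (\<forall>j\<in>{1..N}. redfrac P j > 0 \<longrightarrow>
          redfit P j \<ge> 1 \<and> (medium_type P j \<longrightarrow> redfit P j = 1)) \<and>
      (\<forall>j\<in>{1..N}. leaves P j > 0 \<longrightarrow> redspace P (leaves P j) \<le> 1 - real (bluefit P j) * t j) \<and>
      (\<forall>j\<in>{1..N}. small_type P j \<and> redfrac P j > 0 \<longrightarrow> redspace P (needs P j) \<le> 1/3) \<and>
      (\<forall>i\<in>{1..N}. medium_type P i \<longrightarrow>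
          redspace P (leaves P i) < 1/3 \<and> (redfrac P i > 0 \<longrightarrow> 1/3 < redspace P (needs P i))) \<and>
      (\<forall>x>1/3. x \<in> D \<longleftrightarrow> (\<exists>i\<in>{1..N}. x = t i)) \<and>
      (\<forall>i\<in>{1..N}. 0 \<le> redfrac P i \<and> redfrac P i < 1/3) \<and>
      t 1 = 1 \<and> t 2 = 2/3 \<and> t 3 = 1/2 \<and>
      redfrac P 1 = 0 \<and> redfrac P 2 = 0 \<and> redfrac P N = 0 \<and>
      leaves P 1 = 0 \<and> leaves P N = 0 \<and>
      1/3 \<in> D \<and> redspace P (leaves P 2) = 1/3 \<and>
      (\<forall>i\<in>{1..<N}. medium (t i) \<and> medium (t (Suc i)) \<longrightarrow> t i - t (Suc i) < t N) \<and>
      t N < 1/100)"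


section \<open>Bins and items\<close>

datatype color = Blue | Red | Uncolored | Bonus

fun opposite :: "color \<Rightarrow> color" where
  "opposite Blue = Red"
| "opposite Red = Blue"
| "opposite c = c"

datatype mark = MarkN | MarkB | MarkR

datatype bin_kind = PureBlue | Unmixed | Mixed

text \<open>
  Items are numbered \<open>0, 1, \<dots>\<close> in order of arrival and bins in order of opening.  The label
  \<open>lab k\<close> is the type that item \<open>k\<close> currently counts as; it differs from the type of its size only
  if \<open>k\<close> was a bonus item that has been relabeled.  A relabeled item counts as \<open>mult k\<close> items.
  \<open>nf_bin\<close> is the current Next Fit bin.
\<close>

record eh_state =
  sizes :: "real list"
  bin_of :: "nat \<Rightarrow> nat"
  lab :: "nat \<Rightarrow> nat"
  col :: "nat \<Rightarrow> color"
  mult :: "nat \<Rightarrow> nat"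
  mrk :: "nat \<Rightarrow> mark option"
  nbins :: nat
  kind :: "nat \<Rightarrow> bin_kind"
  nf_bin :: "nat option"
  cnt :: "nat \<Rightarrow> nat"
  cnt_red :: "nat \<Rightarrow> nat"
  cnt_bonus :: "nat \<Rightarrow> nat"

definition init_state :: eh_state where
  "init_state =
     \<lparr>sizes = [], bin_of = (\<lambda>_. 0), lab = (\<lambda>_. 0), col = (\<lambda>_. Uncolored), mult = (\<lambda>_. 1),
      mrk = (\<lambda>_. None), nbins = 0, kind = (\<lambda>_. Unmixed), nf_bin = None,
      cnt = (\<lambda>_. 0), cnt_red = (\<lambda>_. 0), cnt_bonus = (\<lambda>_. 0)\<rparr>"

definition items :: "eh_state \<Rightarrow> nat set" where
  "items S = {..<length (sizes S)}"

definition content :: "eh_state \<Rightarrow> nat \<Rightarrow> nat set" where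
  "content S B = {k \<in> items S. bin_of S k = B}"

definition bins_used :: "eh_state \<Rightarrow> nat" where
  "bins_used S = card (bin_of S ` items S)"

definition capacity_for :: "eh_params \<Rightarrow> color \<Rightarrow> nat \<Rightarrow> nat" where
  "capacity_for P c i = (if c = Blue then bluefit P i else redfit P i)"

definition open_bin :: "eh_params \<Rightarrow> eh_state \<Rightarrow> color \<Rightarrow> nat \<Rightarrow> nat \<Rightarrow> bool" where
  "open_bin P S c i B \<longleftrightarrow>
     B < nbins S \<and>
     (\<forall>k\<in>content S B. col S k \<noteq> Bonus) \<and>
     (\<exists>k\<in>content S B. col S k = c \<and> lab S k = i) \<and>
     (\<Sum>k \<in> {k \<in> content S B. col S k = c}. mult S k) < capacity_for P c i"

definition red_compatible :: "eh_params \<Rightarrow> eh_state \<Rightarrow> real \<Rightarrow> nat \<Rightarrow> bool" where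
  "red_compatible P S p B \<longleftrightarrow>
     B < nbins S \<and> kind S B = Unmixed \<and>
     ((small p \<and> (\<exists>k\<in>content S B. col S k \<in> {Blue, Uncolored} \<and>
                      leaves P (lab S k) \<ge> needs P (type_of P p))) \<or>
      (medium p \<and> (\<exists>k\<in>content S B. large (sizes S ! k) \<and> p \<le> 1 - sizes S ! k)))"

definition blue_compatible :: "eh_params \<Rightarrow> eh_state \<Rightarrow> real \<Rightarrow> nat \<Rightarrow> bool" where
  "blue_compatible P S p B \<longleftrightarrow>
     B < nbins S \<and> kind S B = Unmixed \<and>
     ((\<exists>k\<in>content S B. col S k = Red \<and> leaves P (type_of P p) \<ge> needs P (lab S k)) \<or>
      (large p \<and> (\<exists>k\<in>content S B. col S k \<in> {Red, Uncolored} \<and> medium (sizes S ! k) \<and>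
                      p \<le> 1 - sizes S ! k)))"

definition compatible :: "eh_params \<Rightarrow> eh_state \<Rightarrow> color \<Rightarrow> real \<Rightarrow> nat \<Rightarrow> bool" where
  "compatible P S c p B \<longleftrightarrow> (if c = Blue then blue_compatible P S p B else red_compatible P S p B)"


section \<open>Packing an item\<close>

definition add_item :: "eh_state \<Rightarrow> real \<Rightarrow> nat \<Rightarrow> nat \<Rightarrow> color \<Rightarrow> eh_state" where
  "add_item S p i B c =
     (let k = length (sizes S) in
      S\<lparr>sizes := sizes S @ [p], bin_of := (bin_of S)(k := B), lab := (lab S)(k := i),
        col := (col S)(k := c), mult := (mult S)(k := 1), mrk := (mrk S)(k := None)\<rparr>)"

definition open_new_bin :: "eh_state \<Rightarrow> bin_kind \<Rightarrow> eh_state" where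
  "open_new_bin S kd = S\<lparr>nbins := Suc (nbins S), kind := (kind S)(nbins S := kd)\<rparr>"

definition make_mixed :: "eh_state \<Rightarrow> nat \<Rightarrow> color \<Rightarrow> eh_state" where
  "make_mixed S B c =
     S\<lparr>kind := (kind S)(B := Mixed),
       col := (\<lambda>k. if k \<in> content S B \<and> col S k = Uncolored then opposite c else col S k)\<rparr>"

text \<open>
  A pure blue bin contains only blue items, so a bin opened for an item that gets no color is
  unmixed, also if its type has \<open>leaves = 0\<close>.
\<close>

definition pack_new :: "eh_params \<Rightarrow> color \<Rightarrow> eh_state \<Rightarrow> real \<Rightarrow> eh_state" where
  "pack_new P c S p =
     (let i = type_of P p;
          c' = (if medium p \<and> redfrac P i > 0 then Uncolored else c);
          kd = (if leaves P i = 0 \<and> c' = Blue then PureBlue else Unmixed)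
      in add_item (open_new_bin S kd) p i (nbins S) c')"

definition pack :: "eh_params \<Rightarrow> color \<Rightarrow> eh_state \<Rightarrow> real \<Rightarrow> eh_state \<Rightarrow> bool" where
  "pack P c S p S' \<longleftrightarrow>
     (let i = type_of P p in
      if \<exists>B. open_bin P S c i B
      then \<exists>B. open_bin P S c i B \<and> S' = add_item S p i B c
      else if \<exists>B. compatible P S c p B
      then \<exists>B. compatible P S c p B \<and> S' = add_item (make_mixed S B c) p i B c
      else S' = pack_new P c S p)"

definition next_fit :: "eh_params \<Rightarrow> eh_state \<Rightarrow> real \<Rightarrow> eh_state" where
  "next_fit P S p =
     (case nf_bin S of
        Some B \<Rightarrow>
          if (\<Sum>k\<in>content S B. sizes S ! k) + p \<le> 1
          then add_item S p (ntypes P) B Blue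
          else (add_item (open_new_bin S PureBlue) p (ntypes P) (nbins S) Blue)\<lparr>nf_bin := Some (nbins S)\<rparr>
      | None \<Rightarrow>
          (add_item (open_new_bin S PureBlue) p (ntypes P) (nbins S) Blue)\<lparr>nf_bin := Some (nbins S)\<rparr>)"

definition relabel_bonus :: "eh_params \<Rightarrow> nat \<Rightarrow> nat \<Rightarrow> eh_state \<Rightarrow> eh_state" where
  "relabel_bonus P i b S =
     (let S1 = S\<lparr>cnt_bonus := (cnt_bonus S)(lab S b := cnt_bonus S (lab S b) - 1)\<rparr> in
      S1\<lparr>lab := (lab S1)(b := i), col := (col S1)(b := Red), mult := (mult S1)(b := redfit P i),
         cnt := (cnt S1)(i := cnt S1 i + redfit P i),
         cnt_red := (cnt_red S1)(i := cnt_red S1 i + redfit P i)\<rparr>)"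

definition pack_bonus :: "nat \<Rightarrow> real \<Rightarrow> nat \<Rightarrow> eh_state \<Rightarrow> eh_state" where
  "pack_bonus i p B S =
     (add_item (S\<lparr>kind := (kind S)(B := Mixed)\<rparr>) p i B Bonus)
       \<lparr>cnt := (cnt S)(i := cnt S i - 1), cnt_bonus := (cnt_bonus S)(i := cnt_bonus S i + 1)\<rparr>"

definition handle_item :: "eh_params \<Rightarrow> eh_state \<Rightarrow> real \<Rightarrow> eh_state \<Rightarrow> bool" where
  "handle_item P S p S' \<longleftrightarrow>
     (let i = type_of P p;
          S0 = S\<lparr>cnt := (cnt S)(i := cnt S i + 1)\<rparr>
      in
      if int (cnt_red S0 i) < \<lfloor>redfrac P i * real (cnt S0 i)\<rfloor>
      then
        (if cnt_bonus S0 i > 0 \<or>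
            (redspace P (needs P i) \<le> 1/3 \<and> (\<exists>j\<in>{1..<ntypes P}. cnt_bonus S0 j > 0))
         then \<exists>b\<in>items S0. col S0 b = Bonus \<and> cnt_bonus S0 (lab S0 b) > 0 \<and>
                (cnt_bonus S0 i > 0 \<longrightarrow> lab S0 b = i) \<and>
                pack P Blue (relabel_bonus P i b S0) p S'
         else \<exists>S1. pack P Red S0 p S1 \<and>
                S' = S1\<lparr>cnt_red := (cnt_red S1)(i := cnt_red S1 i + 1)\<rparr>)
      else
        (if medium p \<and> redfrac P i > 0 \<and> (\<exists>B. red_compatible P S0 p B)
         then \<exists>B. red_compatible P S0 p B \<and> S' = pack_bonus i p B S0
         else pack P Blue S0 p S'))"


section \<open>Mark and color\<close>

text \<open>The marked counters are the numbers of items they denote, hence are not stored in the state.\<close>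

definition cnt_mark :: "eh_state \<Rightarrow> nat \<Rightarrow> mark \<Rightarrow> nat" where
  "cnt_mark S i M = card {k \<in> items S. lab S k = i \<and> mrk S k = Some M}"

definition cnt_red_mark :: "eh_state \<Rightarrow> nat \<Rightarrow> mark \<Rightarrow> nat" where
  "cnt_red_mark S i M = card {k \<in> items S. lab S k = i \<and> mrk S k = Some M \<and> col S k = Red}"

definition uncolored_items :: "eh_state \<Rightarrow> nat \<Rightarrow> nat set" where
  "uncolored_items S i = {k \<in> items S. lab S k = i \<and> col S k = Uncolored}"

definition unmarked_blue :: "eh_state \<Rightarrow> nat \<Rightarrow> nat \<Rightarrow> nat set" where
  "unmarked_blue S i B = {k \<in> content S B. lab S k = i \<and> col S k = Blue \<and> mrk S k = None}"

definition set_mark :: "nat set \<Rightarrow> mark \<Rightarrow> eh_state \<Rightarrow> eh_state" where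
  "set_mark X M S = S\<lparr>mrk := (\<lambda>k. if k \<in> X then Some M else mrk S k)\<rparr>"

definition set_color :: "nat set \<Rightarrow> color \<Rightarrow> eh_state \<Rightarrow> eh_state" where
  "set_color X c S = S\<lparr>col := (\<lambda>k. if k \<in> X then c else col S k)\<rparr>"

definition inherits_mark :: "eh_state \<Rightarrow> nat \<Rightarrow> nat \<Rightarrow> mark \<Rightarrow> bool" where
  "inherits_mark S i k M \<longleftrightarrow>
     k \<in> unmarked_blue S i (bin_of S k) \<and>
     (\<exists>k'\<in>content S (bin_of S k). col S k' = Blue \<and> mrk S k' = Some M)"

definition mark_step1 :: "nat \<Rightarrow> eh_state \<Rightarrow> eh_state \<Rightarrow> bool" where
  "mark_step1 i S S' \<longleftrightarrow>
     (if \<exists>k M. inherits_mark S i k M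
      then \<exists>k M. inherits_mark S i k M \<and> S' = set_mark {k} M S
      else S' = S)"

text \<open>
  In the three remaining steps the minimum integer \<open>x\<close> is a number of items and is therefore taken
  over the natural numbers.
\<close>

definition mark_step2 :: "eh_params \<Rightarrow> nat \<Rightarrow> eh_state \<Rightarrow> eh_state \<Rightarrow> bool" where
  "mark_step2 P i S S' \<longleftrightarrow>
     (let x = (LEAST x::nat. \<lfloor>real (cnt_mark S i MarkR + 2 * x + 1) * redfrac P i\<rfloor>
                               > int (cnt_red_mark S i MarkR));
          U = uncolored_items S i;
          C = {k \<in> items S. lab S k = i \<and> mrk S k = None \<and> col S k \<in> {Red, Bonus} \<and>
                 kind S (bin_of S k) = Mixed}
      in
      if x \<le> card U \<and> C \<noteq> {}
      then \<exists>X b. X \<subseteq> U \<and> card X = x \<and> b \<in> C \<and>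
             ((\<exists>k\<in>C. col S k = Bonus) \<longrightarrow> col S b = Bonus) \<and>
             S' = (set_color {b} Red (set_color X Blue (set_mark (insert b X) MarkR S)))
                    \<lparr>cnt_bonus := (if col S b = Bonus then (cnt_bonus S)(i := cnt_bonus S i - 1)
                                   else cnt_bonus S)\<rparr>
      else S' = S)"

definition mark_step3 :: "eh_params \<Rightarrow> nat \<Rightarrow> eh_state \<Rightarrow> eh_state \<Rightarrow> bool" where
  "mark_step3 P i S S' \<longleftrightarrow>
     (let x = (LEAST x::nat. \<lfloor>real (cnt_mark S i MarkB + x + 1) * redfrac P i\<rfloor>
                               > int (cnt_red_mark S i MarkB));
          U = uncolored_items S i;
          good = (\<lambda>Bs. Bs \<subseteq> {B. B < nbins S \<and> kind S B = Mixed \<and> card (unmarked_blue S i B) = 2} \<and>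
                    2 * card Bs \<in> {x, x + 1})
      in
      if U \<noteq> {} \<and> (\<exists>Bs. good Bs)
      then \<exists>u Bs. u \<in> U \<and> good Bs \<and>
             S' = set_color {u} Red (set_mark (insert u (\<Union>B\<in>Bs. unmarked_blue S i B)) MarkB S)
      else S' = S)"

definition mark_step4 :: "eh_params \<Rightarrow> nat \<Rightarrow> eh_state \<Rightarrow> eh_state \<Rightarrow> bool" where
  "mark_step4 P i S S' \<longleftrightarrow>
     (let x = (LEAST x::nat. \<lfloor>real (cnt_mark S i MarkN + 2 * x + 1) * redfrac P i\<rfloor>
                               > int (cnt_red_mark S i MarkN));
          U = uncolored_items S i
      in
      if x + 1 \<le> card U
      then \<exists>X m. m \<in> U \<and> (\<forall>u\<in>U. sizes S ! m \<le> sizes S ! u) \<and>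
             X \<subseteq> U - {m} \<and> card X = x \<and> (\<forall>l\<in>X. \<forall>u\<in>U - X. sizes S ! u \<le> sizes S ! l) \<and>
             S' = set_color {m} Red (set_color X Blue (set_mark (insert m X) MarkN S))
      else S' = S)"

definition mark_and_color :: "eh_params \<Rightarrow> nat \<Rightarrow> eh_state \<Rightarrow> eh_state \<Rightarrow> bool" where
  "mark_and_color P i = mark_step1 i OO mark_step2 P i OO mark_step3 P i OO mark_step4 P i"

text \<open>The runs for different types do not interact, so their order is immaterial.\<close>

definition mark_and_color_all :: "eh_params \<Rightarrow> eh_state \<Rightarrow> eh_state \<Rightarrow> bool" where
  "mark_and_color_all P =
     foldr (\<lambda>i R. mark_and_color P i OO R)
       (filter (\<lambda>i. medium_type P i \<and> redfrac P i > 0) [1..<ntypes P]) (=)"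


section \<open>Extreme Harmonic algorithms\<close>

definition eh_step :: "eh_params \<Rightarrow> eh_state \<Rightarrow> real \<Rightarrow> eh_state \<Rightarrow> bool" where
  "eh_step P S p S' \<longleftrightarrow>
     (if type_of P p = ntypes P then S' = next_fit P S p
      else \<exists>S1. handle_item P S p S1 \<and> mark_and_color_all P S1 S')"

text \<open>
  A deterministic online algorithm: \<open>A \<sigma>\<close> is the configuration after the input \<open>\<sigma>\<close>.  Ties are
  broken arbitrarily, possibly depending on the whole history.
\<close>

definition extreme_harmonic :: "(real list \<Rightarrow> eh_state) \<Rightarrow> bool" where
  "extreme_harmonic A \<longleftrightarrow>
     (\<exists>P. eh_params_ok P \<and> A [] = init_state \<and>
        (\<forall>\<sigma> p. valid_input (\<sigma> @ [p]) \<longrightarrow> eh_step P (A \<sigma>) p (A (\<sigma> @ [p]))))"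

end

theory Submission
  imports Defs
begin

text \<open>
  Seven inputs suffice, built from sand (size at most \<open>t\<^sub>N\<close>) and items of size slightly above
  \<open>1/2\<close>, \<open>1/3\<close>, \<open>1/4\<close> and \<open>1/7\<close>.  Let \<open>\<mu>\<close>, \<open>\<beta>\<close>, \<open>\<gamma>\<close> be the red fractions of the last three types.
  Red items are worthless if they find no partner and save a bin if they do.  Inputs without large
  items bound \<open>\<beta>\<close> and \<open>\<gamma>\<close> from above.  The bins \<open>1/2 + 1/3 + sand\<close> and \<open>1/2 + 1/3 + 1/7 + sand\<close>,
  which cost at least \<open>1 + (1 - \<mu>)/2 + \<dots>\<close>, settle the case \<open>\<mu> < 0.1809\<close> and bound \<open>\<gamma>\<close> from below.

  Against a large \<open>\<mu>\<close> the adversary adapts the sizes of the medium items: an item that opens a bin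
  gets size \<open>r\<close>, an item that joins a bin gets the smaller size \<open>s\<close>.  All red medium items then have
  size \<open>r\<close>, so large items of size \<open>1 - s\<close> fit with none of them, whereas an offline packing combines
  each large item with an item of size \<open>s\<close> and packs the items of size \<open>r\<close> in pairs, each pair with an
  item of size slightly above \<open>1/4\<close> and sand.  The latter items come first: their red ones are joined
  by two medium items of size \<open>s\<close> each, and without this gain the bound would drop slightly below
  \<open>1.5762\<close>.  (If the parameters forbid such bins, two medium items, one such item and sand per
  offline bin already win.)
\<close>

text \<open>The argument is by contradiction: an input that does not force \<open>R\<close> yields
  an inequality in \<open>\<mu>\<close>, \<open>\<beta>\<close>, \<open>\<gamma>\<close>, and all of
  them together have no solution. The value 1.5762 is limited by the last case, where a quadratic in
  \<open>\<mu>\<close> is barely positive at 0.1809. The obstacle is that medium items are colored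
  late, through marks, whereas the counters move at arrival. Three observations handle this. In all
  inputs medium items precede large ones, so bonus items never arise, and until large items come no
  red medium item lies in a mixed bin, so \<open>MarkR\<close> does not occur. The minimality of
  \<open>x\<close> in steps 3 and 4 shows that the items really colored red lag behind their counter
  by at most 2. Conversely, in a run with medium items only, the red items are at most the fraction
  \<open>\<alpha>\<close> of a total in which each blue bin counts double, as step 4 anticipates.
  The adaptive adversary is possible because, as long as there is no large item, the state and the
  type of a medium item decide whether it opens a bin; its exact size has no influence. So the size
  can be chosen after the outcome is known.\<close>

locale eh_parameters =
  fixes P :: eh_params
  assumes ok: "eh_params_ok P"
begin

abbreviation "N \<equiv> ntypes P"
abbreviation "t \<equiv> thr P"

section \<open>Arithmetic of thresholds, types and red spaces\<close>

lemma N_ge: "3 \<le> N"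
  and thr_step: "\<And>i. 1 \<le> i \<Longrightarrow> i < N \<Longrightarrow> t (Suc i) < t i"
  and thr_N_pos: "0 < t N"
  and redspace_step: "\<And>k. 1 \<le> k \<Longrightarrow> k < nspaces P \<Longrightarrow> redspace P k \<le> redspace P (Suc k)"
  and leaves_le: "\<And>j. 1 \<le> j \<Longrightarrow> j \<le> N \<Longrightarrow> leaves P j \<le> nspaces P"
  and no_inner: "\<And>c j. c \<in> {1/2, 1/3, 2/3} \<Longrightarrow> 1 \<le> j \<Longrightarrow> j < N \<Longrightarrow> \<not> (t (Suc j) < c \<and> c < t j)"
  and needs_eq_0: "\<And>j. 1 \<le> j \<Longrightarrow> j \<le> N \<Longrightarrow> needs P j = 0 \<longleftrightarrow> redfrac P j = 0"
  and redfit_ge_1: "\<And>j. 1 \<le> j \<Longrightarrow> j \<le> N \<Longrightarrow> redfrac P j > 0 \<Longrightarrow> redfit P j \<ge> 1"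
  and redfit_medium: "\<And>j. 1 \<le> j \<Longrightarrow> j \<le> N \<Longrightarrow> redfrac P j > 0 \<Longrightarrow> medium_type P j \<Longrightarrow> redfit P j = 1"
  and leaves_bound: "\<And>j. 1 \<le> j \<Longrightarrow> j \<le> N \<Longrightarrow> leaves P j > 0 \<Longrightarrow>
        redspace P (leaves P j) \<le> 1 - real (bluefit P j) * t j"
  and small_needs: "\<And>j. 1 \<le> j \<Longrightarrow> j \<le> N \<Longrightarrow> small_type P j \<Longrightarrow> redfrac P j > 0 \<Longrightarrow>
        redspace P (needs P j) \<le> 1/3"
  and medium_leaves: "\<And>j. 1 \<le> j \<Longrightarrow> j \<le> N \<Longrightarrow> medium_type P j \<Longrightarrow> redspace P (leaves P j) < 1/3"
  and medium_needs: "\<And>j. 1 \<le> j \<Longrightarrow> j \<le> N \<Longrightarrow> medium_type P j \<Longrightarrow> redfrac P j > 0 \<Longrightarrow>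
        1/3 < redspace P (needs P j)"
  and redfrac_nonneg: "\<And>j. 1 \<le> j \<Longrightarrow> j \<le> N \<Longrightarrow> 0 \<le> redfrac P j"
  and redfrac_less: "\<And>j. 1 \<le> j \<Longrightarrow> j \<le> N \<Longrightarrow> redfrac P j < 1/3"
  and thr_1: "t 1 = 1" and thr_2: "t 2 = 2/3" and thr_3: "t 3 = 1/2"
  and redfrac_2: "redfrac P 2 = 0"
  and leaves_2: "redspace P (leaves P 2) = 1/3"
  and thr_N_less: "t N < 1/100"
  using ok unfolding eh_params_ok_def Let_def
  by ((elim conjE; simp only: Ball_def atLeastAtMost_iff atLeastLessThan_iff; blast)+)

lemma thr_antimono:
  assumes "1 \<le> i" "i \<le> j" "j \<le> N"
  shows "t j \<le> t i"
  using assms(2,1,3)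
proof (induction j rule: dec_induct)
  case (step n)
  then show ?case using thr_step[of n] by force
qed simp

lemma thr_pos: "1 \<le> j \<Longrightarrow> j \<le> N \<Longrightarrow> 0 < t j"
  using thr_antimono[of j N] thr_N_pos by force

lemma thr_le_1: "1 \<le> j \<Longrightarrow> j \<le> N \<Longrightarrow> t j \<le> 1"
  using thr_antimono[of 1 j] thr_1 by force

text \<open>Yields the type of all sizes slightly above \<open>c\<close>: the last threshold above
  \<open>c\<close> starts it. It is applied to 1/3, 1/4 and 1/7.\<close>

lemma exists_type_above:
  assumes "t N \<le> c" "c < 1"
  obtains j where "1 \<le> j" "j < N" "t (Suc j) \<le> c" "c < t j"
proof -
  define J where "J = {j. 1 \<le> j \<and> j \<le> N \<and> c < t j}"
  have f: "finite J" unfolding J_def by (rule finite_subset[of _ "{..N}"]) auto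
  have "1 \<in> J" using assms N_ge thr_1 unfolding J_def by auto
  then have m: "Max J \<in> J" using f Max_in by blast
  have "Suc (Max J) \<notin> J" using Max_ge[OF f, of "Suc (Max J)"] by auto
  moreover have "Max J \<noteq> N" using m assms unfolding J_def by auto
  ultimately show thesis using that[of "Max J"] m unfolding J_def by auto
qed

lemma type_of_eqI:
  assumes "1 \<le> j" "j < N" "t (Suc j) < s" "s \<le> t j"
  shows "type_of P s = j"
proof -
  have "t N \<le> t (Suc j)" using thr_antimono[of "Suc j" N] assms by auto
  then have "\<not> s \<le> t N" using assms by auto
  moreover have "(THE j. 1 \<le> j \<and> j < N \<and> t (Suc j) < s \<and> s \<le> t j) = j"
  proof (rule the_equality)
    fix k assume k: "1 \<le> k \<and> k < N \<and> t (Suc k) < s \<and> s \<le> t k"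
    show "k = j"
    proof (rule ccontr)
      assume "k \<noteq> j"
      then consider "Suc k \<le> j" | "Suc j \<le> k" by linarith
      then show False
        using thr_antimono[of "Suc k" j] thr_antimono[of "Suc j" k] k assms by cases auto
    qed
  qed (use assms in auto)
  ultimately show ?thesis unfolding type_of_def by auto
qed

lemma type_of_N: "s \<le> t N \<Longrightarrow> type_of P s = N"
  unfolding type_of_def by auto

lemma type_of_cases:
  assumes "0 < s" "s \<le> 1"
  obtains "type_of P s = N" "s \<le> t N"
  | j where "type_of P s = j" "1 \<le> j" "j < N" "t (Suc j) < s" "s \<le> t j"
proof (cases "s \<le> t N")
  case True then show ?thesis using that type_of_N by auto
next
  case False
  define J where "J = {j. 1 \<le> j \<and> j \<le> N \<and> s \<le> t j}"
  have f: "finite J" unfolding J_def by (rule finite_subset[of _ "{..N}"]) auto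
  have "1 \<in> J" using assms N_ge thr_1 unfolding J_def by auto
  then have m: "Max J \<in> J" using f Max_in by blast
  have "Suc (Max J) \<notin> J" using Max_ge[OF f, of "Suc (Max J)"] by auto
  moreover have "Max J \<noteq> N" using m False unfolding J_def by auto
  ultimately have "1 \<le> Max J" "Max J < N" "t (Suc (Max J)) < s" "s \<le> t (Max J)"
    using m unfolding J_def by auto
  then show ?thesis using that(2) type_of_eqI by blast
qed

lemma type_of_bounds:
  assumes "0 < s" "s \<le> 1" "type_of P s < N"
  shows "1 \<le> type_of P s" "t (Suc (type_of P s)) < s" "s \<le> t (type_of P s)"
  by (cases rule: type_of_cases[OF assms(1,2)]; use assms(3) in simp)+

text \<open>Neither 1/3 nor 1/2 is an inner point of a type interval. This reconciles the packing
  rules, which test sizes, with the marking rules, which test types.\<close>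

lemma medium_type_of:
  assumes "0 < s" "s \<le> 1" "type_of P s < N"
  shows "medium_type P (type_of P s) \<longleftrightarrow> medium s"
  using type_of_bounds[OF assms] no_inner[of "1/3" "type_of P s"] no_inner[of "1/2" "type_of P s"] assms(3)
  unfolding medium_type_def medium_def by auto

lemma redspace_mono:
  assumes "1 \<le> i" "i \<le> j" "j \<le> nspaces P"
  shows "redspace P i \<le> redspace P j"
  using assms(2,1,3)
proof (induction j rule: dec_induct)
  case (step n)
  then show ?case using redspace_step[of n] by force
qed simp

lemma bluefit_mult: "1 \<le> j \<Longrightarrow> j \<le> N \<Longrightarrow> 1 < (real (bluefit P j) + 1) * t j"
proof -
  assume a: "1 \<le> j" "j \<le> N"
  have p: "0 < t j" using thr_pos a by auto
  have "1 / t j < real_of_int \<lfloor>1 / t j\<rfloor> + 1" by linarith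
  moreover have "real (bluefit P j) = real_of_int \<lfloor>1 / t j\<rfloor>"
    unfolding bluefit_def using p by simp
  ultimately show ?thesis using p by (simp add: field_simps)
qed

lemma bluefit_pos: "1 \<le> j \<Longrightarrow> j \<le> N \<Longrightarrow> 1 \<le> bluefit P j"
  unfolding bluefit_def using thr_pos[of j] thr_le_1[of j] by (simp add: le_nat_iff le_floor_iff)

lemma redfit_mult: 
  assumes "1 \<le> j" "j \<le> N" "redfrac P j > 0"
  shows "real (redfit P j) * t j \<le> redspace P (needs P j)"
proof -
  have p: "0 < t j" using thr_pos assms by auto
  have "1 \<le> redfit P j" using redfit_ge_1 assms by auto
  then have "real (redfit P j) = real_of_int \<lfloor>redspace P (needs P j) / t j\<rfloor>"
    unfolding redfit_def by linarith
  then have "real (redfit P j) \<le> redspace P (needs P j) / t j" by linarith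
  then show ?thesis using p by (simp add: field_simps)
qed

text \<open>As \<open>needs P j\<close> is positive, so is \<open>leaves P i\<close>, and the spaces
  compare by monotonicity. The last bound holds because beside \<open>bluefit\<close> items of the
  largest size there is no room for another one.\<close>

lemma redspace_le_leaves:
  assumes "1 \<le> i" "i \<le> N" "1 \<le> j" "j \<le> N" "redfrac P j > 0" "needs P j \<le> leaves P i"
  shows "redspace P (needs P j) \<le> redspace P (leaves P i)"
    "redspace P (leaves P i) \<le> 1 - real (bluefit P i) * t i"
    "redspace P (leaves P i) < t i"
proof -
  have n: "1 \<le> needs P j" using needs_eq_0[of j] assms by auto
  then show "redspace P (needs P j) \<le> redspace P (leaves P i)"
    using redspace_mono assms leaves_le[of i] by auto
  show b: "redspace P (leaves P i) \<le> 1 - real (bluefit P i) * t i"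
    using leaves_bound[of i] assms n by auto
  show "redspace P (leaves P i) < t i"
    using b bluefit_mult[of i] assms by (simp add: algebra_simps)
qed

text \<open>A group of red items of type \<open>j\<close> asks for at least
  \<open>redfit P j * t j\<close>, but blue items of type \<open>i\<close> leave less than
  \<open>t i\<close>.\<close>

lemma no_small_host:
  assumes "1 \<le> i" "i \<le> N" "1 \<le> j" "j \<le> N" "redfrac P j > 0" "t i \<le> real (redfit P j) * t j"
  shows "\<not> needs P j \<le> leaves P i"
  using redspace_le_leaves[OF assms(1-5)] redfit_mult[OF assms(3-5)] assms(6) by force

text \<open>A red medium item needs more than 1/3. Type 2 leaves exactly 1/3, medium types leave
  less by assumption, and types with threshold at most 1/3 leave less than one of their own items.
  Hence only the rule comparing exact sizes can put a red medium item beside a blue item of such a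
  type.\<close>

lemma no_medium_host:
  assumes "1 \<le> i" "i \<le> N" "1 \<le> j" "j \<le> N" "redfrac P j > 0" "medium_type P j"
    and "medium_type P i \<or> t i \<le> 1/3 \<or> i = 2"
  shows "\<not> needs P j \<le> leaves P i"
  using redspace_le_leaves[OF assms(1-5)] medium_needs[OF assms(3,4,6,5)] assms(7)
    medium_leaves[OF assms(1,2)] leaves_2 by force

end

section \<open>The invariant of states without bonus items and sand\<close>

definition hosts :: "eh_params \<Rightarrow> eh_state \<Rightarrow> nat \<Rightarrow> nat \<Rightarrow> bool" where
  "hosts P S k k' \<longleftrightarrow> needs P (lab S k') \<le> leaves P (lab S k) \<or>
     (large (sizes S ! k) \<and> medium (sizes S ! k') \<and> sizes S ! k + sizes S ! k' \<le> 1)"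

definition colored :: "eh_state \<Rightarrow> nat \<Rightarrow> color \<Rightarrow> nat set" where
  "colored S B c = {k \<in> content S B. col S k = c}"

definition labeled :: "eh_state \<Rightarrow> nat \<Rightarrow> nat set" where
  "labeled S i = {k \<in> items S. lab S k = i}"

text \<open>Since nothing is relabeled, labels are types and all multiplicities are 1. By
  \<open>unc\<close> an uncolored item is alone in its bin, which makes later coloring harmless. The
  field \<open>mix\<close> keeps, through \<open>hosts\<close>, the two ways in which a blue item
  \<open>k\<close> and a red item \<open>k'\<close> can have become compatible: by type or by exact
  size. \<open>red_cnt\<close> omits medium types, whose actual red items need not agree with the
  counter.\<close>

locale regular =
  fixes P :: eh_params and S :: eh_state
  assumes item: "k \<in> items S \<Longrightarrow> 0 < sizes S ! k \<and> sizes S ! k \<le> 1 \<and> lab S k = type_of P (sizes S ! k) \<and>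
      lab S k < ntypes P \<and> mult S k = 1 \<and> col S k \<noteq> Bonus \<and> bin_of S k < nbins S"
    and bonus: "cnt_bonus S i = 0"
    and nf: "nf_bin S = None"
    and same: "k \<in> items S \<Longrightarrow> k' \<in> items S \<Longrightarrow> bin_of S k = bin_of S k' \<Longrightarrow> col S k = col S k' \<Longrightarrow>
      lab S k = lab S k'"
    and cap: "k \<in> items S \<Longrightarrow> col S k \<in> {Blue, Red} \<Longrightarrow>
      card (colored S (bin_of S k) (col S k)) \<le> capacity_for P (col S k) (lab S k)"
    and unc: "k \<in> items S \<Longrightarrow> col S k = Uncolored \<Longrightarrow>
      content S (bin_of S k) = {k} \<and> medium (sizes S ! k) \<and> redfrac P (lab S k) > 0"
    and red: "k \<in> items S \<Longrightarrow> col S k = Red \<Longrightarrow> redfrac P (lab S k) > 0"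
    and mix: "k \<in> items S \<Longrightarrow> k' \<in> items S \<Longrightarrow> bin_of S k = bin_of S k' \<Longrightarrow> col S k = Blue \<Longrightarrow>
      col S k' = Red \<Longrightarrow> kind S (bin_of S k) = Mixed \<and> hosts P S k k'"
    and mixed: "B < nbins S \<Longrightarrow> kind S B = Mixed \<Longrightarrow> colored S B Blue \<noteq> {} \<and> colored S B Red \<noteq> {}"
    and pure: "k \<in> items S \<Longrightarrow> kind S (bin_of S k) = PureBlue \<Longrightarrow> col S k = Blue"
    and cnt: "cnt S i = card (labeled S i)"
    and cnt_red: "1 \<le> i \<Longrightarrow> i < ntypes P \<Longrightarrow> int (cnt_red S i) = \<lfloor>redfrac P i * real (cnt S i)\<rfloor>"
    and red_cnt: "\<not> medium_type P i \<Longrightarrow> card {k \<in> labeled S i. col S k = Red} = cnt_red S i"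

lemma content_iff [simp]: "k \<in> content S B \<longleftrightarrow> k \<in> items S \<and> bin_of S k = B"
  unfolding content_def by auto

lemma colored_iff [simp]: "k \<in> colored S B c \<longleftrightarrow> k \<in> items S \<and> bin_of S k = B \<and> col S k = c"
  unfolding colored_def by auto

lemma labeled_iff [simp]: "k \<in> labeled S i \<longleftrightarrow> k \<in> items S \<and> lab S k = i"
  unfolding labeled_def by auto

lemma finite_items [simp]: "finite (items S)"
  unfolding items_def by auto

lemma finite_content [simp]: "finite (content S B)"
  unfolding content_def by auto

lemma finite_colored [simp]: "finite (colored S B c)"
  unfolding colored_def by auto

lemma finite_labeled [simp]: "finite (labeled S i)"
  unfolding labeled_def by auto

lemma unmarked_blue_iff [simp]:
  "k \<in> unmarked_blue S i B \<longleftrightarrow> k \<in> labeled S i \<and> bin_of S k = B \<and> col S k = Blue \<and> mrk S k = None"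
  unfolding unmarked_blue_def by auto

lemma finite_unmarked_blue [simp]: "finite (unmarked_blue S i B)"
  unfolding unmarked_blue_def by simp

lemma uncolored_items_iff [simp]: "k \<in> uncolored_items S i \<longleftrightarrow> k \<in> labeled S i \<and> col S k = Uncolored"
  unfolding uncolored_items_def by auto

lemma finite_uncolored_items [simp]: "finite (uncolored_items S i)"
  unfolding uncolored_items_def by simp

lemma uncolored_items_alt: "uncolored_items S i = {k \<in> labeled S i. col S k = Uncolored}"
  by auto

definition reds :: "eh_state \<Rightarrow> nat \<Rightarrow> nat set" where
  "reds S i = {k \<in> labeled S i. col S k = Red}"

definition blues :: "eh_state \<Rightarrow> nat \<Rightarrow> nat set" where
  "blues S i = {k \<in> labeled S i. col S k = Blue}"

lemma finite_reds [simp]: "finite (reds S i)"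
  unfolding reds_def by simp

lemma finite_blues [simp]: "finite (blues S i)"
  unfolding blues_def by simp

lemma regular_init: "regular P init_state"
  by unfold_locales (auto simp: init_state_def items_def labeled_def colored_def)

lemma color_cases: "c \<noteq> Bonus \<Longrightarrow> c = Blue \<or> c = Red \<or> c = Uncolored"
  by (cases c) auto

section \<open>Recoloring\<close>

text \<open>The effect of marking in the absence of bonus items. Marks are left unconstrained, so
  that the relation is transitive and covers any sequence of marking steps.\<close>

definition recolored :: "eh_state \<Rightarrow> eh_state \<Rightarrow> bool" where
  "recolored S S' \<longleftrightarrow> sizes S' = sizes S \<and> bin_of S' = bin_of S \<and> lab S' = lab S \<and> mult S' = mult S \<and>
     nbins S' = nbins S \<and> kind S' = kind S \<and> nf_bin S' = nf_bin S \<and> cnt S' = cnt S \<and>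
     cnt_red S' = cnt_red S \<and> cnt_bonus S' = cnt_bonus S \<and>
     (\<forall>k. col S' k = col S k \<or> k \<in> items S \<and> col S k = Uncolored \<and> col S' k \<in> {Blue, Red})"

lemma recolored_refl [simp]: "recolored S S"
  unfolding recolored_def by auto

lemma recolored_trans: "recolored S S' \<Longrightarrow> recolored S' S'' \<Longrightarrow> recolored S S''"
  unfolding recolored_def items_def
  apply (elim conjE)
  apply (intro conjI)
  apply (simp_all only:)
  apply (rule allI)
  subgoal for k
    apply (drule spec[of _ k])+
    apply auto
    done
  done

lemma recolored_color: "recolored S S' \<Longrightarrow> col S k \<noteq> Uncolored \<Longrightarrow> col S' k = col S k"
  unfolding recolored_def by metis

lemma recolored_items: "recolored S S' \<Longrightarrow> items S' = items S \<and> content S' = content S \<and> labeled S' = labeled S"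
  unfolding recolored_def items_def content_def labeled_def by (auto simp: fun_eq_iff)

text \<open>A newly colored item is alone in its bin, so every condition on bins reduces to a
  capacity of at least 1. Types that are not medium have no uncolored items and therefore keep their
  red counts.\<close>

lemma (in eh_parameters) recolored_regular:
  assumes "regular P S" "recolored S S'"
  shows "regular P S'"
proof -
  interpret regular P S by fact
  note r = assms(2)[unfolded recolored_def]
  have eqs: "sizes S' = sizes S" "bin_of S' = bin_of S" "lab S' = lab S" "mult S' = mult S"
     "nbins S' = nbins S" "kind S' = kind S" "nf_bin S' = nf_bin S" "cnt S' = cnt S"
     "cnt_red S' = cnt_red S" "cnt_bonus S' = cnt_bonus S"
     "items S' = items S" "content S' = content S" "labeled S' = labeled S"
    using r recolored_items[OF assms(2)] by blast+
  have col: "col S' k = col S k \<or> k \<in> items S \<and> col S k = Uncolored \<and> (col S' k = Blue \<or> col S' k = Red)" for k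
    using r by blast
  have keep: "col S k \<noteq> Uncolored \<Longrightarrow> col S' k = col S k" for k
    using col by blast
  have single: "content S (bin_of S k) = {k}" "colored S' (bin_of S k) (col S' k) = {k}"
    if "k \<in> items S" "col S k = Uncolored" for k
  proof -
    show 1: "content S (bin_of S k) = {k}" using unc[OF that] by simp
    show "colored S' (bin_of S k) (col S' k) = {k}"
      unfolding colored_def eqs 1 by auto
  qed
  have eqcol: "colored S' B c = colored S B c" if h: "\<forall>k\<in>content S B. col S k \<noteq> Uncolored" for B c
    unfolding colored_def eqs using h keep by fastforce
  have alone: "k = k'" if "k \<in> items S" "k' \<in> items S" "bin_of S k = bin_of S k'" "col S k = Uncolored" for k k'
  proof -
    have "k' \<in> content S (bin_of S k)" using that by simp
    then show ?thesis unfolding single(1)[OF that(1,4)] by simp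
  qed
  have lab: "1 \<le> lab S k" "lab S k < N" "medium_type P (lab S k) \<longleftrightarrow> medium (sizes S ! k)" if "k \<in> items S" for k
    using item[OF that] type_of_bounds(1) medium_type_of by auto
  show ?thesis
  proof (unfold_locales, unfold eqs)
    fix k assume k: "k \<in> items S"
    show "0 < sizes S ! k \<and> sizes S ! k \<le> 1 \<and> lab S k = type_of P (sizes S ! k) \<and>
      lab S k < N \<and> mult S k = 1 \<and> col S' k \<noteq> Bonus \<and> bin_of S k < nbins S"
      using item[OF k] col[of k] by auto
  next
    fix k k' assume a: "k \<in> items S" "k' \<in> items S" "bin_of S k = bin_of S k'" "col S' k = col S' k'"
    show "lab S k = lab S k'"
    proof (cases "col S k = Uncolored \<or> col S k' = Uncolored")
      case True then show ?thesis using alone[OF a(1-3)] alone[OF a(2,1) a(3)[symmetric]] by auto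
    next
      case False then show ?thesis using same[OF a(1-3)] keep a(4) by metis
    qed
  next
    fix k assume ki: "k \<in> items S" and c: "col S' k \<in> {Blue, Red}"
    show "card (colored S' (bin_of S k) (col S' k)) \<le> capacity_for P (col S' k) (lab S k)"
    proof (cases "col S k = Uncolored")
      case True
      have "1 \<le> capacity_for P (col S' k) (lab S k)"
        using c bluefit_pos[of "lab S k"] redfit_ge_1[of "lab S k"] lab[OF ki] unc[OF ki True]
        unfolding capacity_for_def by auto
      then show ?thesis using single(2)[OF ki True] by simp
    next
      case False
      have e: "col S' k = col S k" using keep[OF False] .
      have "\<forall>k'\<in>content S (bin_of S k). col S k' \<noteq> Uncolored"
      proof (intro ballI notI)
        fix k' assume k': "k' \<in> content S (bin_of S k)" "col S k' = Uncolored"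
        then have "k' = k" using alone[of k' k] ki by simp
        then show "False" using k' False by simp
      qed
      then show ?thesis using cap[OF ki] eqcol e c by simp
    qed
  next
    fix k assume "k \<in> items S" "col S' k = Uncolored"
    then show "content S (bin_of S k) = {k} \<and> medium (sizes S ! k) \<and> redfrac P (lab S k) > 0"
      using unc[of k] col[of k] by simp
  next
    fix k assume "k \<in> items S" "col S' k = Red"
    then show "redfrac P (lab S k) > 0"
      using unc[of k] red[of k] col[of k] by auto
  next
    fix k k' assume a: "k \<in> items S" "k' \<in> items S" "bin_of S k = bin_of S k'" "col S' k = Blue" "col S' k' = Red"
    then have "k \<noteq> k'" by auto
    then have "col S k \<noteq> Uncolored" "col S k' \<noteq> Uncolored"
      using alone[OF a(1-3)] alone[OF a(2,1) a(3)[symmetric]] by auto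
    then have "kind S (bin_of S k) = Mixed \<and> hosts P S k k'"
      using mix[OF a(1-3)] keep a by metis
    then show "kind S (bin_of S k) = Mixed \<and> hosts P S' k k'"
      unfolding hosts_def eqs .
  next
    fix B assume "B < nbins S" "kind S B = Mixed"
    then have "colored S B Blue \<noteq> {} \<and> colored S B Red \<noteq> {}" using mixed by blast
    moreover have "c \<noteq> Uncolored \<Longrightarrow> colored S B c \<subseteq> colored S' B c" for c
      unfolding colored_def eqs using keep by auto
    ultimately show "colored S' B Blue \<noteq> {} \<and> colored S' B Red \<noteq> {}"
      by blast
  next
    fix k assume "k \<in> items S" "kind S (bin_of S k) = PureBlue"
    then show "col S' k = Blue" using pure[of k] keep by auto
  next
    fix i assume i: "\<not> medium_type P i"
    have "col S' k = Red \<longleftrightarrow> col S k = Red" if "k \<in> labeled S i" for k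
    proof -
      have "col S k \<noteq> Uncolored" using unc[of k] lab[of k] that i by auto
      then show ?thesis using keep by simp
    qed
    then have "{k \<in> labeled S i. col S' k = Red} = {k \<in> labeled S i. col S k = Red}" by blast
    then show "card {k \<in> labeled S i. col S' k = Red} = cnt_red S i" using red_cnt[OF i] by simp
  qed (use bonus nf cnt cnt_red in auto)
qed

lemma set_mark_sel [simp]:
  "sizes (set_mark X M S) = sizes S" "bin_of (set_mark X M S) = bin_of S" "lab (set_mark X M S) = lab S"
  "col (set_mark X M S) = col S" "mult (set_mark X M S) = mult S" "nbins (set_mark X M S) = nbins S"
  "kind (set_mark X M S) = kind S" "nf_bin (set_mark X M S) = nf_bin S" "cnt (set_mark X M S) = cnt S"
  "cnt_red (set_mark X M S) = cnt_red S" "cnt_bonus (set_mark X M S) = cnt_bonus S"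
  "mrk (set_mark X M S) = (\<lambda>k. if k \<in> X then Some M else mrk S k)"
  unfolding set_mark_def by simp_all

lemma set_color_sel [simp]:
  "sizes (set_color X c S) = sizes S" "bin_of (set_color X c S) = bin_of S" "lab (set_color X c S) = lab S"
  "mrk (set_color X c S) = mrk S" "mult (set_color X c S) = mult S" "nbins (set_color X c S) = nbins S"
  "kind (set_color X c S) = kind S" "nf_bin (set_color X c S) = nf_bin S" "cnt (set_color X c S) = cnt S"
  "cnt_red (set_color X c S) = cnt_red S" "cnt_bonus (set_color X c S) = cnt_bonus S"
  "col (set_color X c S) = (\<lambda>k. if k \<in> X then c else col S k)"
  unfolding set_color_def by simp_all

lemma mark_step1_recolored: "mark_step1 i S S' \<Longrightarrow> recolored S S'"
  unfolding mark_step1_def set_mark_def recolored_def by (auto split: if_splits)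

text \<open>Step 2 alone touches \<open>cnt_bonus\<close>, and only when it picks a bonus item.
  Without bonus items the chosen item is red already, so coloring it red changes nothing.\<close>

lemma mark_step2_recolored:
  assumes "\<forall>k\<in>items S. col S k \<noteq> Bonus" "mark_step2 P i S S'"
  shows "recolored S S'"
proof -
  define U where "U = uncolored_items S i"
  define C where "C = {k \<in> items S. lab S k = i \<and> mrk S k = None \<and> col S k \<in> {Red, Bonus} \<and>
                 kind S (bin_of S k) = Mixed}"
  have "S' = S \<or> (\<exists>X b. X \<subseteq> U \<and> b \<in> C \<and> S' = (set_color {b} Red (set_color X Blue (set_mark (insert b X) MarkR S)))
                    \<lparr>cnt_bonus := (if col S b = Bonus then (cnt_bonus S)(i := cnt_bonus S i - 1)
                                   else cnt_bonus S)\<rparr>)"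
    using assms(2) unfolding mark_step2_def Let_def U_def[symmetric] C_def[symmetric]
    by (auto split: if_splits)
  then show ?thesis
  proof (elim disjE exE conjE)
    fix X b assume X: "X \<subseteq> U" and b: "b \<in> C" and S': "S' = (set_color {b} Red (set_color X Blue (set_mark (insert b X) MarkR S)))
                    \<lparr>cnt_bonus := (if col S b = Bonus then (cnt_bonus S)(i := cnt_bonus S i - 1)
                                   else cnt_bonus S)\<rparr>"
    have "col S b = Red" "b \<in> items S" using b assms(1) unfolding C_def by auto
    then show ?thesis using X unfolding S' recolored_def set_color_def set_mark_def U_def uncolored_items_def
      by auto
  qed auto
qed

lemma mark_step3_recolored: "mark_step3 P i S S' \<Longrightarrow> recolored S S'"
  unfolding mark_step3_def Let_def set_mark_def set_color_def recolored_def uncolored_items_def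
  by (auto split: if_splits)

lemma mark_step4_recolored:
  assumes "mark_step4 P i S S'" shows "recolored S S'"
proof -
  have "S' = S \<or> (\<exists>X m. m \<in> uncolored_items S i \<and> X \<subseteq> uncolored_items S i - {m} \<and>
      S' = set_color {m} Red (set_color X Blue (set_mark (insert m X) MarkN S)))"
    using assms unfolding mark_step4_def Let_def by (simp only: split: if_splits) blast+
  then show ?thesis
  proof (elim disjE exE conjE)
    fix X m assume "m \<in> uncolored_items S i" "X \<subseteq> uncolored_items S i - {m}"
      and S': "S' = set_color {m} Red (set_color X Blue (set_mark (insert m X) MarkN S))"
    then show ?thesis
      unfolding recolored_def uncolored_items_def by auto
  qed simp
qed

lemma mark_and_color_recolored:
  assumes "\<forall>k\<in>items S. col S k \<noteq> Bonus" "mark_and_color P i S S'"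
  shows "recolored S S'"
proof -
  obtain S1 S2 S3 where s: "mark_step1 i S S1" "mark_step2 P i S1 S2" "mark_step3 P i S2 S3" "mark_step4 P i S3 S'"
    using assms(2) unfolding mark_and_color_def by auto
  have r1: "recolored S S1" using mark_step1_recolored[OF s(1)] .
  have "\<forall>k\<in>items S1. col S1 k \<noteq> Bonus"
    using r1 assms(1) unfolding recolored_def items_def by (metis color.distinct insert_iff empty_iff)
  then show ?thesis
    using r1 mark_step2_recolored[OF _ s(2)] mark_step3_recolored[OF s(3)] mark_step4_recolored[OF s(4)]
      recolored_trans by blast
qed

lemma recolored_no_bonus:
  "recolored S S' \<Longrightarrow> \<forall>k\<in>items S. col S k \<noteq> Bonus \<Longrightarrow> \<forall>k\<in>items S'. col S' k \<noteq> Bonus"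
  unfolding recolored_def items_def by (metis color.distinct insert_iff empty_iff)

lemma mark_and_color_all_recolored:
  assumes "\<forall>k\<in>items S. col S k \<noteq> Bonus" "mark_and_color_all P S S'"
  shows "recolored S S'"
proof -
  have "foldr (\<lambda>i R. mark_and_color P i OO R) is (=) S S' \<Longrightarrow> \<forall>k\<in>items S. col S k \<noteq> Bonus \<Longrightarrow> recolored S S'" for "is" S
  proof (induction "is" arbitrary: S)
    case (Cons i "is")
    then obtain T where T: "mark_and_color P i S T" "foldr (\<lambda>i R. mark_and_color P i OO R) is (=) T S'" by auto
    then show ?case
      using Cons mark_and_color_recolored recolored_no_bonus recolored_trans by blast
  qed auto
  then show ?thesis using assms unfolding mark_and_color_all_def by blast
qed

section \<open>The effect of packing a single item\<close>

definition case_A :: "eh_params \<Rightarrow> eh_state \<Rightarrow> nat \<Rightarrow> bool" where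
  "case_A P S i \<longleftrightarrow> int (cnt_red S i) < \<lfloor>redfrac P i * real (Suc (cnt S i))\<rfloor>"

text \<open>What the three outcomes of \<open>pack\<close> have in common. Both counter updates of
  the main loop are included, although they happen before and after the call of
  \<open>pack\<close>.\<close>

definition appended :: "eh_params \<Rightarrow> color \<Rightarrow> eh_state \<Rightarrow> real \<Rightarrow> nat \<Rightarrow> eh_state \<Rightarrow> bool" where
  "appended P c S p B S' \<longleftrightarrow>
     (let k = length (sizes S); i = type_of P p in
      sizes S' = sizes S @ [p] \<and> bin_of S' = (bin_of S)(k := B) \<and> lab S' = (lab S)(k := i) \<and>
      mult S' = (mult S)(k := 1) \<and> mrk S' = (mrk S)(k := None) \<and> nf_bin S' = nf_bin S \<and>
      cnt_bonus S' = cnt_bonus S \<and> cnt S' = (cnt S)(i := Suc (cnt S i)) \<and>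
      cnt_red S' = (if c = Red then (cnt_red S)(i := Suc (cnt_red S i)) else cnt_red S))"

definition to_open :: "eh_params \<Rightarrow> color \<Rightarrow> eh_state \<Rightarrow> real \<Rightarrow> nat \<Rightarrow> eh_state \<Rightarrow> bool" where
  "to_open P c S p B S' \<longleftrightarrow> appended P c S p B S' \<and> open_bin P S c (type_of P p) B \<and>
     col S' = (col S)(length (sizes S) := c) \<and> kind S' = kind S \<and> nbins S' = nbins S"

definition to_compat :: "eh_params \<Rightarrow> color \<Rightarrow> eh_state \<Rightarrow> real \<Rightarrow> nat \<Rightarrow> eh_state \<Rightarrow> bool" where
  "to_compat P c S p B S' \<longleftrightarrow> appended P c S p B S' \<and> (\<nexists>B. open_bin P S c (type_of P p) B) \<and>
     compatible P S c p B \<and>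
     col S' = (\<lambda>k. if k = length (sizes S) then c
                   else if k \<in> content S B \<and> col S k = Uncolored then opposite c else col S k) \<and>
     kind S' = (kind S)(B := Mixed) \<and> nbins S' = nbins S"

definition to_new :: "eh_params \<Rightarrow> color \<Rightarrow> eh_state \<Rightarrow> real \<Rightarrow> nat \<Rightarrow> eh_state \<Rightarrow> bool" where
  "to_new P c S p B S' \<longleftrightarrow>
     (let i = type_of P p; c' = (if medium p \<and> redfrac P i > 0 then Uncolored else c) in
      appended P c S p B S' \<and> (\<nexists>B. open_bin P S c i B) \<and> (\<nexists>B. compatible P S c p B) \<and>
      B = nbins S \<and> col S' = (col S)(length (sizes S) := c') \<and>
      kind S' = (kind S)(nbins S := (if leaves P i = 0 \<and> c' = Blue then PureBlue else Unmixed)) \<and>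
      nbins S' = Suc (nbins S))"

lemma items_cnt [simp]: "items (S\<lparr>cnt := f\<rparr>) = items S" "content (S\<lparr>cnt := f\<rparr>) = content S"
  unfolding items_def content_def by (auto simp: items_def)

lemma open_bin_cnt [simp]: "open_bin P (S\<lparr>cnt := f\<rparr>) = open_bin P S"
  unfolding open_bin_def by (auto simp: fun_eq_iff)

lemma compatible_cnt [simp]: "compatible P (S\<lparr>cnt := f\<rparr>) = compatible P S"
  "red_compatible P (S\<lparr>cnt := f\<rparr>) = red_compatible P S"
  unfolding compatible_def blue_compatible_def red_compatible_def by (auto simp: fun_eq_iff)

lemma pack_effect:
  assumes "pack P c (S\<lparr>cnt := (cnt S)(i := Suc (cnt S i))\<rparr>) p S1" "i = type_of P p" "c \<in> {Blue, Red}"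
    and "S' = (if c = Red then S1\<lparr>cnt_red := (cnt_red S1)(i := Suc (cnt_red S1 i))\<rparr> else S1)"
  shows "\<exists>B. to_open P c S p B S' \<or> to_compat P c S p B S' \<or> to_new P c S p B S'"
proof -
  define S0 where "S0 = S\<lparr>cnt := (cnt S)(i := Suc (cnt S i))\<rparr>"
  have a: "appended P c S p B S'" if "S1 = add_item T p i B c'"
    "sizes T = sizes S" "bin_of T = bin_of S" "lab T = lab S" "mult T = mult S" "mrk T = mrk S"
    "nf_bin T = nf_bin S" "cnt_bonus T = cnt_bonus S" "cnt T = cnt S0" "cnt_red T = cnt_red S" for T B c'
    unfolding appended_def Let_def using that assms(2-4) unfolding S0_def
    by (auto simp: add_item_def Let_def)
 have o: "open_bin P S0 = open_bin P S" "compatible P S0 = compatible P S"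
    unfolding S0_def by simp_all
  have pk: "if \<exists>B. open_bin P S c i B then \<exists>B. open_bin P S c i B \<and> S1 = add_item S0 p i B c
      else if \<exists>B. compatible P S c p B then \<exists>B. compatible P S c p B \<and> S1 = add_item (make_mixed S0 B c) p i B c
      else S1 = pack_new P c S0 p"
    using assms(1) unfolding pack_def Let_def assms(2)[symmetric] S0_def[symmetric] o .
  have sel: "col S' = col S1" "kind S' = kind S1" "nbins S' = nbins S1" using assms(4) by auto
  consider "\<exists>B. open_bin P S c i B" | "\<nexists>B. open_bin P S c i B" "\<exists>B. compatible P S c p B"
    | "\<nexists>B. open_bin P S c i B" "\<nexists>B. compatible P S c p B" by blast
  then show ?thesis
  proof cases
    case 1
    then obtain B where B: "open_bin P S c i B" "S1 = add_item S0 p i B c"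
      using pk by auto
    have "to_open P c S p B S'"
      unfolding to_open_def using B assms(2) a[OF B(2)]
      by (auto simp: sel S0_def add_item_def Let_def)
    then show ?thesis by blast
  next
    case 2
    then obtain B where B: "compatible P S c p B" "S1 = add_item (make_mixed S0 B c) p i B c"
      using pk by auto
    have "to_compat P c S p B S'"
      unfolding to_compat_def using 2 B assms(2) a[OF B(2)]
      by (auto simp: sel S0_def add_item_def make_mixed_def Let_def fun_eq_iff)
    then show ?thesis by blast
  next
    case 3
    then have B: "S1 = pack_new P c S0 p"
      using pk by auto
    define c' where "c' = (if medium p \<and> redfrac P i > 0 then Uncolored else c)"
    define kd where "kd = (if leaves P i = 0 \<and> c' = Blue then PureBlue else Unmixed)"
    have B': "S1 = add_item (open_new_bin S0 kd) p i (nbins S) c'"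
      using B assms(2) unfolding pack_new_def Let_def kd_def c'_def S0_def by simp
    have "appended P c S p (nbins S) S'"
      by (rule a[OF B']) (simp_all add: open_new_bin_def S0_def)
    then have "to_new P c S p (nbins S) S'"
      unfolding to_new_def Let_def assms(2)[symmetric] c'_def[symmetric] kd_def[symmetric]
      using 3 by (simp add: sel B' S0_def add_item_def open_new_bin_def Let_def)
    then show ?thesis by blast
  qed
qed

text \<open>Both branches with bonus items are closed: all \<open>cnt_bonus\<close> are 0, and a
  medium item could become a bonus item only beside a large item, which the hypothesis
  excludes.\<close>

lemma (in regular) handle_effect:
  assumes "handle_item P S p S'" "medium p \<Longrightarrow> \<forall>k\<in>items S. \<not> large (sizes S ! k)"
  shows "\<exists>c B. c = (if case_A P S (type_of P p) then Red else Blue) \<and>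
     (to_open P c S p B S' \<or> to_compat P c S p B S' \<or> to_new P c S p B S')"
proof -
  define i where "i = type_of P p"
  define S0 where "S0 = S\<lparr>cnt := (cnt S)(i := Suc (cnt S i))\<rparr>"
  have nb: "cnt_bonus S0 = (\<lambda>_. 0)" using bonus unfolding S0_def by auto
  have nc: "\<not> (medium p \<and> (\<exists>B. red_compatible P S0 p B))"
    using assms(2) unfolding red_compatible_def S0_def small_def medium_def by auto
  have ca: "int (cnt_red S0 i) < \<lfloor>redfrac P i * real (cnt S0 i)\<rfloor> \<longleftrightarrow> case_A P S i"
    unfolding case_A_def S0_def by simp
  have h: "if case_A P S i then \<exists>S1. pack P Red S0 p S1 \<and> S' = S1\<lparr>cnt_red := (cnt_red S1)(i := cnt_red S1 i + 1)\<rparr>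
       else pack P Blue S0 p S'"
    using assms(1) nc unfolding handle_item_def Let_def i_def[symmetric]
    unfolding Suc_eq_plus1[symmetric] S0_def[symmetric] ca nb by (auto split: if_splits)
  show ?thesis
  proof (cases "case_A P S i")
    case True
    then obtain S1 where "pack P Red S0 p S1" "S' = S1\<lparr>cnt_red := (cnt_red S1)(i := Suc (cnt_red S1 i))\<rparr>"
      using h by auto
    then show ?thesis using pack_effect[of P Red S i p S1 S'] True unfolding i_def S0_def by auto
  next
    case False
    then show ?thesis using h pack_effect[of P Blue S i p S' S'] unfolding i_def S0_def by auto
  qed
qed

lemma appended_items:
  assumes "appended P c S p B S'"
  shows "items S' = insert (length (sizes S)) (items S)" "length (sizes S) \<notin> items S"
    "content S' B' = (if B' = B then insert (length (sizes S)) (content S B) else content S B')"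
    "labeled S' i = (if i = type_of P p then insert (length (sizes S)) (labeled S i) else labeled S i)"
  using assms unfolding appended_def Let_def
  by (auto simp: items_def less_Suc_eq split: if_splits)

text \<open>
  The three ways of packing an item at once: only bin \<open>B\<close> changes, and \<open>u\<close> says that its single
  uncolored item gets the color \<open>c'\<close>.
\<close>

lemma (in eh_parameters) appended_regular:
  assumes "regular P S" "appended P c S p B S'" "0 < p" "p \<le> 1" "type_of P p < N"
    and c: "c = (if case_A P S (type_of P p) then Red else Blue)"
    and B: "B < nbins S'" "nbins S \<le> nbins S'"
    and col: "\<And>k. k \<in> items S \<Longrightarrow> col S' k = (if k \<in> content S B \<and> u then c' else col S k)"
    and u: "u \<Longrightarrow> \<exists>k. content S B = {k} \<and> col S k = Uncolored"
    and c': "c' \<in> {Blue, Red}"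
    and newcol: "col S' (length (sizes S)) = d" "d = c \<or> d = Uncolored"
    and du: "d = Uncolored \<Longrightarrow> content S B = {} \<and> medium p \<and> redfrac P (type_of P p) > 0"
    and colored: "content S B \<noteq> {} \<Longrightarrow> \<forall>k\<in>content S B. col S' k \<noteq> Uncolored"
    and knd: "\<And>B'. B' \<noteq> B \<Longrightarrow> kind S' B' = kind S B'" "\<And>B'. nbins S \<le> B' \<Longrightarrow> B' < nbins S' \<Longrightarrow> B' = B"
    and kmix: "kind S' B = Mixed \<Longrightarrow> colored S' B Blue \<noteq> {} \<and> colored S' B Red \<noteq> {}"
    and kpure: "kind S' B = PureBlue \<Longrightarrow> \<forall>k\<in>content S' B. col S' k = Blue"
    and samelab: "\<And>k. k \<in> content S B \<Longrightarrow> col S' k = d \<Longrightarrow> lab S k = type_of P p"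
    and capac: "d \<in> {Blue, Red} \<Longrightarrow> card (colored S' B d) \<le> capacity_for P d (type_of P p)"
    and host: "\<And>k k'. k \<in> content S' B \<Longrightarrow> k' \<in> content S' B \<Longrightarrow> col S' k = Blue \<Longrightarrow> col S' k' = Red \<Longrightarrow>
       kind S' B = Mixed \<and> hosts P S' k k'"
  shows "regular P S'"
proof -
  interpret regular P S by fact
  define L where "L = length (sizes S)"
  define i where "i = type_of P p"
  have eqs: "sizes S' = sizes S @ [p]" "bin_of S' = (bin_of S)(L := B)" "lab S' = (lab S)(L := i)"
      "mult S' = (mult S)(L := 1)" "nf_bin S' = nf_bin S"
      "cnt_bonus S' = cnt_bonus S" "cnt S' = (cnt S)(i := Suc (cnt S i))"
      "cnt_red S' = (if c = Red then (cnt_red S)(i := Suc (cnt_red S i)) else cnt_red S)"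
    using assms(2) unfolding appended_def Let_def L_def i_def by simp_all
  have it: "items S' = insert L (items S)" "L \<notin> items S"
    "\<And>B'. content S' B' = (if B' = B then insert L (content S B) else content S B')"
    "\<And>j. labeled S' j = (if j = i then insert L (labeled S j) else labeled S j)"
    using appended_items[OF assms(2)] unfolding L_def i_def by blast+
  have LN: "k \<noteq> L" "sizes S' ! k = sizes S ! k" if "k \<in> items S" for k
    using that unfolding items_def L_def eqs by (auto simp: nth_append)
  have Lp: "sizes S' ! L = p" unfolding eqs L_def by simp
  have i: "1 \<le> i" "i < N" "medium_type P i \<longleftrightarrow> medium p"
    using type_of_bounds(1)[OF assms(3-5)] medium_type_of[OF assms(3-5)] assms(5) unfolding i_def by auto
  have newc: "col S' L = d" using newcol unfolding L_def by simp
  have old: "col S' k = col S k" if "k \<in> items S" "bin_of S k \<noteq> B" for k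
    using col[OF that(1)] that by auto
  have keep: "col S' k = col S k" if "k \<in> items S" "col S k \<noteq> Uncolored" for k
  proof (cases "k \<in> content S B \<and> u")
    case True
    then obtain k' where "content S B = {k'}" "col S k' = Uncolored" using u by blast
    then show ?thesis using that True by auto
  qed (use col[OF that(1)] in auto)
  have colored_other: "colored S' B' e = colored S B' e" if "B' \<noteq> B" for B' e
    unfolding colored_def it(3) using that old by auto
  have lab: "1 \<le> lab S k" "lab S k < N" "medium_type P (lab S k) \<longleftrightarrow> medium (sizes S ! k)" if "k \<in> items S" for k
    using item[OF that] type_of_bounds(1) medium_type_of by auto
  have u_single: "content S B = {k}" if uu: u and kB: "k \<in> content S B" for k
  proof -
    obtain k' where k': "content S B = {k'}" using u[OF uu] by blast
    then have "k = k'" using kB by (simp del: content_iff)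
    then show ?thesis using k' by simp
  qed
  have unc_red: "redfrac P (lab S k) > 0" if uu: u and kB: "k \<in> content S B" for k
  proof -
    obtain k' where k': "content S B = {k'}" "col S k' = Uncolored" using u[OF uu] by blast
    then have "k = k'" using kB by (simp del: content_iff)
    moreover have "k \<in> items S" using kB by simp
    ultimately show ?thesis using k' unc[of k] by simp
  qed
  have cred: "redfrac P i > 0" if "c = Red"
  proof -
    have "int (cnt_red S i) < \<lfloor>redfrac P i * real (Suc (cnt S i))\<rfloor>"
      using that c unfolding case_A_def i_def by (simp split: if_splits)
    then have "0 < redfrac P i * real (Suc (cnt S i))" by linarith
    then show ?thesis by (simp add: zero_less_mult_iff)
  qed
  have cBR: "c = Blue \<or> c = Red" using c by auto
  show ?thesis
  proof unfold_locales
    fix k assume k: "k \<in> items S'"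
    show "0 < sizes S' ! k \<and> sizes S' ! k \<le> 1 \<and> lab S' k = type_of P (sizes S' ! k) \<and>
      lab S' k < N \<and> mult S' k = 1 \<and> col S' k \<noteq> Bonus \<and> bin_of S' k < nbins S'"
    proof (cases "k = L")
      case True
      then show ?thesis using assms(3-5) Lp newc newcol(2) cBR B unfolding eqs i_def by auto
    next
      case False
      then have kS: "k \<in> items S" using k it by auto
      then show ?thesis using item[OF kS] LN[OF kS] col[OF kS] c' B unfolding eqs by auto
    qed
  next
    fix j show "cnt_bonus S' j = 0" using bonus eqs by simp
  next
    show "nf_bin S' = None" using nf eqs by simp
  next
    fix k k' assume a: "k \<in> items S'" "k' \<in> items S'" "bin_of S' k = bin_of S' k'" "col S' k = col S' k'"
    consider "k = L" "k' = L" | "k = L" "k' \<in> items S" | "k' = L" "k \<in> items S" | "k \<in> items S" "k' \<in> items S"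
      using a it by auto
    then show "lab S' k = lab S' k'"
    proof cases
      case 2
      then have "k' \<in> content S B" using a(3) LN(1)[of k'] unfolding eqs by simp
      then show ?thesis using samelab[of k'] 2 a(4) newc LN(1)[of k'] unfolding eqs i_def by simp
    next
      case 3
      then have "k \<in> content S B" using a(3) LN(1)[of k] unfolding eqs by simp
      then show ?thesis using samelab[of k] 3 a(4) newc LN(1)[of k] unfolding eqs i_def by simp
    next
      case 4
      have b: "bin_of S k = bin_of S k'" using a(3) 4 LN(1) unfolding eqs by auto
      have "lab S k = lab S k'"
      proof (cases "k \<in> content S B \<and> u")
        case True
        then have "k = k'" using u_single[of k] 4 b by (auto simp: set_eq_iff)
        then show ?thesis by simp
      next
        case False
        then have False': "\<not> (k' \<in> content S B \<and> u)" using b 4 by simp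
        have "col S' k = col S k" "col S' k' = col S k'"
          by (simp_all only: col[OF 4(1)] col[OF 4(2)] if_not_P[OF False] if_not_P[OF False'])
        then show ?thesis using same[OF 4 b] a(4) by simp
      qed
      then show ?thesis using LN(1) 4 unfolding eqs by auto
    qed auto
  next
    fix k assume k: "k \<in> items S'" and e: "col S' k \<in> {Blue, Red}"
    consider "k = L" | "k \<in> items S" "bin_of S k \<noteq> B" | "k \<in> content S B"
      using k it by auto
    then show "card (colored S' (bin_of S' k) (col S' k)) \<le> capacity_for P (col S' k) (lab S' k)"
    proof cases
      case 1
      then show ?thesis using capac e newc unfolding eqs i_def by simp
    next
      case 2
      then show ?thesis using cap[OF 2(1)] e old[OF 2] colored_other[OF 2(2)] LN(1)[OF 2(1)] unfolding eqs by simp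
    next
      case 3
      show ?thesis
      proof (cases "col S' k = d")
        case True
        then show ?thesis using capac e samelab[OF 3] LN(1)[of k] 3 unfolding eqs i_def by simp
      next
        case False
        have "colored S' B (col S' k) = {k' \<in> content S B. col S' k' = col S' k}"
          unfolding colored_def it(3) using False newc by auto
        moreover have "card {k' \<in> content S B. col S' k' = col S' k} \<le> capacity_for P (col S' k) (lab S k)"
        proof (cases u)
          case True
          have "{k' \<in> content S B. col S' k' = col S' k} = {k}" unfolding u_single[OF True 3] by auto
          moreover have "1 \<le> capacity_for P (col S' k) (lab S k)"
            using e bluefit_pos[of "lab S k"] redfit_ge_1[of "lab S k"] lab[of k] unc_red[OF True 3] 3
            unfolding capacity_for_def by auto
          ultimately show ?thesis by simp
        next
          case False
          then have "\<forall>k'\<in>content S B. col S' k' = col S k'" using col by simp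
          then have "{k' \<in> content S B. col S' k' = col S' k} = colored S (bin_of S k) (col S k)" "col S' k = col S k"
            unfolding colored_def using 3 by auto
          then show ?thesis using cap[of k] e 3 by auto
        qed
        ultimately show ?thesis using LN(1)[of k] 3 unfolding eqs by simp
      qed
    qed
  next
    fix k assume k: "k \<in> items S'" "col S' k = Uncolored"
    show "content S' (bin_of S' k) = {k} \<and> medium (sizes S' ! k) \<and> redfrac P (lab S' k) > 0"
    proof (cases "k = L")
      case True
      then show ?thesis using du k newc Lp unfolding it(3) eqs i_def by simp
    next
      case False
      then have kS: "k \<in> items S" using k it by auto
      have nb: "bin_of S k \<noteq> B"
      proof
        assume "bin_of S k = B"
        then have "k \<in> content S B" using kS by simp
        then show False using colored k(2) by blast
      qed
      then have "col S k = Uncolored" using old[OF kS] k by simp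
      then show ?thesis using unc[OF kS] nb LN[OF kS] unfolding it(3) eqs by simp
    qed
  next
    fix k assume k: "k \<in> items S'" "col S' k = Red"
    show "redfrac P (lab S' k) > 0"
    proof (cases "k = L")
      case True
      then have "c = Red" using newc k newcol by auto
      then show ?thesis using cred True unfolding eqs by simp
    next
      case False
      then have kS: "k \<in> items S" using k it by auto
      then show ?thesis using red[OF kS] col[OF kS] unc_red k False unfolding eqs by (auto split: if_splits)
    qed
  next
    fix k k' assume a: "k \<in> items S'" "k' \<in> items S'" "bin_of S' k = bin_of S' k'" "col S' k = Blue" "col S' k' = Red"
    show "kind S' (bin_of S' k) = Mixed \<and> hosts P S' k k'"
    proof (cases "bin_of S' k = B")
      case True
      then show ?thesis using host[of k k'] a by simp
    next
      case False
      have kS: "k \<in> items S" "k' \<in> items S" using a False it unfolding eqs by auto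
      have b: "bin_of S k \<noteq> B" "bin_of S k' = bin_of S k" using False a(3) kS LN(1) unfolding eqs by auto
      have "kind S (bin_of S k) = Mixed \<and> hosts P S k k'"
        using mix[OF kS b(2)[symmetric]] old[OF kS(1) b(1)] old[OF kS(2)] b a by simp
      then show ?thesis using LN kS knd(1) b unfolding hosts_def eqs(2,3) by simp
    qed
  next
    fix B' assume b: "B' < nbins S'" "kind S' B' = Mixed"
    show "colored S' B' Blue \<noteq> {} \<and> colored S' B' Red \<noteq> {}"
    proof (cases "B' = B")
      case False
      then have "B' < nbins S" using b knd(2)[of B'] by (meson not_le)
      then show ?thesis using mixed b knd(1)[OF False] colored_other[OF False] by simp
    qed (use kmix b in auto)
  next
    fix k assume k: "k \<in> items S'" "kind S' (bin_of S' k) = PureBlue"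
    show "col S' k = Blue"
    proof (cases "bin_of S' k = B")
      case True
      then show ?thesis using kpure k by simp
    next
      case False
      have kS: "k \<in> items S" using k False it unfolding eqs by auto
      have b: "bin_of S k \<noteq> B" using False LN(1)[OF kS] unfolding eqs by simp
      then show ?thesis using pure[OF kS] old[OF kS b] k(2) knd(1) LN(1)[OF kS] unfolding eqs by simp
    qed
  next
    fix j show "cnt S' j = card (labeled S' j)"
      using cnt it(2) unfolding it(4) eqs by simp
  next
    fix j assume j: "1 \<le> j" "j < N"
    show "int (cnt_red S' j) = \<lfloor>redfrac P j * real (cnt S' j)\<rfloor>"
    proof (cases "j = i")
      case False
      then show ?thesis using cnt_red[OF j] unfolding eqs by auto
    next
      case True
      \<comment> \<open>The fraction is below 1, so one more item raises the floor by 0 or 1, and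
        case A is exactly a rise by 1.\<close>
      have e: "int (cnt_red S i) = \<lfloor>redfrac P i * real (cnt S i)\<rfloor>" using cnt_red i by simp
      have le: "0 \<le> redfrac P i" "redfrac P i < 1" using redfrac_nonneg[of i] redfrac_less[of i] i by auto
      have s: "redfrac P i * real (Suc (cnt S i)) = redfrac P i * real (cnt S i) + redfrac P i"
        by (simp add: algebra_simps)
      have "\<lfloor>redfrac P i * real (Suc (cnt S i))\<rfloor> \<le> \<lfloor>redfrac P i * real (cnt S i)\<rfloor> + 1"
        "\<lfloor>redfrac P i * real (cnt S i)\<rfloor> \<le> \<lfloor>redfrac P i * real (Suc (cnt S i))\<rfloor>"
        unfolding s using le by linarith+
      then show ?thesis using True e c unfolding eqs case_A_def i_def by auto
    qed
  next
    fix j assume j: "\<not> medium_type P j"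
    have o: "{k \<in> labeled S j. col S' k = Red} = {k \<in> labeled S j. col S k = Red}"
    proof -
      have "col S' k = col S k" if "k \<in> labeled S j" for k
      proof -
        have "col S k \<noteq> Uncolored" using unc[of k] lab[of k] that j by auto
        then show ?thesis using keep that by simp
      qed
      then show ?thesis by auto
    qed
    have n: "finite {k \<in> labeled S j. col S k = Red}" "L \<notin> labeled S j" using it(2) by auto
    show "card {k \<in> labeled S' j. col S' k = Red} = cnt_red S' j"
    proof (cases "j = i")
      case False
      then show ?thesis using red_cnt[OF j] o unfolding it(4) eqs by auto
    next
      case True
      then have "d = c" using du newcol(2) i j unfolding i_def by auto
      then have "{k \<in> labeled S' j. col S' k = Red} =
          (if c = Red then insert L {k \<in> labeled S j. col S k = Red} else {k \<in> labeled S j. col S k = Red})"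
        using o newc True unfolding it(4) by auto
      then show ?thesis using red_cnt[OF j] n True unfolding eqs by auto
    qed
  qed
qed

section \<open>Preservation of the invariant\<close>

context eh_parameters
begin

lemma bluefit_large:
  assumes "1 \<le> j" "j \<le> N" "1/2 < t j"
  shows "bluefit P j = 1"
proof -
  have "\<lfloor>1 / t j\<rfloor> = 1"
    using assms thr_le_1[of j] by (intro floor_unique) (auto simp: field_simps)
  then show ?thesis unfolding bluefit_def by simp
qed

lemma case_A_redfrac:
  assumes "case_A P S i" shows "0 < redfrac P i"
proof -
  have "int (cnt_red S i) < \<lfloor>redfrac P i * real (Suc (cnt S i))\<rfloor>"
    using assms unfolding case_A_def .
  then have "0 < redfrac P i * real (Suc (cnt S i))" by linarith
  then show ?thesis by (simp add: zero_less_mult_iff)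
qed

text \<open>The new item joins an item \<open>k0\<close> of its own type and color and inherits the
  partners that \<open>k0\<close> has by type. Partners by exact size would not carry over, but they
  involve a large blue item (\<open>bluefit\<close> 1) or a medium red item (\<open>redfit\<close>
  1), and such an item already exhausts its color, so that the bin would not be open.\<close>

lemma to_open_regular:
  assumes "regular P S" and o: "to_open P c S p B S'" and p: "0 < p" "p \<le> 1" "type_of P p < N"
    and c: "c = (if case_A P S (type_of P p) then Red else Blue)"
  shows "regular P S'"
proof -
  interpret regular P S by fact
  define L where "L = length (sizes S)"
  define i where "i = type_of P p"
  have i: "1 \<le> i" "i < N" using type_of_bounds(1)[OF p] p(3) unfolding i_def by auto
  have app: "appended P c S p B S'" and ob: "open_bin P S c i B" and
    eqs: "col S' = (col S)(L := c)" "kind S' = kind S" "nbins S' = nbins S"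
    using o unfolding to_open_def L_def i_def by auto
  have aeq: "sizes S' = sizes S @ [p]" "lab S' = (lab S)(L := i)"
    using app unfolding appended_def Let_def L_def i_def by auto
  note it = appended_items[OF app, folded L_def i_def]
  obtain k0 where k0: "k0 \<in> items S" "bin_of S k0 = B" "col S k0 = c" "lab S k0 = i"
    using ob unfolding open_bin_def by auto
  have B: "B < nbins S" using ob unfolding open_bin_def by auto
  have cBR: "c \<noteq> Uncolored" "c \<in> {Blue, Red}" using c by auto
  have LN: "k \<noteq> L" if "k \<in> items S" for k using that it(2) by auto
  have old: "col S' k = col S k" if "k \<in> items S" for k using LN[OF that] eqs by simp
  have "(\<Sum>k\<in>{k \<in> content S B. col S k = c}. mult S k) < capacity_for P c i"
    using ob unfolding open_bin_def by auto
  moreover have "(\<Sum>k\<in>{k \<in> content S B. col S k = c}. mult S k) = card (colored S B c)"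
    unfolding colored_def using item by simp
  ultimately have cd: "card (colored S B c) < capacity_for P c i" by simp
  have k0c: "k0 \<in> colored S B c" using k0 by simp
  then have cd1: "1 \<le> card (colored S B c)"
    by (metis One_nat_def Suc_leI card_gt_0_iff empty_iff finite_colored)
  have notunc: "col S k \<noteq> Uncolored" if "k \<in> content S B" for k
  proof
    assume "col S k = Uncolored"
    then have "content S B = {k}" using unc[of k] that by auto
    moreover have "k0 \<in> content S B" using k0 by simp
    ultimately show False using \<open>col S k = Uncolored\<close> k0 cBR by (metis singletonD)
  qed
  have col': "colored S' B e = (if e = c then insert L (colored S B e) else colored S B e)" for e
    unfolding colored_def it(3) using old LN eqs by (auto simp: it(2))
  have szs: "sizes S' ! k = sizes S ! k" if "k \<in> items S" for k
    using that unfolding items_def aeq by (auto simp: nth_append)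
  show ?thesis
  proof (rule appended_regular[where u = False and c' = Blue and d = c and B = B, OF \<open>regular P S\<close> app p c],
      unfold L_def[symmetric] i_def[symmetric])
    show "\<And>k. k \<in> items S \<Longrightarrow> col S' k = (if k \<in> content S B \<and> False then Blue else col S k)"
      using old by simp
    show "\<forall>k\<in>content S B. col S' k \<noteq> Uncolored" using notunc old by auto
    show "kind S' B = Mixed \<Longrightarrow> colored S' B Blue \<noteq> {} \<and> colored S' B Red \<noteq> {}"
      using mixed[OF B] eqs unfolding col' by auto
    show "kind S' B = PureBlue \<Longrightarrow> \<forall>k\<in>content S' B. col S' k = Blue"
    proof
      fix k assume h: "kind S' B = PureBlue" "k \<in> content S' B"
      have cB: "c = Blue" using pure[of k0] k0 h eqs by auto
      show "col S' k = Blue"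
      proof (cases "k = L")
        case True then show ?thesis using eqs cB by simp
      next
        case False
        then have "k \<in> items S" "bin_of S k = B" using h(2) unfolding it(3) by auto
        then show ?thesis using pure[of k] h eqs old by simp
      qed
    qed
    show "\<And>k. k \<in> content S B \<Longrightarrow> col S' k = c \<Longrightarrow> lab S k = i"
      using same[of _ k0] k0 old by simp
    show "card (colored S' B c) \<le> capacity_for P c i"
      unfolding col' using cd it(2) by simp
    show "kind S' B = Mixed \<and> hosts P S' k k'"
      if a: "k \<in> content S' B" "k' \<in> content S' B" "col S' k = Blue" "col S' k' = Red" for k k'
    proof -
      have ne: "k \<noteq> k'" using a by auto
      consider "k = L" "k' \<in> content S B" "c = Blue" | "k' = L" "k \<in> content S B" "c = Red"
        | "k \<in> content S B" "k' \<in> content S B"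
        using a ne eqs unfolding it(3) by auto
      then show ?thesis
      proof cases
        case 1
        have r: "col S k' = Red" using a old 1 by simp
        have m: "kind S B = Mixed" "hosts P S k0 k'"
          using mix[of k0 k'] k0 1 r by auto
        have "\<not> large (sizes S ! k0)"
        proof
          assume "large (sizes S ! k0)"
          then have "1/2 < t i" using item[OF k0(1)] type_of_bounds(3)[of "sizes S ! k0"] k0(4)
            unfolding large_def by auto
          then have "bluefit P i = 1" using bluefit_large i by simp
          then show False using cd cd1 1 unfolding capacity_for_def by simp
        qed
        then show ?thesis using m 1 k0(4) LN[of k'] eqs unfolding hosts_def aeq by simp
      next
        case 2
        have r: "col S k = Blue" using a old 2 by simp
        have m: "kind S B = Mixed" "hosts P S k k0"
          using mix[of k k0] k0 2 r by auto
        have "\<not> medium (sizes S ! k0)"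
        proof
          assume "medium (sizes S ! k0)"
          then have "medium_type P i" using item[OF k0(1)] medium_type_of[of "sizes S ! k0"] k0(4) by auto
          then have "redfit P i = 1" using redfit_medium i red[OF k0(1)] k0 2 by simp
          then show False using cd cd1 2 unfolding capacity_for_def by simp
        qed
        then show ?thesis using m 2 k0(4) LN[of k] eqs unfolding hosts_def aeq by simp
      next
        case 3
        then have "kind S B = Mixed \<and> hosts P S k k'" using mix[of k k'] a old by simp
        then show ?thesis using 3 LN[of k] LN[of k'] szs eqs unfolding hosts_def aeq(2) by simp
      qed
    qed
  qed (use B eqs cBR k0 in auto)
qed

lemma to_new_regular:
  assumes "regular P S" and o: "to_new P c S p B S'" and p: "0 < p" "p \<le> 1" "type_of P p < N"
    and c: "c = (if case_A P S (type_of P p) then Red else Blue)"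
  shows "regular P S'"
proof -
  interpret regular P S by fact
  define L where "L = length (sizes S)"
  define i where "i = type_of P p"
  define d where "d = (if medium p \<and> redfrac P i > 0 then Uncolored else c)"
  have i: "1 \<le> i" "i < N" using type_of_bounds(1)[OF p] p(3) unfolding i_def by auto
  have app: "appended P c S p B S'" and
    eqs: "B = nbins S" "col S' = (col S)(L := d)"
      "kind S' = (kind S)(nbins S := (if leaves P i = 0 \<and> d = Blue then PureBlue else Unmixed))"
      "nbins S' = Suc (nbins S)"
    using o unfolding to_new_def Let_def L_def i_def d_def by auto
  note it = appended_items[OF app, folded L_def i_def]
  have ce: "content S B = {}" using item eqs by fastforce
  have ce': "content S' B = {L}" unfolding it(3) ce by simp
  have LN: "k \<noteq> L" if "k \<in> items S" for k using that it(2) by auto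
  have old: "col S' k = col S k" if "k \<in> items S" for k using LN[OF that] eqs by simp
  have cap1: "1 \<le> capacity_for P d i" if "d \<in> {Blue, Red}"
    using that bluefit_pos[of i] redfit_ge_1[of i] case_A_redfrac[of S i] i c
    unfolding capacity_for_def d_def i_def[symmetric] by (auto split: if_splits)
  show ?thesis
  proof (rule appended_regular[where u = False and c' = Blue and d = d and B = B, OF \<open>regular P S\<close> app p c],
      unfold L_def[symmetric] i_def[symmetric])
    show "\<And>k. k \<in> items S \<Longrightarrow> col S' k = (if k \<in> content S B \<and> False then Blue else col S k)"
      using old by simp
    show "kind S' B = PureBlue \<Longrightarrow> \<forall>k\<in>content S' B. col S' k = Blue"
      unfolding ce' using eqs by (auto split: if_splits)
    show "card (colored S' B d) \<le> capacity_for P d i" if "d \<in> {Blue, Red}"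
    proof -
      have "colored S' B d \<subseteq> {L}" using ce' unfolding colored_def by auto
      then have "card (colored S' B d) \<le> 1" using card_mono[of "{L}"] by fastforce
      then show ?thesis using cap1[OF that] by simp
    qed
    show "kind S' B = Mixed \<and> hosts P S' k k'"
      if a: "k \<in> content S' B" "k' \<in> content S' B" "col S' k = Blue" "col S' k' = Red" for k k'
    proof -
      have "k = L" "k' = L" using a(1,2) unfolding ce' by auto
      then show ?thesis using a by simp
    qed
    show "d = c \<or> d = Uncolored" unfolding d_def by simp
    show "d = Uncolored \<Longrightarrow> content S B = {} \<and> medium p \<and> redfrac P i > 0"
      using ce c unfolding d_def by (auto split: if_splits)
  qed (use eqs ce in \<open>auto split: if_splits\<close>)
qed

text \<open>By \<open>mix\<close> an unmixed bin cannot contain both blue and red items. So it has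
  items of one color or a single uncolored item, and the arriving item is the only one of its
  color.\<close>

lemma to_compat_regular:
  assumes "regular P S" and o: "to_compat P c S p B S'" and p: "0 < p" "p \<le> 1" "type_of P p < N"
    and c: "c = (if case_A P S (type_of P p) then Red else Blue)"
    and nl: "medium p \<Longrightarrow> \<forall>k\<in>items S. \<not> large (sizes S ! k)"
  shows "regular P S'"
proof -
  interpret regular P S by fact
  define L where "L = length (sizes S)"
  define i where "i = type_of P p"
  define e where "e = opposite c"
  have i: "1 \<le> i" "i < N" using type_of_bounds(1)[OF p] p(3) unfolding i_def by auto
  have app: "appended P c S p B S'" and co: "compatible P S c p B" and
    eqs: "kind S' = (kind S)(B := Mixed)" "nbins S' = nbins S" and
    cole: "col S' = (\<lambda>k. if k = L then c
                   else if k \<in> content S B \<and> col S k = Uncolored then e else col S k)"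
    using o unfolding to_compat_def L_def e_def by auto
  have aeq: "sizes S' = sizes S @ [p]" "lab S' = (lab S)(L := i)"
    using app unfolding appended_def Let_def L_def i_def by auto
  note it = appended_items[OF app, folded L_def i_def]
  have LN: "k \<noteq> L" if "k \<in> items S" for k using that it(2) by auto
  have ce: "c = Blue \<and> e = Red \<or> c = Red \<and> e = Blue" using c unfolding e_def by auto
  have BU: "B < nbins S" "kind S B = Unmixed"
    using co unfolding compatible_def blue_compatible_def red_compatible_def by (auto split: if_splits)
  obtain k0 where k0: "k0 \<in> items S" "bin_of S k0 = B" "col S k0 = e \<or> col S k0 = Uncolored"
    and h0: "if c = Red then leaves P (lab S k0) \<ge> needs P i
      else leaves P i \<ge> needs P (lab S k0) \<or> (large p \<and> medium (sizes S ! k0) \<and> p + sizes S ! k0 \<le> 1)"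
  proof (cases "c = Red")
    case True
    have "\<exists>k\<in>content S B. col S k \<in> {Blue, Uncolored} \<and> leaves P (lab S k) \<ge> needs P i"
      using co nl True unfolding compatible_def red_compatible_def i_def by auto
    then show thesis using that True ce by auto
  next
    case False
    then have "\<exists>k\<in>content S B. col S k = Red \<and> leaves P i \<ge> needs P (lab S k) \<or>
      (large p \<and> col S k \<in> {Red, Uncolored} \<and> medium (sizes S ! k) \<and> p \<le> 1 - sizes S ! k)"
      using co ce unfolding compatible_def blue_compatible_def i_def by auto
    then show thesis using that False ce by auto
  qed
  \<comment> \<open>The case in which the bin consists of one uncolored item, which now receives the
    opposite color \<open>e\<close>.\<close>
  define u where "u \<longleftrightarrow> col S k0 = Uncolored"
  have single: "content S B = {k0}" if u using unc[OF k0(1)] that k0(2) unfolding u_def by simp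
  have colB: "(u \<and> k = k0) \<or> (\<not> u \<and> col S k = e)" if k: "k \<in> content S B" for k
  proof (cases u)
    case True then show ?thesis using k single by blast
  next
    case False
    have ke: "col S k0 = e" using False k0(3) unfolding u_def by simp
    have "col S k \<noteq> c"
      using mix[of k k0] mix[of k0 k] ke k k0 ce BU by auto
    moreover have "col S k \<noteq> Uncolored"
    proof
      assume un: "col S k = Uncolored"
      then have "content S B = {k}" using unc[of k] k by auto
      then have "k0 = k" using k0 by (metis content_iff singletonD)
      then show False using un False unfolding u_def by simp
    qed
    ultimately show ?thesis using False color_cases[of "col S k"] item[of k] k ce by auto
  qed
  have newc: "col S' k = e" if "k \<in> content S B" for k
    using colB[OF that] that LN[of k] ce unfolding cole u_def by auto
  have labB: "lab S k = lab S k0" if k: "k \<in> content S B" for k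
    using colB[OF k] same[of k k0] k k0 u_def by auto
  have onlyL: "colored S' B c = {L}"
  proof -
    have "col S' L = c" using cole by simp
    moreover have "k \<in> content S B \<Longrightarrow> col S' k \<noteq> c" for k using newc ce by auto
    ultimately show ?thesis unfolding colored_def it(3) by (auto simp del: content_iff)
  qed
  have cap1: "1 \<le> capacity_for P c i"
    using bluefit_pos[of i] redfit_ge_1[of i] case_A_redfrac[of S i] i c
    unfolding capacity_for_def i_def[symmetric] by (auto split: if_splits)
  show ?thesis
  proof (rule appended_regular[where u = u and c' = e and d = c and B = B, OF \<open>regular P S\<close> app p c],
      unfold L_def[symmetric] i_def[symmetric])
    show "col S' k = (if k \<in> content S B \<and> u then e else col S k)" if k: "k \<in> items S" for k
    proof (cases "k \<in> content S B")
      case True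
      then show ?thesis using newc[OF True] colB[OF True] by auto
    qed (use LN[OF k] cole in auto)
    show "u \<Longrightarrow> \<exists>k. content S B = {k} \<and> col S k = Uncolored"
      using single u_def by blast
    show "\<forall>k\<in>content S B. col S' k \<noteq> Uncolored" using newc ce by auto
    show "colored S' B Blue \<noteq> {} \<and> colored S' B Red \<noteq> {}"
    proof -
      have "k0 \<in> colored S' B e" using k0 newc[of k0] unfolding colored_def it(3) by simp
      then show ?thesis using onlyL ce by auto
    qed
    show "k \<in> content S B \<Longrightarrow> col S' k = c \<Longrightarrow> lab S k = i" for k
      using newc[of k] ce by auto
    show "card (colored S' B c) \<le> capacity_for P c i" using onlyL cap1 by simp
    show "kind S' B = Mixed \<and> hosts P S' k k'"
      if a: "k \<in> content S' B" "k' \<in> content S' B" "col S' k = Blue" "col S' k' = Red" for k k'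
    proof -
      have ne: "k \<noteq> k'" using a by auto
      consider "k = L" "k' \<in> content S B" | "k' = L" "k \<in> content S B"
        using a ne newc unfolding it(3) by fastforce
      then have "hosts P S' k k'"
      proof cases
        case 1
        have cB: "c = Blue" using a 1 cole by simp
        have l: "lab S' k' = lab S k0" "lab S' k = i" using labB[OF 1(2)] LN[of k'] 1 aeq by auto
        \<comment> \<open>A match by size was checked for the particular item \<open>k0\<close>. It
          applies to \<open>k'\<close> because a medium red item is the only red item of its
          bin.\<close>
        have "k' = k0" if "medium (sizes S ! k0)"
        proof (cases u)
          case True then show ?thesis using single 1 by blast
        next
          case False
          then have kr: "col S k0 = Red" "col S k' = Red" using colB[of k0] colB[OF 1(2)] k0 ce cB by auto
          have "medium_type P (lab S k0)" using item[OF k0(1)] medium_type_of that by auto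
          moreover have "1 \<le> lab S k0" using item[OF k0(1)] type_of_bounds(1) by auto
          ultimately have "redfit P (lab S k0) = 1"
            using redfit_medium red[OF k0(1) kr(1)] item[OF k0(1)] by auto
          then have "card (colored S B Red) \<le> 1"
            using cap[OF k0(1)] kr k0 unfolding capacity_for_def by simp
          moreover have "{k', k0} \<subseteq> colored S B Red" using 1 kr k0 by auto
          ultimately show ?thesis
            by (metis card_le_Suc0_iff_eq finite_colored insert_subset One_nat_def)
        qed
        then show ?thesis using h0 cB l 1 k0(1) unfolding hosts_def aeq(1) L_def
          by (auto simp: nth_append items_def)
      next
        case 2
        have cR: "c = Red" using a 2 cole by simp
        have l: "lab S' k = lab S k0" "lab S' k' = i" using labB[OF 2(2)] LN[of k] 2 aeq by auto
        then show ?thesis using h0 cR unfolding hosts_def by simp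
      qed
      then show ?thesis using eqs by simp
    qed
  qed (use BU eqs ce cole in auto)
qed

text \<open>Besides the invariant, positions and colors other than \<open>Uncolored\<close> are
  permanent. Bins counted after a prefix of the input can therefore be counted at the end.\<close>

theorem step_regular:
  assumes r: "regular P S" and st: "eh_step P S p S'" and p: "0 < p" "p \<le> 1" "type_of P p < N"
    and nl: "medium p \<Longrightarrow> \<forall>k\<in>items S. \<not> large (sizes S ! k)"
  shows "regular P S'" "sizes S' = sizes S @ [p]"
    "\<And>k. k \<in> items S \<Longrightarrow> bin_of S' k = bin_of S k"
    "\<And>k. k \<in> items S \<Longrightarrow> col S k \<noteq> Uncolored \<Longrightarrow> col S' k = col S k"
proof -
  obtain T where T: "handle_item P S p T" "mark_and_color_all P T S'"
    using st p(3) unfolding eh_step_def by auto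
  obtain c B where c: "c = (if case_A P S (type_of P p) then Red else Blue)"
    and e: "to_open P c S p B T \<or> to_compat P c S p B T \<or> to_new P c S p B T"
    using regular.handle_effect[OF r T(1) nl] by auto
  have rT: "regular P T"
    using e to_open_regular[OF r _ p c] to_compat_regular[OF r _ p c nl] to_new_regular[OF r _ p c] by blast
  have app: "appended P c S p B T" using e unfolding to_open_def to_compat_def to_new_def Let_def by auto
  have "\<forall>k\<in>items T. col T k \<noteq> Bonus" using regular.item[OF rT] by blast
  then have rc: "recolored T S'" using mark_and_color_all_recolored T(2) by blast
  show "regular P S'" using recolored_regular[OF rT rc] .
  have eT: "sizes T = sizes S @ [p]" "bin_of T = (bin_of S)(length (sizes S) := B)"
    using app unfolding appended_def Let_def by auto
  show "sizes S' = sizes S @ [p]" using rc eT unfolding recolored_def by simp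
  show "bin_of S' k = bin_of S k" if "k \<in> items S" for k
    using rc eT that unfolding recolored_def items_def by simp
  show "col S' k = col S k" if "k \<in> items S" "col S k \<noteq> Uncolored" for k
  proof -
    have "col T k = col S k"
      using e that unfolding to_open_def to_compat_def to_new_def Let_def items_def by auto
    then show ?thesis using recolored_color[OF rc] that by simp
  qed
qed

end

section \<open>Optimal packings and the ratio\<close>

lemma opt_le: "packable \<sigma> m \<Longrightarrow> opt \<sigma> \<le> m"
  unfolding opt_def by (rule Least_le)

lemma packable_concat:
  assumes "\<And>b. b \<in> set bs \<Longrightarrow> sum_list b \<le> 1"
  shows "packable (concat bs) (length bs)"
  using assms
proof (induction bs rule: rev_induct)
  case Nil
  then show ?case unfolding packable_def by auto
next
  case (snoc b bs)
  define n where "n = length (concat bs)"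
  from snoc obtain f where f: "\<forall>k<n. f k < length bs"
    "\<And>B. B < length bs \<Longrightarrow> (\<Sum>k \<in> {k. k < n \<and> f k = B}. concat bs ! k) \<le> 1"
    unfolding packable_def n_def by auto
  define g where "g = (\<lambda>k. if k < n then f k else length bs)"
  have len: "length (concat (bs @ [b])) = n + length b" unfolding n_def by simp
  have 1: "{k. k < n + length b \<and> g k = B} = {k. k < n \<and> f k = B}" if "B < length bs" for B
    using that unfolding g_def by auto
  have 2: "{k. k < n + length b \<and> g k = length bs} = {n..<n + length b}"
    using f(1) unfolding g_def by (auto split: if_splits) (metis less_irrefl not_le)
  have 3: "(\<Sum>k\<in>{n..<n + length b}. concat (bs @ [b]) ! k) = sum_list b"
    unfolding sum_list_sum_nth n_def
    by (rule sum.reindex_bij_witness[of _ "\<lambda>k. n + k" "\<lambda>k. k - n"]) (auto simp: nth_append n_def)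
  have 4: "(\<Sum>k \<in> {k. k < n \<and> f k = B}. concat (bs @ [b]) ! k) = (\<Sum>k \<in> {k. k < n \<and> f k = B}. concat bs ! k)" for B
    unfolding n_def by (rule sum.cong) (auto simp: nth_append)
  have "(\<Sum>k \<in> {k. k < n + length b \<and> g k = B}. concat (bs @ [b]) ! k) \<le> 1" if "B < length bs + 1" for B
  proof (cases "B = length bs")
    case True
    then show ?thesis using 2 3 snoc.prems[of b] by simp
  next
    case False
    then have "B < length bs" using that by simp
    then show ?thesis using f(2) by (simp only: 1 4)
  qed
  moreover have "\<forall>k<n + length b. g k < length bs + 1"
    using f(1) unfolding g_def by (auto simp: less_SucI)
  ultimately show ?case unfolding packable_def len by (intro exI[of _ g]) simp
qed

lemma packable_perm:
  assumes "mset \<sigma> = mset \<tau>" "packable \<tau> m"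
  shows "packable \<sigma> m"
proof -
  obtain p where p: "p permutes {..<length \<tau>}" "permute_list p \<tau> = \<sigma>"
    using mset_eq_permutation[OF assms(1)] by auto
  obtain f where f: "\<forall>k<length \<tau>. f k < m" "\<forall>B<m. (\<Sum>k \<in> {k. k < length \<tau> \<and> f k = B}. \<tau> ! k) \<le> 1"
    using assms(2) unfolding packable_def by auto
  have len: "length \<sigma> = length \<tau>" using assms(1) mset_eq_length by blast
  have pin: "p k < length \<tau>" if "k < length \<tau>" for k
    using p(1) that permutes_in_image by fastforce
  have inv: "inv p k < length \<tau>" if "k < length \<tau>" for k
    using permutes_inv[OF p(1)] that permutes_in_image by fastforce
  have nth: "\<sigma> ! k = \<tau> ! p k" if "k < length \<tau>" for k
    using p(2) permute_list_nth[OF p(1) that] by auto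
  have "(\<Sum>k \<in> {k. k < length \<sigma> \<and> f (p k) = B}. \<sigma> ! k) = (\<Sum>k \<in> {k. k < length \<tau> \<and> f k = B}. \<tau> ! k)" for B
    using pin inv nth permutes_inverses[OF p(1)] len
    by (intro sum.reindex_bij_witness[of _ "inv p" p]) auto
  then show ?thesis
    unfolding packable_def using f pin len by (intro exI[of _ "\<lambda>k. f (p k)"]) auto
qed

lemma packable_bins:
  assumes "mset \<sigma> = mset (concat bs)" "\<And>b. b \<in> set bs \<Longrightarrow> sum_list b \<le> 1"
  shows "packable \<sigma> (length bs)"
  using packable_perm[OF assms(1)] packable_concat assms(2) by blast

text \<open>The existence of some packing guarantees that the \<open>LEAST\<close> in
  \<open>opt\<close> is attained; its bins then bound the total volume.\<close>

lemma sum_list_le_opt: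
  assumes "packable \<sigma> m"
  shows "sum_list \<sigma> \<le> real (opt \<sigma>)"
proof -
  have "packable \<sigma> (opt \<sigma>)" unfolding opt_def using assms by (rule LeastI)
  then obtain f where f: "\<forall>k<length \<sigma>. f k < opt \<sigma>"
      "\<forall>B<opt \<sigma>. (\<Sum>k \<in> {k. k < length \<sigma> \<and> f k = B}. \<sigma> ! k) \<le> 1"
    unfolding packable_def by auto
  have "sum_list \<sigma> = (\<Sum>k\<in>{..<length \<sigma>}. \<sigma> ! k)"
    by (simp add: sum_list_sum_nth atLeast0LessThan)
  also have "\<dots> = (\<Sum>B\<in>{..<opt \<sigma>}. \<Sum>k\<in>{k. k \<in> {..<length \<sigma>} \<and> f k = B}. \<sigma> ! k)"
    using f(1) by (intro sum.group[symmetric]) auto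
  also have "\<dots> \<le> (\<Sum>B\<in>{..<opt \<sigma>}. 1)"
    using f(2) by (intro sum_mono) auto
  finally show ?thesis by simp
qed

text \<open>The limsup runs over the value of the optimum, so inputs with arbitrarily large optimum
  are enough. Asking for \<open>Suc n\<close> in the proof keeps the denominator positive.\<close>

lemma asymptotic_ratio_geI:
  assumes "\<And>n. \<exists>\<sigma>. valid_input \<sigma> \<and> n \<le> opt \<sigma> \<and> r * real (opt \<sigma>) \<le> real (cost \<sigma>)"
  shows "ereal r \<le> asymptotic_ratio cost"
  unfolding asymptotic_ratio_def limsup_INF_SUP
proof (rule INF_greatest)
  fix n :: nat
  obtain \<sigma> where s: "valid_input \<sigma>" "Suc n \<le> opt \<sigma>" "r * real (opt \<sigma>) \<le> real (cost \<sigma>)"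
    using assms by blast
  have "ereal r \<le> ereal (real (cost \<sigma>) / real (opt \<sigma>))"
    using s by (simp add: field_simps)
  then show "ereal r \<le> (SUP m\<in>{n..}. SUP \<sigma>\<in>{\<sigma>. valid_input \<sigma> \<and> opt \<sigma> = m}. ereal (real (cost \<sigma>) / real (opt \<sigma>)))"
    using s(1,2) by (intro SUP_upper2[of "opt \<sigma>"] SUP_upper2[of \<sigma>]) auto
qed

section \<open>Counting bins\<close>

text \<open>The source of all lower bounds on the cost: item sets with pairwise disjoint sets of
  bins.\<close>

lemma sum_card_image_le:
  assumes "sorted_wrt (\<lambda>X Y. f ` X \<inter> f ` Y = {}) Xs" "\<And>X. X \<in> set Xs \<Longrightarrow> finite X \<and> X \<subseteq> Z" "finite Z"
  shows "sum_list (map (\<lambda>X. card (f ` X)) Xs) \<le> card (f ` Z)"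
proof -
  have "sum_list (map (\<lambda>X. card (f ` X)) Xs) = card (f ` \<Union>(set Xs))"
    using assms(1,2)
  proof (induction Xs)
    case (Cons X Xs)
    have "f ` X \<inter> f ` \<Union>(set Xs) = {}" using Cons.prems(1) by auto
    moreover have "finite (\<Union>(set Xs))" using Cons.prems(2) by auto
    ultimately show ?case using Cons by (simp add: image_Un card_Un_disjoint)
  qed simp
  also have "\<dots> \<le> card (f ` Z)"
    using assms(2,3) by (intro card_mono image_mono) auto
  finally show ?thesis .
qed

text \<open>With \<open>f\<close> as the bin map, a limit on the items per bin becomes a lower bound
  on the number of bins.\<close>

lemma card_le_fibre_image:
  assumes "finite X" "\<And>k. k \<in> X \<Longrightarrow> card {k' \<in> X. f k' = f k} \<le> b"
  shows "card X \<le> b * card (f ` X)"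
proof -
  have "X = (\<Union>y\<in>f ` X. {k \<in> X. f k = y})" by auto
  then have "card X \<le> (\<Sum>y\<in>f ` X. card {k \<in> X. f k = y})"
    using card_UN_le[of "f ` X" "\<lambda>y. {k \<in> X. f k = y}"] assms(1) by (metis finite_imageI)
  also have "\<dots> \<le> (\<Sum>y\<in>f ` X. b)"
    using assms(2) by (intro sum_mono) auto
  finally show ?thesis by (simp add: mult.commute)
qed

section \<open>Runs of the algorithm\<close>

locale eh_run = eh_parameters +
  fixes A :: "real list \<Rightarrow> eh_state"
  assumes start: "A [] = init_state"
    and step: "valid_input (\<sigma> @ [p]) \<Longrightarrow> eh_step P (A \<sigma>) p (A (\<sigma> @ [p]))"
begin

text \<open>No sand, and no medium item after a large one. The second condition is what prevents
  bonus items.\<close>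

definition plain :: "real list \<Rightarrow> bool" where
  "plain \<sigma> \<longleftrightarrow> (\<forall>p\<in>set \<sigma>. 0 < p \<and> p \<le> 1 \<and> type_of P p < N) \<and>
     sorted_wrt (\<lambda>x y. large x \<longrightarrow> \<not> medium y) \<sigma>"

lemma plain_prefix: "plain (\<sigma> @ \<tau>) \<Longrightarrow> plain \<sigma>"
  unfolding plain_def by (simp add: sorted_wrt_append)

lemma plain_snoc:
  assumes "plain (\<sigma> @ [p])"
  shows "valid_input (\<sigma> @ [p])" "0 < p" "p \<le> 1" "type_of P p < N"
    "medium p \<Longrightarrow> \<forall>x\<in>set \<sigma>. \<not> large x"
  using assms unfolding plain_def valid_input_def by (auto simp: sorted_wrt_append)

lemma run_regular: "plain \<sigma> \<Longrightarrow> regular P (A \<sigma>) \<and> sizes (A \<sigma>) = \<sigma>"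
proof (induction \<sigma> rule: rev_induct)
  case Nil
  then show ?case using regular_init[of P] unfolding start by (simp add: init_state_def)
next
  case (snoc p \<sigma>)
  then have IH: "regular P (A \<sigma>)" "sizes (A \<sigma>) = \<sigma>" using plain_prefix by auto
  note ps = plain_snoc[OF snoc.prems]
  have nl: "medium p \<Longrightarrow> \<forall>k\<in>items (A \<sigma>). \<not> large (sizes (A \<sigma>) ! k)"
    using ps(5) IH(2) unfolding items_def by auto
  show ?case
    using step_regular[OF IH(1) step[OF ps(1)] ps(2-4) nl] IH(2) by simp
qed

lemma run_step:
  assumes "plain (\<sigma> @ [p])"
  shows "eh_step P (A \<sigma>) p (A (\<sigma> @ [p]))" "\<And>k. k < length \<sigma> \<Longrightarrow> bin_of (A (\<sigma> @ [p])) k = bin_of (A \<sigma>) k"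
    "\<And>k. k < length \<sigma> \<Longrightarrow> col (A \<sigma>) k \<noteq> Uncolored \<Longrightarrow> col (A (\<sigma> @ [p])) k = col (A \<sigma>) k"
proof -
  note IH = run_regular[OF plain_prefix[OF assms]]
  note ps = plain_snoc[OF assms]
  have nl: "medium p \<Longrightarrow> \<forall>k\<in>items (A \<sigma>). \<not> large (sizes (A \<sigma>) ! k)"
    using ps(5) IH unfolding items_def by auto
  note sr = step_regular[OF conjunct1[OF IH] step[OF ps(1)] ps(2-4) nl]
  show "eh_step P (A \<sigma>) p (A (\<sigma> @ [p]))" using step[OF ps(1)] .
  show "\<And>k. k < length \<sigma> \<Longrightarrow> bin_of (A (\<sigma> @ [p])) k = bin_of (A \<sigma>) k"
    "\<And>k. k < length \<sigma> \<Longrightarrow> col (A \<sigma>) k \<noteq> Uncolored \<Longrightarrow> col (A (\<sigma> @ [p])) k = col (A \<sigma>) k"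
    using sr(3,4) IH unfolding items_def by auto
qed

lemma run_keep:
  assumes "plain (\<sigma> @ \<tau>)" "k < length \<sigma>"
  shows "bin_of (A (\<sigma> @ \<tau>)) k = bin_of (A \<sigma>) k \<and>
    (col (A \<sigma>) k \<noteq> Uncolored \<longrightarrow> col (A (\<sigma> @ \<tau>)) k = col (A \<sigma>) k)"
  using assms(1)
proof (induction \<tau> rule: rev_induct)
  case (snoc p \<tau>)
  have pl: "plain ((\<sigma> @ \<tau>) @ [p])" using snoc.prems by simp
  then show ?case
    using snoc.IH plain_prefix[OF pl] run_step(2,3)[OF pl, of k] assms(2) by simp
qed simp

text \<open>After a plain prefix \<open>nf_bin\<close> is \<open>None\<close>, so the first grain
  opens a bin, and Next Fit never returns to the bins of the prefix.\<close>

lemma sand_run: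
  assumes pl: "plain \<sigma>" and sand: "\<forall>s\<in>set \<tau>. 0 < s \<and> s \<le> t N"
  defines "S \<equiv> A \<sigma>" and "T \<equiv> A (\<sigma> @ \<tau>)"
  shows "sizes T = \<sigma> @ \<tau> \<and> nbins S \<le> nbins T \<and> (\<forall>k<length \<sigma>. bin_of T k = bin_of S k) \<and>
    (\<forall>k. length \<sigma> \<le> k \<longrightarrow> k < length (\<sigma> @ \<tau>) \<longrightarrow> nbins S \<le> bin_of T k \<and> bin_of T k < nbins T) \<and>
    (\<forall>B. nf_bin T = Some B \<longrightarrow> nbins S \<le> B \<and> B < nbins T) \<and>
    (\<forall>B\<ge>nbins S. (\<Sum>k\<in>content T B. (\<sigma> @ \<tau>) ! k) \<le> 1)"
  using sand unfolding T_def
proof (induction \<tau> rule: rev_induct)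
  case Nil
  have r: "regular P S" "sizes S = \<sigma>" using run_regular[OF pl] unfolding S_def by auto
  have "content S B = {}" if "nbins S \<le> B" for B
    using regular.item[OF r(1)] that by fastforce
  then show ?case using regular.nf[OF r(1)] by (simp add: S_def[symmetric] r(2))
next
  case (snoc s \<tau>)
  define U where "U = A (\<sigma> @ \<tau>)"
  have s: "0 < s" "s \<le> t N" using snoc.prems by auto
  have IH: "sizes U = \<sigma> @ \<tau>" "nbins S \<le> nbins U" "\<forall>k<length \<sigma>. bin_of U k = bin_of S k"
    "\<And>k. length \<sigma> \<le> k \<Longrightarrow> k < length (\<sigma> @ \<tau>) \<Longrightarrow> nbins S \<le> bin_of U k \<and> bin_of U k < nbins U"
    "\<And>B. nf_bin U = Some B \<Longrightarrow> nbins S \<le> B \<and> B < nbins U"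
    "\<And>B. nbins S \<le> B \<Longrightarrow> (\<Sum>k\<in>content U B. (\<sigma> @ \<tau>) ! k) \<le> 1"
    using snoc.IH snoc.prems unfolding U_def by auto
  have s1: "s \<le> 1" using s thr_N_less by simp
  have v: "valid_input ((\<sigma> @ \<tau>) @ [s])"
    using pl snoc.prems s thr_N_less unfolding plain_def valid_input_def by fastforce
  define V where "V = A ((\<sigma> @ \<tau>) @ [s])"
  have V: "V = next_fit P U s"
    using step[OF v] type_of_N[OF s(2)] unfolding eh_step_def U_def V_def by simp
  define n where "n = length (\<sigma> @ \<tau>)"
  obtain B where B: "nbins S \<le> B" "B < nbins V" "nf_bin V = Some B" "sizes V = sizes U @ [s]"
    "bin_of V = (bin_of U)(n := B)" "nbins U \<le> nbins V" "(\<Sum>k\<in>content U B. (\<sigma> @ \<tau>) ! k) + s \<le> 1"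
  proof (cases "\<exists>B. nf_bin U = Some B \<and> (\<Sum>k\<in>content U B. sizes U ! k) + s \<le> 1")
    case True
    then obtain B where "nf_bin U = Some B" "(\<Sum>k\<in>content U B. sizes U ! k) + s \<le> 1" by blast
    then show thesis using that[of B] IH(5)[of B] V IH(1) unfolding next_fit_def n_def
      by (simp add: add_item_def Let_def)
  next
    case False
    then have VV: "V = (add_item (open_new_bin U PureBlue) s N (nbins U) Blue)\<lparr>nf_bin := Some (nbins U)\<rparr>"
      using V unfolding next_fit_def by (auto split: option.splits)
    have "bin_of U k \<noteq> nbins U" if "k \<in> items U" for k
    proof (cases "length \<sigma> \<le> k")
      case True then show ?thesis using IH(4)[of k] that IH(1) unfolding items_def by auto
    next
      case False
      then have "k \<in> items S" using run_regular[OF pl] unfolding S_def items_def by simp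
      then show ?thesis using regular.item[of P S k] run_regular[OF pl] IH(2,3) False unfolding S_def by auto
    qed
    then have "content U (nbins U) = {}" by auto
    then show thesis using that[of "nbins U"] VV IH(1,2) s1 unfolding n_def
      by (simp add: add_item_def open_new_bin_def Let_def)
  qed
  have itV: "items V = insert n (items U)" "n \<notin> items U"
    using B(4) IH(1) unfolding items_def n_def by auto
  have cV: "content V B' = (if B' = B then insert n (content U B') else content U B')" for B'
    using itV B(5) by (auto simp: set_eq_iff)
  have "(\<Sum>k\<in>content V B'. (\<sigma> @ \<tau> @ [s]) ! k) \<le> 1" if b: "nbins S \<le> B'" for B'
  proof -
    have e: "(\<Sum>k\<in>content U B'. (\<sigma> @ \<tau> @ [s]) ! k) = (\<Sum>k\<in>content U B'. (\<sigma> @ \<tau>) ! k)"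
      using IH(1) by (intro sum.cong) (auto simp: items_def nth_append)
    show ?thesis
    proof (cases "B' = B")
      case True
      have "(\<sigma> @ \<tau> @ [s]) ! n = s" unfolding n_def by (simp add: nth_append)
      then show ?thesis using True e B(7) itV(2) unfolding cV by simp
    qed (use e IH(6)[OF b] cV in simp)
  qed
  moreover have "nbins S \<le> bin_of V k \<and> bin_of V k < nbins V"
    if "length \<sigma> \<le> k" "k < Suc n" for k
    using that IH(4)[of k] B unfolding n_def by (cases "k = length (\<sigma> @ \<tau>)") (auto simp: n_def)
  moreover have "\<forall>k<length \<sigma>. bin_of V k = bin_of S k"
    using IH(3) B(5) unfolding n_def by auto
  ultimately have "sizes V = \<sigma> @ \<tau> @ [s] \<and> nbins S \<le> nbins V \<and> (\<forall>k<length \<sigma>. bin_of V k = bin_of S k) \<and>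
    (\<forall>k. length \<sigma> \<le> k \<longrightarrow> k < length (\<sigma> @ \<tau> @ [s]) \<longrightarrow> nbins S \<le> bin_of V k \<and> bin_of V k < nbins V) \<and>
    (\<forall>B. nf_bin V = Some B \<longrightarrow> nbins S \<le> B \<and> B < nbins V) \<and>
    (\<forall>B\<ge>nbins S. (\<Sum>k\<in>content V B. (\<sigma> @ \<tau> @ [s]) ! k) \<le> 1)"
    using B(1-4,6) IH(1,2) unfolding n_def by simp
  then show ?case unfolding V_def by simp
qed

text \<open>Sand bins are disjoint from the earlier ones and hold volume at most 1 each. Volume
  alone suffices, as the grains are used to fill offline bins almost completely.\<close>

lemma sand_bins:
  assumes pl: "plain \<sigma>" and sand: "\<forall>s\<in>set \<tau>. 0 < s \<and> s \<le> t N"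
  shows "real (bins_used (A \<sigma>)) + sum_list \<tau> \<le> real (bins_used (A (\<sigma> @ \<tau>)))"
proof -
  define S where "S = A \<sigma>"
  define T where "T = A (\<sigma> @ \<tau>)"
  define n where "n = length \<sigma>"
  define m where "m = length (\<sigma> @ \<tau>)"
  have T: "sizes T = \<sigma> @ \<tau>" "\<forall>k<n. bin_of T k = bin_of S k"
    "\<And>k. n \<le> k \<Longrightarrow> k < m \<Longrightarrow> nbins S \<le> bin_of T k \<and> bin_of T k < nbins T"
    "\<And>B. nbins S \<le> B \<Longrightarrow> (\<Sum>k\<in>content T B. (\<sigma> @ \<tau>) ! k) \<le> 1"
    using sand_run[OF assms] unfolding S_def T_def n_def m_def by blast+
  have S: "regular P S" "sizes S = \<sigma>" using run_regular[OF pl] unfolding S_def by auto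
  have SB: "bin_of S k < nbins S" if "k < n" for k
    using regular.item[OF S(1), of k] that S(2) unfolding items_def n_def by auto
  have it: "items S = {..<n}" "items T = {..<n} \<union> {n..<m}"
    using T(1) S(2) unfolding items_def n_def m_def by auto
  have disj: "bin_of T ` {..<n} \<inter> bin_of T ` {n..<m} = {}"
    using SB T(2,3) by fastforce
  have "bins_used T = card (bin_of T ` {..<n}) + card (bin_of T ` {n..<m})"
    unfolding bins_used_def it image_Un using disj by (intro card_Un_disjoint) auto
  moreover have "bin_of T ` {..<n} = bin_of S ` {..<n}" using T(2) by auto
  ultimately have b: "bins_used T = bins_used S + card (bin_of T ` {n..<m})"
    unfolding bins_used_def it(1) by simp
  have "sum_list \<tau> = (\<Sum>k\<in>{n..<m}. (\<sigma> @ \<tau>) ! k)"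
    unfolding sum_list_sum_nth n_def m_def
    by (rule sum.reindex_bij_witness[of _ "\<lambda>k. k - length \<sigma>" "\<lambda>k. length \<sigma> + k"]) (auto simp: nth_append)
  also have "\<dots> = (\<Sum>B\<in>bin_of T ` {n..<m}. \<Sum>k\<in>{k \<in> {n..<m}. bin_of T k = B}. (\<sigma> @ \<tau>) ! k)"
    by (intro sum.group[symmetric]) auto
  also have "\<dots> \<le> (\<Sum>B\<in>bin_of T ` {n..<m}. 1)"
  proof (rule sum_mono)
    fix B assume "B \<in> bin_of T ` {n..<m}"
    then have B: "nbins S \<le> B" using T(3) by auto
    have "bin_of T k \<noteq> B" if "k < n" for k using that T(2) SB[OF that] B by auto
    then have "{k \<in> {n..<m}. bin_of T k = B} = content T B"
      using it(2) unfolding content_def by fastforce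
    then show "(\<Sum>k\<in>{k \<in> {n..<m}. bin_of T k = B}. (\<sigma> @ \<tau>) ! k) \<le> 1" using T(4)[OF B] by simp
  qed
  finally have "sum_list \<tau> \<le> real (card (bin_of T ` {n..<m}))" by simp
  then show ?thesis using b unfolding S_def T_def by simp
qed

end

section \<open>The medium items\<close>

text \<open>\<open>m\<close> is a medium type that uses red items; \<open>f\<close> is a type of
  smaller items, whose red items may be joined by blue items of type \<open>m\<close>. While only
  these types arrive, no large item is present.\<close>

locale medium_phase = eh_parameters +
  fixes m f :: nat
  assumes m: "1 \<le> m" "m < N" "medium (t m)" and red_m: "redfrac P m > 0"
    and f: "1 \<le> f" "f < N" "t f \<le> 1/3"
begin

abbreviation "\<alpha> \<equiv> redfrac P m"

lemma m_type: "medium_type P m" and f_type: "\<not> medium_type P f" and m_f: "m \<noteq> f"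
  using m f unfolding medium_type_def medium_def by auto

lemma alpha: "0 < \<alpha>" "\<alpha> < 1/3"
  using red_m redfrac_less[of m] m by auto

lemma redfit_m: "redfit P m = 1"
  using redfit_medium[of m] m m_type red_m by simp

lemma bluefit_m: "bluefit P m = 2"
proof -
  have "\<lfloor>1 / t m\<rfloor> = 2"
    using m(3) unfolding medium_def by (intro floor_unique) (auto simp: field_simps)
  then show ?thesis unfolding bluefit_def by simp
qed

lemma m_not_hosted: "i = m \<or> i = f \<Longrightarrow> \<not> needs P m \<le> leaves P i"
  using no_medium_host[of i m] m f m_type red_m by auto

section \<open>States with items of types \<open>m\<close> and \<open>f\<close> only, and the marks
  in them\<close>

definition two_types :: "eh_state \<Rightarrow> bool" where
  "two_types S \<longleftrightarrow> regular P S \<and> (\<forall>k\<in>items S. lab S k = m \<or> lab S k = f)"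

lemma two_types_not_large:
  assumes "two_types S" "k \<in> items S"
  shows "\<not> large (sizes S ! k)"
proof -
  have "sizes S ! k \<le> t (lab S k)"
    using assms regular.item[of P S k] type_of_bounds(3)[of "sizes S ! k"] unfolding two_types_def by auto
  then show ?thesis using assms m f unfolding two_types_def large_def medium_def by fastforce
qed

text \<open>By type, neither \<open>m\<close> nor \<open>f\<close> leaves enough room for a red item
  of type \<open>m\<close>, and the rule by size needs a large item. A second red item is excluded
  by \<open>redfit\<close> 1.\<close>

lemma red_medium_alone:
  assumes tt: "two_types S" and k: "k \<in> labeled S m" "col S k = Red"
  shows "content S (bin_of S k) = {k}" "kind S (bin_of S k) = Unmixed"
proof -
  interpret regular P S using tt unfolding two_types_def by simp
  have ki: "k \<in> items S" "lab S k = m" using k by auto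
  have noblue: "col S k' \<noteq> Blue" if "k' \<in> content S (bin_of S k)" for k'
  proof
    assume "col S k' = Blue"
    then have "hosts P S k' k" using mix[of k' k] that k ki by auto
    then show False
      using m_not_hosted[of "lab S k'"] two_types_not_large[OF tt, of k'] tt that ki
      unfolding hosts_def two_types_def by auto
  qed
  have "k' = k" if k': "k' \<in> content S (bin_of S k)" for k'
  proof -
    have "col S k' \<noteq> Uncolored"
    proof
      assume "col S k' = Uncolored"
      then have "content S (bin_of S k) = {k'}" using unc[of k'] k' by auto
      moreover have "k \<in> content S (bin_of S k)" using ki by simp
      ultimately have "k = k'" by (metis singletonD)
      then show False using \<open>col S k' = Uncolored\<close> k by simp
    qed
    then have r: "col S k' = Red" using noblue[OF k'] color_cases[of "col S k'"] item[of k'] k' by auto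
    have "card (colored S (bin_of S k) Red) \<le> 1"
      using cap[OF ki(1)] k ki redfit_m unfolding capacity_for_def by simp
    moreover have "{k', k} \<subseteq> colored S (bin_of S k) Red" using r k k' by auto
    ultimately show ?thesis
      by (metis card_le_Suc0_iff_eq finite_colored insert_subset One_nat_def)
  qed
  then show "content S (bin_of S k) = {k}" using ki by auto
  have "kind S (bin_of S k) \<noteq> Mixed"
    using mixed[of "bin_of S k"] item[OF ki(1)] noblue by auto
  moreover have "kind S (bin_of S k) \<noteq> PureBlue" using pure[OF ki(1)] k by auto
  ultimately show "kind S (bin_of S k) = Unmixed" by (cases "kind S (bin_of S k)") auto
qed

lemma uncolored_unmixed:
  assumes tt: "two_types S" and k: "k \<in> items S" "col S k = Uncolored"
  shows "content S (bin_of S k) = {k}" "kind S (bin_of S k) = Unmixed" "lab S k = m"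
proof -
  interpret regular P S using tt unfolding two_types_def by simp
  show c: "content S (bin_of S k) = {k}" using unc[OF k] by simp
  have "col S k' = Uncolored" if "k' \<in> content S (bin_of S k)" for k'
    using that k unfolding c by simp
  then have "kind S (bin_of S k) \<noteq> Mixed"
    using mixed[of "bin_of S k"] item[OF k(1)] by fastforce
  moreover have "kind S (bin_of S k) \<noteq> PureBlue" using pure[OF k(1)] k by auto
  ultimately show "kind S (bin_of S k) = Unmixed" by (cases "kind S (bin_of S k)") auto
  have "medium_type P (lab S k)" using unc[OF k] item[OF k(1)] medium_type_of by auto
  then show "lab S k = m" using tt k f_type unfolding two_types_def by auto
qed

lemma blue_mate_medium:
  assumes tt: "two_types S" and k: "k \<in> labeled S m" "col S k = Blue" and k': "k' \<in> content S (bin_of S k)" "col S k' = Blue"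
  shows "k' \<in> labeled S m"
  using regular.same[of P S k' k] assms unfolding two_types_def by auto

lemma blue_le_2:
  assumes tt: "two_types S" and k: "k \<in> labeled S m" "col S k = Blue"
  shows "card (colored S (bin_of S k) Blue) \<le> 2"
  using regular.cap[of P S k] assms bluefit_m unfolding two_types_def capacity_for_def by auto

text \<open>Unmarked items of type \<open>m\<close> are uncolored or blue in a mixed bin, so those
  that are unmarked and colored await step 3. A mixed bin with a marked blue medium item is full and
  completely marked; thus only unmixed or pure blue bins can ask step 1 for a mark. At most one bin
  has a single unmarked blue item, because such a bin is blue-open and is filled before another one
  is begun.\<close>

definition marks_ok :: "eh_state \<Rightarrow> bool" where
  "marks_ok S \<longleftrightarrow> two_types S \<and>
     (\<forall>k\<in>labeled S m. mrk S k = None \<longrightarrow> col S k = Uncolored \<or> col S k = Blue \<and> kind S (bin_of S k) = Mixed) \<and>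
     (\<forall>k\<in>labeled S m. col S k = Uncolored \<longrightarrow> mrk S k = None) \<and>
     (\<forall>k\<in>labeled S m. mrk S k \<noteq> Some MarkR) \<and>
     (\<forall>k\<in>labeled S m. col S k = Blue \<and> kind S (bin_of S k) = Mixed \<and> mrk S k \<noteq> None \<longrightarrow>
        unmarked_blue S m (bin_of S k) = {} \<and> card (colored S (bin_of S k) Blue) = 2) \<and>
     (\<forall>B B'. card (unmarked_blue S m B) = 1 \<and> card (unmarked_blue S m B') = 1 \<longrightarrow> B = B')"

lemma marks_okD:
  assumes "marks_ok S"
  shows "two_types S"
    "k \<in> labeled S m \<Longrightarrow> mrk S k = None \<Longrightarrow> col S k = Uncolored \<or> col S k = Blue \<and> kind S (bin_of S k) = Mixed"
    "k \<in> labeled S m \<Longrightarrow> col S k = Uncolored \<Longrightarrow> mrk S k = None"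
    "k \<in> labeled S m \<Longrightarrow> mrk S k \<noteq> Some MarkR"
    "k \<in> labeled S m \<Longrightarrow> col S k = Blue \<Longrightarrow> kind S (bin_of S k) = Mixed \<Longrightarrow> mrk S k \<noteq> None \<Longrightarrow>
        unmarked_blue S m (bin_of S k) = {} \<and> card (colored S (bin_of S k) Blue) = 2"
    "card (unmarked_blue S m B) = 1 \<Longrightarrow> card (unmarked_blue S m B') = 1 \<Longrightarrow> B = B'"
proof -
  note a = assms[unfolded marks_ok_def]
  note c1 = a[THEN conjunct1] and r1 = a[THEN conjunct2]
  note c2 = r1[THEN conjunct1] and r2 = r1[THEN conjunct2]
  note c3 = r2[THEN conjunct1] and r3 = r2[THEN conjunct2]
  note c4 = r3[THEN conjunct1] and r4 = r3[THEN conjunct2]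
  note c5 = r4[THEN conjunct1] and c6 = r4[THEN conjunct2]
  show "two_types S" by (rule c1)
  show "k \<in> labeled S m \<Longrightarrow> mrk S k = None \<Longrightarrow> col S k = Uncolored \<or> col S k = Blue \<and> kind S (bin_of S k) = Mixed"
    using c2 by blast
  show "k \<in> labeled S m \<Longrightarrow> col S k = Uncolored \<Longrightarrow> mrk S k = None" using c3 by blast
  show "k \<in> labeled S m \<Longrightarrow> mrk S k \<noteq> Some MarkR" using c4 by blast
  show "k \<in> labeled S m \<Longrightarrow> col S k = Blue \<Longrightarrow> kind S (bin_of S k) = Mixed \<Longrightarrow> mrk S k \<noteq> None \<Longrightarrow>
        unmarked_blue S m (bin_of S k) = {} \<and> card (colored S (bin_of S k) Blue) = 2"
    using c5 by blast
  show "card (unmarked_blue S m B) = 1 \<Longrightarrow> card (unmarked_blue S m B') = 1 \<Longrightarrow> B = B'"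
    using c6 by metis
qed

lemma two_types_recolored: "two_types S \<Longrightarrow> recolored S S' \<Longrightarrow> two_types S'"
  using recolored_regular recolored_items unfolding two_types_def recolored_def by metis

definition pairs :: "eh_state \<Rightarrow> nat set" where
  "pairs S = {B. B < nbins S \<and> kind S B = Mixed \<and> card (unmarked_blue S m B) = 2}"

lemma no_inherits: 
  assumes "marks_ok S" shows "\<not> inherits_mark S m k M"
proof
  assume "inherits_mark S m k M"
  then obtain k' where k: "k \<in> unmarked_blue S m (bin_of S k)" and
    k': "k' \<in> content S (bin_of S k)" "col S k' = Blue" "mrk S k' = Some M"
    unfolding inherits_mark_def by auto
  have tt: "two_types S" using marks_okD(1)[OF assms] .
  have kk: "k \<in> labeled S m" "col S k = Blue" "mrk S k = None" using k by auto
  have l: "k' \<in> labeled S m" using blue_mate_medium[OF tt kk(1,2) k'(1,2)] .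
  have x: "kind S (bin_of S k) = Mixed" using marks_okD(2)[OF assms kk(1,3)] kk by simp
  have b: "bin_of S k' = bin_of S k" using k' by simp
  have x': "kind S (bin_of S k') = Mixed" unfolding b by (rule x)
  have n: "mrk S k' \<noteq> None" using k'(3) by simp
  have "unmarked_blue S m (bin_of S k') = {}" using marks_okD(5)[OF assms l k'(2) x' n] by (rule conjunct1)
  then show False using k unfolding b by blast
qed

lemma step1_id: "marks_ok S \<Longrightarrow> mark_step1 m S S' \<Longrightarrow> S' = S"
  using no_inherits unfolding mark_step1_def by auto

text \<open>Red items of type \<open>m\<close> lie in unmixed bins, so step 2 has no candidate for
  mark \<open>MarkR\<close>.\<close>

lemma step2_id: 
  assumes tt: "two_types S" and st: "mark_step2 P m S S'"
  shows "S' = S"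
proof -
  have "{k \<in> items S. lab S k = m \<and> mrk S k = None \<and> col S k \<in> {Red, Bonus} \<and> kind S (bin_of S k) = Mixed} = {}"
  proof -
    have "kind S (bin_of S k) \<noteq> Mixed" if "k \<in> items S" "lab S k = m" "col S k \<in> {Red, Bonus}" for k
      using red_medium_alone(2)[OF tt, of k] regular.item[of P S k] tt that unfolding two_types_def by auto
    then show ?thesis by auto
  qed
  then show ?thesis using st unfolding mark_step2_def Let_def by auto
qed

text \<open>The inequalities that the minimality of \<open>x\<close> yields if step 3 or 4 leaves an uncolored item alone.\<close>

definition idle3 :: "eh_state \<Rightarrow> bool" where
  "idle3 S \<longleftrightarrow> real (cnt_mark S m MarkB + 2 * card (pairs S) + 1) * \<alpha> < real (cnt_red_mark S m MarkB) + 1"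

definition idle4 :: "eh_state \<Rightarrow> bool" where
  "idle4 S \<longleftrightarrow> (real (cnt_mark S m MarkN) + 2 * real (card (uncolored_items S m)) - 1) * \<alpha> <
     real (cnt_red_mark S m MarkN) + 1"

text \<open>If step 3 is idle although an uncolored item exists, the required \<open>x\<close>
  exceeds the supply of \<open>2 * card (pairs S)\<close> blue items, which is \<open>idle3\<close>.
  The clause for \<open>Bs = {}\<close> later excludes that step 3 fires in a run without any
  pairs.\<close>

lemma step3_cases:
  assumes ok: "marks_ok S" and st: "mark_step3 P m S S'"
  shows "S' = S \<and> (uncolored_items S m \<noteq> {} \<longrightarrow> idle3 S) \<or>
    (\<exists>u Bs. u \<in> uncolored_items S m \<and> Bs \<subseteq> pairs S \<and>
       S' = set_color {u} Red (set_mark (insert u (\<Union>B\<in>Bs. unmarked_blue S m B)) MarkB S) \<and>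
       (Bs = {} \<longrightarrow> \<lfloor>real (cnt_mark S m MarkB + 1) * \<alpha>\<rfloor> > int (cnt_red_mark S m MarkB)))"
proof -
  define Q where "Q = (\<lambda>x::nat. \<lfloor>real (cnt_mark S m MarkB + x + 1) * \<alpha>\<rfloor> > int (cnt_red_mark S m MarkB))"
  define x where "x = (LEAST x. Q x)"
  define good where "good = (\<lambda>Bs. Bs \<subseteq> pairs S \<and> 2 * card Bs \<in> {x, x + 1})"
  have fin: "finite (pairs S)" unfolding pairs_def by auto
  have st': "if uncolored_items S m \<noteq> {} \<and> (\<exists>Bs. good Bs)
      then \<exists>u Bs. u \<in> uncolored_items S m \<and> good Bs \<and>
             S' = set_color {u} Red (set_mark (insert u (\<Union>B\<in>Bs. unmarked_blue S m B)) MarkB S)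
      else S' = S"
    using st unfolding mark_step3_def Let_def Q_def[symmetric] x_def[symmetric]
      pairs_def[symmetric] by (simp only: good_def)
  show ?thesis
  proof (cases "uncolored_items S m \<noteq> {} \<and> (\<exists>Bs. good Bs)")
    case True
    then obtain u Bs where u: "u \<in> uncolored_items S m" "good Bs"
      "S' = set_color {u} Red (set_mark (insert u (\<Union>B\<in>Bs. unmarked_blue S m B)) MarkB S)"
      using st' by auto
    have "Q 0" if "Bs = {}"
    proof -
      have "x = 0" using u(2) that unfolding good_def by auto
      moreover have "\<exists>x. Q x"
      proof -
        obtain y :: nat where y: "(real (cnt_red_mark S m MarkB) + 1) / \<alpha> < real y" using reals_Archimedean2 by blast
        then have "real (cnt_red_mark S m MarkB) + 1 < real y * \<alpha>" using alpha by (simp add: field_simps)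
        also have "\<dots> \<le> real (cnt_mark S m MarkB + y + 1) * \<alpha>" using alpha by (intro mult_right_mono) auto
        finally have "Q y" unfolding Q_def by linarith
        then show ?thesis by blast
      qed
      ultimately show ?thesis unfolding x_def by (metis LeastI)
    qed
    then show ?thesis using u unfolding good_def Q_def by auto
  next
    case False
    have "idle3 S" if U: "uncolored_items S m \<noteq> {}"
    proof -
      have "\<not> x \<le> 2 * card (pairs S)"
      proof
        assume le: "x \<le> 2 * card (pairs S)"
        \<comment> \<open>Bins contribute two blue items each; this is the number of bins for
          whichever of \<open>x\<close> and \<open>x + 1\<close> is even.\<close>
        define c where "c = (x + 1) div 2"
        have "c \<le> card (pairs S)" using le unfolding c_def by linarith
        have "2 * c = x \<or> 2 * c = x + 1" unfolding c_def by presburger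
        then have "2 * c \<in> {x, x + 1}" by simp
        obtain Bs where "Bs \<subseteq> pairs S" "card Bs = c"
          using obtain_subset_with_card_n[OF \<open>c \<le> card (pairs S)\<close>] by metis
        then show False using False U \<open>2 * c \<in> {x, x + 1}\<close> unfolding good_def by auto
      qed
      then have "\<not> Q (2 * card (pairs S))" unfolding x_def using not_less_Least not_le by blast
      then have "\<lfloor>real (cnt_mark S m MarkB + 2 * card (pairs S) + 1) * \<alpha>\<rfloor> \<le> int (cnt_red_mark S m MarkB)"
        unfolding Q_def by simp
      then show ?thesis unfolding idle3_def by linarith
    qed
    moreover have "S' = S" using st' False by meson
    ultimately show ?thesis by blast
  qed
qed

text \<open>If step 4 is idle, even \<open>x = card (uncolored_items S m) - 1\<close> fails the
  test, which is \<open>idle4\<close>.\<close>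

lemma step4_cases:
  assumes st: "mark_step4 P m S S'"
  shows "S' = S \<and> (uncolored_items S m \<noteq> {} \<longrightarrow> idle4 S) \<or>
    (\<exists>u X. u \<in> uncolored_items S m \<and> X \<subseteq> uncolored_items S m - {u} \<and>
       S' = set_color {u} Red (set_color X Blue (set_mark (insert u X) MarkN S)) \<and>
       real (cnt_red_mark S m MarkN) + 1 \<le> real (cnt_mark S m MarkN + 2 * card X + 1) * \<alpha> \<and>
       (\<forall>y. real (cnt_red_mark S m MarkN) + 1 \<le> real (cnt_mark S m MarkN + 2 * y + 1) * \<alpha> \<longrightarrow> card X \<le> y))"
proof -
  define Q where "Q = (\<lambda>x::nat. \<lfloor>real (cnt_mark S m MarkN + 2 * x + 1) * \<alpha>\<rfloor> > int (cnt_red_mark S m MarkN))"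
  define x where "x = (LEAST x. Q x)"
  define U where "U = uncolored_items S m"
  have Qiff: "Q y \<longleftrightarrow> real (cnt_red_mark S m MarkN) + 1 \<le> real (cnt_mark S m MarkN + 2 * y + 1) * \<alpha>" for y
    unfolding Q_def by linarith
  have st': "if x + 1 \<le> card U
      then \<exists>X b. b \<in> U \<and> (\<forall>u\<in>U. sizes S ! b \<le> sizes S ! u) \<and>
             X \<subseteq> U - {b} \<and> card X = x \<and> (\<forall>l\<in>X. \<forall>u\<in>U - X. sizes S ! u \<le> sizes S ! l) \<and>
             S' = set_color {b} Red (set_color X Blue (set_mark (insert b X) MarkN S))
      else S' = S"
    using st unfolding mark_step4_def Let_def Q_def[symmetric] x_def[symmetric] U_def .
  have ex: "\<exists>x. Q x"
  proof -
    obtain y :: nat where y: "(real (cnt_red_mark S m MarkN) + 1) / \<alpha> < real y" using reals_Archimedean2 by blast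
    then have "real (cnt_red_mark S m MarkN) + 1 < real y * \<alpha>" using alpha by (simp add: field_simps)
    also have "\<dots> \<le> real (cnt_mark S m MarkN + 2 * y + 1) * \<alpha>" using alpha by (intro mult_right_mono) auto
    finally have "Q y" unfolding Q_def by linarith
    then show ?thesis by blast
  qed
  show ?thesis
  proof (cases "x + 1 \<le> card U")
    case True
    then obtain X b where X: "b \<in> U" "X \<subseteq> U - {b}" "card X = x"
      "S' = set_color {b} Red (set_color X Blue (set_mark (insert b X) MarkN S))"
      using st' by auto
    have "Q (card X)" using LeastI_ex[OF ex] X(3) unfolding x_def by simp
    moreover have "\<forall>y. Q y \<longrightarrow> card X \<le> y" using Least_le[of Q] X(3) unfolding x_def by simp
    ultimately show ?thesis using X unfolding U_def Qiff by blast
  next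
    case False
    have "idle4 S" if "U \<noteq> {}"
    proof -
      have c: "0 < card U" using that unfolding U_def by (simp add: card_gt_0_iff)
      then have "card U - 1 < x" using False by simp
      then have "\<not> Q (card U - 1)" unfolding x_def using not_less_Least by blast
      moreover have "real (cnt_mark S m MarkN + 2 * (card U - 1) + 1) = real (cnt_mark S m MarkN) + 2 * real (card U) - 1"
        using c by (simp add: of_nat_diff)
      ultimately show ?thesis unfolding Qiff idle4_def U_def[symmetric] by (simp only: not_le)
    qed
    then show ?thesis using st' False unfolding U_def by auto
  qed
qed

text \<open>As \<open>bluefit P m\<close> is 2, each chosen bin is full, and both of its blue items
  get the mark. So the demand on mixed bins with a marked item is met.\<close>

lemma marks_ok_step3:
  assumes ok: "marks_ok S" and u: "u \<in> uncolored_items S m" and Bs: "Bs \<subseteq> pairs S"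
    and S': "S' = set_color {u} Red (set_mark (insert u (\<Union>B\<in>Bs. unmarked_blue S m B)) MarkB S)"
  shows "marks_ok S'" "reds S' m = insert u (reds S m)" "u \<notin> reds S m"
proof -
  note okD = marks_okD[OF ok]
  note tt = okD(1)
  have uu: "u \<in> items S" "lab S u = m" "col S u = Uncolored" using u by auto
  have rc: "recolored S S'" unfolding S' recolored_def using uu by auto
  have it: "items S' = items S" "content S' = content S" "labeled S' = labeled S"
    using recolored_items[OF rc] by auto
  define Z where "Z = (\<Union>B\<in>Bs. unmarked_blue S m B)"
  have Ziff: "k \<in> Z \<longleftrightarrow> bin_of S k \<in> Bs \<and> k \<in> labeled S m \<and> col S k = Blue \<and> mrk S k = None" for k
    unfolding Z_def by auto
  have sel: "bin_of S' = bin_of S" "kind S' = kind S" "lab S' = lab S"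
    "\<And>k. col S' k = (if k = u then Red else col S k)"
    "\<And>k. mrk S' k = (if k = u \<or> k \<in> Z then Some MarkB else mrk S k)"
    unfolding S' Z_def by auto
  have colB: "colored S' B Blue = colored S B Blue" for B
    unfolding colored_def it sel(4) using uu by auto
  have ub: "unmarked_blue S' m B = (if B \<in> Bs then {} else unmarked_blue S m B)" for B
    using uu unfolding set_eq_iff unmarked_blue_iff it sel Ziff by auto
  have pm: "kind S B = Mixed" "card (unmarked_blue S m B) = 2" if "B \<in> Bs" for B
    using Bs that unfolding pairs_def by auto
  have full: "unmarked_blue S' m (bin_of S' k) = {} \<and> card (colored S' (bin_of S' k) Blue) = 2"
    if k: "k \<in> labeled S m" "col S' k = Blue" "kind S (bin_of S k) = Mixed" "mrk S' k \<noteq> None" for k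
  proof (cases "bin_of S k \<in> Bs")
    case True
    have kb: "col S k = Blue" "k \<noteq> u" using k(2) unfolding sel by (auto split: if_splits)
    have "unmarked_blue S m (bin_of S k) \<subseteq> colored S (bin_of S k) Blue" by auto
    then have "2 \<le> card (colored S (bin_of S k) Blue)"
      using pm(2)[OF True] card_mono[OF finite_colored] by metis
    then have "card (colored S (bin_of S k) Blue) = 2" using blue_le_2[OF tt k(1) kb(1)] by simp
    then show ?thesis using True ub colB sel by simp
  next
    case False
    then have "col S k = Blue" "mrk S k \<noteq> None" using k unfolding sel Ziff by (auto split: if_splits)
    then show ?thesis using okD(5)[of k] k False ub colB unfolding sel(1) by simp
  qed
  show "marks_ok S'"
    unfolding marks_ok_def it
  proof (intro conjI ballI allI impI)
    show "two_types S'" using two_types_recolored[OF tt rc] .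
  next
    fix k assume k: "k \<in> labeled S m" "mrk S' k = None"
    then have "mrk S k = None" "k \<noteq> u" unfolding sel by (auto split: if_splits)
    then show "col S' k = Uncolored \<or> col S' k = Blue \<and> kind S' (bin_of S' k) = Mixed"
      using okD(2)[OF k(1)] unfolding sel by simp
  next
    fix k assume k: "k \<in> labeled S m" "col S' k = Uncolored"
    then have "k \<noteq> u" "col S k = Uncolored" unfolding sel by (auto split: if_splits)
    then show "mrk S' k = None" using okD(3)[OF k(1)] unfolding sel Ziff by simp
  next
    fix k assume k: "k \<in> labeled S m"
    then show "mrk S' k \<noteq> Some MarkR" using okD(4) unfolding sel by simp
  next
    fix k assume "k \<in> labeled S m" "col S' k = Blue \<and> kind S' (bin_of S' k) = Mixed \<and> mrk S' k \<noteq> None"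
    then show "unmarked_blue S' m (bin_of S' k) = {}" "card (colored S' (bin_of S' k) Blue) = 2"
      using full[of k] sel(1,2) by auto
  next
    fix B B' assume "card (unmarked_blue S' m B) = 1 \<and> card (unmarked_blue S' m B') = 1"
    then have "card (unmarked_blue S m B) = 1" "card (unmarked_blue S m B') = 1"
      unfolding ub by (simp_all split: if_splits)
    then show "B = B'" by (rule okD(6))
  qed
  show "reds S' m = insert u (reds S m)" "u \<notin> reds S m"
    using uu unfolding reds_def it sel by auto
qed

text \<open>The items concerned are uncolored, hence alone in unmixed bins, and all conditions on
  mixed bins are unaffected.\<close>

lemma marks_ok_step4:
  assumes ok: "marks_ok S" and u: "u \<in> uncolored_items S m" and X: "X \<subseteq> uncolored_items S m - {u}"
    and S': "S' = set_color {u} Red (set_color X Blue (set_mark (insert u X) MarkN S))"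
  shows "marks_ok S'" "reds S' m = insert u (reds S m)" "u \<notin> reds S m"
proof -
  note okD = marks_okD[OF ok]
  note tt = okD(1)
  have uu: "u \<in> items S" "lab S u = m" "col S u = Uncolored" using u by auto
  have XX: "k \<in> labeled S m" "col S k = Uncolored" "k \<noteq> u" if "k \<in> X" for k using X that by auto
  have rc: "recolored S S'" unfolding S' recolored_def using uu XX by auto
  have it: "items S' = items S" "content S' = content S" "labeled S' = labeled S"
    using recolored_items[OF rc] by auto
  have sel: "bin_of S' = bin_of S" "kind S' = kind S" "lab S' = lab S"
    "\<And>k. col S' k = (if k = u then Red else if k \<in> X then Blue else col S k)"
    "\<And>k. mrk S' k = (if k = u \<or> k \<in> X then Some MarkN else mrk S k)"
    unfolding S' by auto
  have ub: "unmarked_blue S' m B = unmarked_blue S m B" for B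
    using uu XX unfolding set_eq_iff unmarked_blue_iff it sel by auto
  have Xk: "kind S (bin_of S k) = Unmixed" if "k \<in> X" for k
    using uncolored_unmixed(2)[OF tt, of k] XX[OF that] by auto
  have colB: "colored S' (bin_of S k) Blue = colored S (bin_of S k) Blue" if "kind S (bin_of S k) = Mixed" for k
  proof -
    have "col S' k' = Blue \<longleftrightarrow> col S k' = Blue" if k': "k' \<in> content S (bin_of S k)" for k'
    proof -
      have "k' \<notin> X" using Xk[of k'] k' \<open>kind S (bin_of S k) = Mixed\<close> by auto
      then show ?thesis using uu unfolding sel by auto
    qed
    then show ?thesis unfolding colored_def it by auto
  qed
  show "marks_ok S'"
    unfolding marks_ok_def it
  proof (intro conjI ballI allI impI)
    show "two_types S'" using two_types_recolored[OF tt rc] .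
  next
    fix k assume k: "k \<in> labeled S m" "mrk S' k = None"
    then have "mrk S k = None" "k \<noteq> u" "k \<notin> X" unfolding sel by (auto split: if_splits)
    then show "col S' k = Uncolored \<or> col S' k = Blue \<and> kind S' (bin_of S' k) = Mixed"
      using okD(2)[OF k(1)] unfolding sel by simp
  next
    fix k assume k: "k \<in> labeled S m" "col S' k = Uncolored"
    then have "k \<noteq> u" "k \<notin> X" "col S k = Uncolored" unfolding sel by (auto split: if_splits)
    then show "mrk S' k = None" using okD(3)[OF k(1)] unfolding sel by simp
  next
    fix k assume k: "k \<in> labeled S m"
    then show "mrk S' k \<noteq> Some MarkR" using okD(4) unfolding sel by simp
  next
    fix k assume k: "k \<in> labeled S m" "col S' k = Blue \<and> kind S' (bin_of S' k) = Mixed \<and> mrk S' k \<noteq> None"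
    then have h: "k \<notin> X" "k \<noteq> u" "col S k = Blue" "mrk S k \<noteq> None" "kind S (bin_of S k) = Mixed"
      using Xk[of k] unfolding sel by (auto split: if_splits)
    then show "unmarked_blue S' m (bin_of S' k) = {}" "card (colored S' (bin_of S' k) Blue) = 2"
      using okD(5)[of k] k(1) colB[of k] unfolding ub sel(1) by auto
  next
    fix B B' assume "card (unmarked_blue S' m B) = 1 \<and> card (unmarked_blue S' m B') = 1"
    then show "B = B'" unfolding ub using okD(6) by blast
  qed
  show "reds S' m = insert u (reds S m)" "u \<notin> reds S m"
    using uu XX unfolding reds_def it sel by auto
qed

end

section \<open>The arrival of one medium item\<close>

context medium_phase
begin

lemma two_types_no_bonus: "two_types S \<Longrightarrow> \<forall>k\<in>items S. col S k \<noteq> Bonus"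
  using regular.item unfolding two_types_def by blast

lemma mark_and_color_inert:
  assumes tt: "two_types S" and i: "i \<noteq> m" "medium_type P i" and st: "mark_and_color P i S S'"
  shows "S' = S"
proof -
  have e: "lab S k \<noteq> i" if "k \<in> items S" for k
    using tt that i f_type unfolding two_types_def by auto
  obtain S1 S2 S3 where s: "mark_step1 i S S1" "mark_step2 P i S1 S2" "mark_step3 P i S2 S3" "mark_step4 P i S3 S'"
    using st unfolding mark_and_color_def by auto
  have 1: "S1 = S"
    using s(1) e unfolding mark_step1_def inherits_mark_def unmarked_blue_def by (auto split: if_splits)
  have U: "uncolored_items S i = {}" using e unfolding uncolored_items_def by auto
  have C: "{k \<in> items S. lab S k = i \<and> mrk S k = None \<and> col S k \<in> {Red, Bonus} \<and> kind S (bin_of S k) = Mixed} = {}"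
    using e by auto
  have 2: "S2 = S" using s(2) unfolding 1 mark_step2_def Let_def C by auto
  have 3: "S3 = S" using s(3) U unfolding 2 mark_step3_def Let_def by auto
  show ?thesis using s(4) U unfolding 3 mark_step4_def Let_def by auto
qed

lemma mark_and_color_all_m:
  assumes tt: "two_types S" and st: "mark_and_color_all P S S'"
  shows "mark_and_color P m S S'"
proof -
  have "foldr (\<lambda>i R. mark_and_color P i OO R) is (=) S S' \<Longrightarrow> two_types S \<Longrightarrow> distinct is \<Longrightarrow>
     (\<forall>i\<in>set is. medium_type P i) \<Longrightarrow> (if m \<in> set is then mark_and_color P m S S' else S' = S)" for "is" S
  proof (induction "is" arbitrary: S)
    case (Cons i "is")
    then obtain T where T: "mark_and_color P i S T" "foldr (\<lambda>i R. mark_and_color P i OO R) is (=) T S'" by auto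
    have tT: "two_types T"
      using two_types_recolored[OF Cons.prems(2)] mark_and_color_recolored[OF two_types_no_bonus[OF Cons.prems(2)] T(1)] .
    have IH: "if m \<in> set is then mark_and_color P m T S' else S' = T"
      using Cons.IH[OF T(2) tT] Cons.prems by simp
    show ?case
    proof (cases "i = m")
      case True
      then show ?thesis using IH T(1) Cons.prems by simp
    next
      case False
      then have "T = S" using mark_and_color_inert[OF Cons.prems(2) False _ T(1)] Cons.prems by simp
      then show ?thesis using IH False by (auto split: if_splits)
    qed
  qed auto
  moreover define ts where "ts = filter (\<lambda>i. medium_type P i \<and> redfrac P i > 0) [1..<N]"
  moreover have "distinct ts" "\<forall>i\<in>set ts. medium_type P i" "m \<in> set ts"
    unfolding ts_def using m(1,2) m_type red_m by simp_all
  moreover have "foldr (\<lambda>i R. mark_and_color P i OO R) ts (=) S S'"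
    using st unfolding mark_and_color_all_def ts_def .
  ultimately show ?thesis using tt by metis
qed

text \<open>In case A an item of type \<open>m\<close> can only open a bin, and it stays uncolored
  there although the red counter rises. In case B it opens a bin only if there is neither a
  blue-open bin of its type nor a compatible red item.\<close>

definition arrived_new :: "eh_state \<Rightarrow> eh_state \<Rightarrow> bool" where
  "arrived_new S T \<longleftrightarrow> (case_A P S m \<or> \<not> (\<exists>B. open_bin P S Blue m B) \<and>
       \<not> (\<exists>k\<in>items S. kind S (bin_of S k) = Unmixed \<and> col S k = Red \<and> needs P (lab S k) \<le> leaves P m)) \<and>
     bin_of T (length (sizes S)) = nbins S \<and> col T (length (sizes S)) = Uncolored \<and>
     kind T = (kind S)(nbins S := Unmixed)"

definition arrived_open :: "eh_state \<Rightarrow> eh_state \<Rightarrow> bool" where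
  "arrived_open S T \<longleftrightarrow> \<not> case_A P S m \<and> open_bin P S Blue m (bin_of T (length (sizes S))) \<and>
     col T (length (sizes S)) = Blue \<and> kind T = kind S"

definition arrived_host :: "eh_state \<Rightarrow> eh_state \<Rightarrow> bool" where
  "arrived_host S T \<longleftrightarrow> (let B = bin_of T (length (sizes S)) in
     \<not> case_A P S m \<and> (\<nexists>B. open_bin P S Blue m B) \<and> kind S B = Unmixed \<and>
     (\<exists>k\<in>content S B. col S k = Red \<and> lab S k = f) \<and> needs P f \<le> leaves P m \<and>
     col T (length (sizes S)) = Blue \<and> kind T = (kind S)(B := Mixed))"

definition arrived :: "eh_state \<Rightarrow> real \<Rightarrow> eh_state \<Rightarrow> bool" where
  "arrived S p T \<longleftrightarrow> sizes T = sizes S @ [p] \<and> bin_of T = (bin_of S)(length (sizes S) := bin_of T (length (sizes S))) \<and>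
     lab T = (lab S)(length (sizes S) := m) \<and> (\<forall>k\<in>items S. col T k = col S k \<and> mrk T k = mrk S k) \<and>
     cnt_red T = (if case_A P S m then (cnt_red S)(m := Suc (cnt_red S m)) else cnt_red S) \<and>
     cnt T = (cnt S)(m := Suc (cnt S m)) \<and>
     (arrived_new S T \<or> arrived_open S T \<or> arrived_host S T)"

lemma arrived_items:
  assumes "arrived S p T"
  shows "items T = insert (length (sizes S)) (items S)" "length (sizes S) \<notin> items S"
    "content T B' = (if B' = bin_of T (length (sizes S)) then insert (length (sizes S)) (content S B') else content S B')"
    "labeled T m = insert (length (sizes S)) (labeled S m)"
proof -
  define n where "n = length (sizes S)"
  have a: "sizes T = sizes S @ [p]" "bin_of T = (bin_of S)(n := bin_of T n)" "lab T = (lab S)(n := m)"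
    using assms unfolding arrived_def n_def by auto
  show 1: "items T = insert (length (sizes S)) (items S)" unfolding items_def a(1) by auto
  show 2: "length (sizes S) \<notin> items S" unfolding items_def by auto
  show "content T B' = (if B' = bin_of T (length (sizes S)) then insert (length (sizes S)) (content S B') else content S B')"
    unfolding set_eq_iff content_iff 1 using 2 unfolding n_def[symmetric] by (subst (1 2) a(2)) auto
  show "labeled T m = insert (length (sizes S)) (labeled S m)"
    unfolding set_eq_iff labeled_iff 1 a(3) using 2 unfolding n_def[symmetric] by auto
qed

text \<open>A red-open bin does not exist because \<open>redfit P m\<close> is 1, and a
  red-compatible one would contain a large item. For a blue item, a compatible bin must hold red
  items of type \<open>f\<close>, since those of type \<open>m\<close> need too much space.\<close>

lemma handle_medium:
  assumes tt: "two_types S" and st: "handle_item P S p T" and p: "0 < p" "p \<le> 1" "type_of P p = m"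
  shows "two_types T" "arrived S p T" "mrk T (length (sizes S)) = None"
proof -
  interpret regular P S using tt unfolding two_types_def by simp
  have med: "medium p" using medium_type_of[of p] p m m_type by simp
  define n where "n = length (sizes S)"
  have nl: "\<forall>k\<in>items S. \<not> large (sizes S ! k)" using two_types_not_large[OF tt] by blast
  obtain c B where c: "c = (if case_A P S m then Red else Blue)"
    and e: "to_open P c S p B T \<or> to_compat P c S p B T \<or> to_new P c S p B T"
    using handle_effect[OF st] nl p by auto
  have c': "c = (if case_A P S (type_of P p) then Red else Blue)" using c p by simp
  have pN: "type_of P p < N" using p m by simp
  have reg: "regular P S" using tt unfolding two_types_def by simp
  have rT: "regular P T"
    using e to_open_regular[OF reg _ p(1,2) pN c'] to_compat_regular[OF reg _ p(1,2) pN c' nl]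
      to_new_regular[OF reg _ p(1,2) pN c'] by blast
  have app: "appended P c S p B T" using e unfolding to_open_def to_compat_def to_new_def Let_def by auto
  have eqs: "sizes T = sizes S @ [p]" "bin_of T = (bin_of S)(n := B)" "lab T = (lab S)(n := m)"
    "mrk T = (mrk S)(n := None)" "cnt T = (cnt S)(m := Suc (cnt S m))"
    "cnt_red T = (if case_A P S m then (cnt_red S)(m := Suc (cnt_red S m)) else cnt_red S)"
    using app p unfolding appended_def Let_def n_def c by (auto split: if_splits)
  have nS: "k \<noteq> n" if "k \<in> items S" for k using that unfolding items_def n_def by auto
  show "two_types T"
    using tt rT eqs(3) appended_items(1)[OF app] unfolding two_types_def n_def by auto
  show "mrk T (length (sizes S)) = None" using eqs unfolding n_def by simp
  have Bn: "bin_of T n = B" using eqs by simp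
  have redcap: "capacity_for P Red m = 1" unfolding capacity_for_def using redfit_m by simp
  have noR: "\<not> open_bin P S Red m B'" for B'
  proof
    assume o: "open_bin P S Red m B'"
    then obtain k where k: "k \<in> content S B'" "col S k = Red" unfolding open_bin_def by auto
    have "(\<Sum>k \<in> {k \<in> content S B'. col S k = Red}. mult S k) < 1" using o redcap unfolding open_bin_def by simp
    moreover have "mult S k \<le> (\<Sum>k \<in> {k \<in> content S B'. col S k = Red}. mult S k)"
      using k by (intro member_le_sum) auto
    ultimately show False using item[of k] k by auto
  qed
  have noRc: "\<not> red_compatible P S p B'" for B'
    using med nl unfolding red_compatible_def small_def medium_def by auto
  have bc: "blue_compatible P S p B' \<longleftrightarrow>
     (B' < nbins S \<and> kind S B' = Unmixed \<and> (\<exists>k\<in>content S B'. col S k = Red \<and> needs P (lab S k) \<le> leaves P m))" for B'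
    using med p unfolding blue_compatible_def large_def medium_def by auto
  have main: "arrived_new S T \<or> arrived_open S T \<or> arrived_host S T"
    and colS: "\<forall>k\<in>items S. col T k = col S k"
  proof -
    consider "to_open P c S p B T" | "to_compat P c S p B T" | "to_new P c S p B T" using e by blast
    then have "(arrived_new S T \<or> arrived_open S T \<or> arrived_host S T) \<and> (\<forall>k\<in>items S. col T k = col S k)"
    proof cases
      case 1
      then have cB: "c = Blue" using noR c p unfolding to_open_def by (auto split: if_splits)
      then have "\<not> case_A P S m" using c by (auto split: if_splits)
      then show ?thesis using 1 cB nS Bn p unfolding to_open_def arrived_open_def n_def by auto
    next
      case 2
      then have cB: "c = Blue" using noRc c p unfolding to_compat_def compatible_def by (auto split: if_splits)
      then have nA: "\<not> case_A P S m" using c by (auto split: if_splits)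
      have b: "blue_compatible P S p B" using 2 cB unfolding to_compat_def compatible_def by simp
      then obtain k0 where k0: "k0 \<in> content S B" "col S k0 = Red" "needs P (lab S k0) \<le> leaves P m"
        and Bu: "kind S B = Unmixed" unfolding bc by auto
      have lf: "lab S k0 = f" using k0 m_not_hosted[of m] tt unfolding two_types_def by auto
      have nu: "col S k \<noteq> Uncolored" if "k \<in> content S B" for k
      proof
        assume u: "col S k = Uncolored"
        then have "content S B = {k}" using unc[of k] that by auto
        then have "k0 = k" using k0(1) by (metis singletonD)
        then show False using u k0 by simp
      qed
      have colT: "col T = (\<lambda>k. if k = n then c else if k \<in> content S B \<and> col S k = Uncolored then opposite c else col S k)"
        "kind T = (kind S)(B := Mixed)" "\<nexists>B. open_bin P S Blue m B"
        using 2 cB p unfolding to_compat_def n_def by auto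
      have "\<forall>k\<in>items S. col T k = col S k" using nS nu unfolding colT(1) by auto
      moreover have "arrived_host S T"
        unfolding arrived_host_def Let_def using nA colT cB k0 lf Bu Bn n_def by auto
      ultimately show ?thesis by blast
    next
      case 3
      have "col T = (col S)(n := Uncolored)" "kind T = (kind S)(nbins S := Unmixed)" "B = nbins S"
        using 3 med p red_m unfolding to_new_def Let_def n_def by auto
      moreover have "\<not> (\<exists>k\<in>items S. kind S (bin_of S k) = Unmixed \<and> col S k = Red \<and> needs P (lab S k) \<le> leaves P m)"
        "\<not> (\<exists>B. open_bin P S Blue m B)"
        if "\<not> case_A P S m"
      proof -
        have "\<not> blue_compatible P S p B'" for B'
          using 3 that c unfolding to_new_def Let_def compatible_def by auto
        then show "\<not> (\<exists>k\<in>items S. kind S (bin_of S k) = Unmixed \<and> col S k = Red \<and> needs P (lab S k) \<le> leaves P m)"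
          using item unfolding bc by (metis content_iff)
        show "\<not> (\<exists>B. open_bin P S Blue m B)"
          using 3 that c p unfolding to_new_def Let_def by auto
      qed
      ultimately show ?thesis using Bn nS unfolding arrived_new_def n_def by auto
    qed
    then show "arrived_new S T \<or> arrived_open S T \<or> arrived_host S T" "\<forall>k\<in>items S. col T k = col S k" by auto
  qed
  show "arrived S p T"
    unfolding arrived_def n_def[symmetric] using main colS eqs nS Bn by auto
qed

lemma open_bin_card:
  assumes tt: "two_types S"
  shows "open_bin P S Blue m B \<longleftrightarrow> (\<exists>k\<in>content S B. col S k = Blue \<and> lab S k = m) \<and> card (colored S B Blue) = 1"
proof -
  interpret regular P S using tt unfolding two_types_def by simp
  have s: "(\<Sum>k \<in> {k \<in> content S B. col S k = Blue}. mult S k) = card (colored S B Blue)"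
    unfolding colored_def using item by simp
  show ?thesis
  proof (cases "\<exists>k\<in>content S B. col S k = Blue \<and> lab S k = m")
    case True
    then obtain k where k: "k \<in> content S B" "col S k = Blue" "lab S k = m" by blast
    then have "k \<in> colored S B Blue" by simp
    then have "card (colored S B Blue) \<noteq> 0" by (metis card_0_eq empty_iff finite_colored)
    then have "card (colored S B Blue) < 2 \<longleftrightarrow> card (colored S B Blue) = 1" by linarith
    moreover have "B < nbins S" "\<forall>k\<in>content S B. col S k \<noteq> Bonus" using item k(1) by auto
    ultimately show ?thesis
      unfolding open_bin_def s capacity_for_def using True bluefit_m by simp
  qed (auto simp: open_bin_def)
qed

lemma set_mark_two_types: "two_types S \<Longrightarrow> two_types (set_mark X M S)"
  by (rule two_types_recolored) (auto simp: recolored_def)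

text \<open>An arrival can only miss the mark of a new item that joins a marked blue item; step 1 supplies it.\<close>

lemma arrival_step1:
  assumes ok: "marks_ok S" and ar: "arrived S p T" and tT: "two_types T" and mn: "mrk T (length (sizes S)) = None"
    and st: "mark_step1 m T T1"
  shows "marks_ok T1" "arrived S p T1" "recolored T T1"
    "mrk T1 (length (sizes S)) = Some M \<Longrightarrow> \<exists>k\<in>items S. mrk S k = Some M"
proof -
  note okD = marks_okD[OF ok]
  note tS = okD(1)
  interpret S: regular P S using tS unfolding two_types_def by simp
  interpret T: regular P T using tT unfolding two_types_def by simp
  define n where "n = length (sizes S)"
  define B where "B = bin_of T n"
  note ari = arrived_items[OF ar, folded n_def B_def]
  have old: "col T k = col S k" "mrk T k = mrk S k" "bin_of T k = bin_of S k" "lab T k = lab S k" if "k \<in> items S" for k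
  proof -
    have "k \<noteq> n" using that ari(2) by auto
    then show "col T k = col S k" "mrk T k = mrk S k" "lab T k = lab S k"
      using ar that unfolding arrived_def n_def by auto
    have "bin_of T = (bin_of S)(n := bin_of T n)" using ar unfolding arrived_def n_def by blast
    then show "bin_of T k = bin_of S k" using \<open>k \<noteq> n\<close> by (metis fun_upd_other)
  qed
  have labn: "lab T n = m" "n \<in> labeled T m" using ari by auto
  have oldl: "k \<in> labeled S m" if "k \<in> labeled T m" "k \<noteq> n" for k using that ari by auto
  have st1: "T1 = T \<or> (\<exists>k M. inherits_mark T m k M \<and> T1 = set_mark {k} M T)"
    using st unfolding mark_step1_def by (auto split: if_splits)
  have arT1: "arrived S p T1" if "T1 = T \<or> (\<exists>M. T1 = set_mark {n} M T)"
    using that ar ari(2) unfolding arrived_def arrived_new_def arrived_open_def arrived_host_def Let_def n_def[symmetric]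
    by auto
  have rcT: "recolored T T1" using mark_step1_recolored[OF st] .
  consider "arrived_new S T" | "arrived_open S T" | "arrived_host S T" using ar unfolding arrived_def by blast
  then have "marks_ok T1 \<and> arrived S p T1 \<and>
    (\<forall>M. mrk T1 n = Some M \<longrightarrow> (\<exists>k\<in>items S. mrk S k = Some M))"
  proof cases
    case 1
    have e: "B = nbins S" "col T n = Uncolored" "kind T = (kind S)(nbins S := Unmixed)"
      using 1 unfolding arrived_new_def n_def B_def by auto
    have Bk: "bin_of S k \<noteq> nbins S" if "k \<in> items S" for k using S.item[OF that] by simp
    have kk: "kind T (bin_of T k) = kind S (bin_of S k)" if "k \<in> items S" for k
      using Bk[OF that] old[OF that] e by simp
    have ub: "unmarked_blue T m B' = unmarked_blue S m B'" for B'
      using old ari(1,2) e(2) unfolding set_eq_iff unmarked_blue_iff labeled_iff by auto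
    have cl: "colored T B' Blue = colored S B' Blue" for B'
      using old ari(1,2) e(2) unfolding set_eq_iff colored_iff by auto
    have okT: "marks_ok T"
      unfolding marks_ok_def
    proof (intro conjI ballI allI impI)
      show "two_types T" by fact
    next
      fix k assume k: "k \<in> labeled T m" "mrk T k = None"
      show "col T k = Uncolored \<or> col T k = Blue \<and> kind T (bin_of T k) = Mixed"
        using e(2) okD(2)[of k] oldl[OF k(1)] old[of k] kk[of k] k by (cases "k = n") auto
    next
      fix k assume k: "k \<in> labeled T m" "col T k = Uncolored"
      show "mrk T k = None"
        using mn okD(3)[of k] oldl[OF k(1)] old[of k] k unfolding n_def[symmetric] by (cases "k = n") auto
    next
      fix k assume k: "k \<in> labeled T m"
      show "mrk T k \<noteq> Some MarkR"
        using mn okD(4)[of k] oldl[OF k(1)] old[of k] unfolding n_def[symmetric] by (cases "k = n") auto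
    next
      fix k assume k: "k \<in> labeled T m" "col T k = Blue \<and> kind T (bin_of T k) = Mixed \<and> mrk T k \<noteq> None"
      then have "k \<noteq> n" using e by auto
      then have kS: "k \<in> labeled S m" "k \<in> items S" using oldl k by auto
      show "unmarked_blue T m (bin_of T k) = {}" "card (colored T (bin_of T k) Blue) = 2"
        using okD(5)[OF kS(1)] k(2) old[OF kS(2)] kk[OF kS(2)] unfolding ub cl by auto
    next
      fix B1 B2 assume "card (unmarked_blue T m B1) = 1 \<and> card (unmarked_blue T m B2) = 1"
      then show "B1 = B2" unfolding ub using okD(6) by blast
    qed
    have "T1 = T" using step1_id[OF okT st] .
    then show ?thesis using okT arT1 mn unfolding n_def by auto
  next
    case 2
    have e: "open_bin P S Blue m B" "col T n = Blue" "kind T = kind S"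
      using 2 unfolding arrived_open_def n_def B_def by auto
    obtain k0 where k0: "k0 \<in> content S B" "col S k0 = Blue" "lab S k0 = m" and c1: "card (colored S B Blue) = 1"
      using e(1) unfolding open_bin_card[OF tS] by blast
    have k0l: "k0 \<in> labeled S m" "bin_of S k0 = B" "k0 \<in> items S" "k0 \<noteq> n" using k0 ari(2) by auto
    have k0c: "colored S B Blue = {k0}"
    proof -
      have "k0 \<in> colored S B Blue" using k0 by simp
      then show ?thesis using c1 by (metis card_1_singletonE singletonD)
    qed
    have cB: "colored T B Blue = {n, k0}"
    proof -
      have "colored T B Blue = insert n (colored S B Blue)"
        using old ari(1,2) e(2) B_def unfolding set_eq_iff colored_iff insert_iff by auto
      then show ?thesis using k0c by simp
    qed
    then have cB2: "card (colored T B Blue) = 2" using k0l by simp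
    have cl: "colored T B' Blue = colored S B' Blue" if "B' \<noteq> B" for B'
      using old ari(1,2) B_def that unfolding set_eq_iff colored_iff by auto
    show ?thesis
    \<comment> \<open>In a mixed bin the mate \<open>k0\<close> is unmarked, as the bin was not
      full, and both items now form a pair for step 3. Otherwise the mate is marked, and step 1
      copies its mark.\<close>
    proof (cases "kind S B = Mixed")
      case True
      have m0: "mrk S k0 = None"
        using okD(5)[OF k0l(1) k0(2)] True k0l c1 by (cases "mrk S k0") auto
      have ubB: "unmarked_blue T m B = {n, k0}"
      proof -
        have "unmarked_blue T m B \<subseteq> colored T B Blue" by auto
        moreover have "n \<in> unmarked_blue T m B" using labn e mn B_def n_def by simp
        moreover have "k0 \<in> unmarked_blue T m B" using k0l k0 old[of k0] m0 ari by auto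
        ultimately show ?thesis unfolding cB by blast
      qed
      have ubB2: "card (unmarked_blue T m B) = 2" unfolding ubB using k0l by simp
      have ub: "unmarked_blue T m B' = unmarked_blue S m B'" if "B' \<noteq> B" for B'
        using old ari(1,2) B_def that unfolding set_eq_iff unmarked_blue_iff labeled_iff by auto
      have okT: "marks_ok T"
        unfolding marks_ok_def
      proof (intro conjI ballI allI impI)
        show "two_types T" by fact
      next
        fix k assume k: "k \<in> labeled T m" "mrk T k = None"
        show "col T k = Uncolored \<or> col T k = Blue \<and> kind T (bin_of T k) = Mixed"
          using e(2,3) True B_def okD(2)[of k] oldl[OF k(1)] old[of k] k by (cases "k = n") auto
      next
        fix k assume k: "k \<in> labeled T m" "col T k = Uncolored"
        show "mrk T k = None"
          using mn okD(3)[of k] oldl[OF k(1)] old[of k] k unfolding n_def[symmetric] by (cases "k = n") auto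
      next
        fix k assume k: "k \<in> labeled T m"
        show "mrk T k \<noteq> Some MarkR"
          using mn okD(4)[of k] oldl[OF k(1)] old[of k] unfolding n_def[symmetric] by (cases "k = n") auto
      next
        fix k assume k: "k \<in> labeled T m" "col T k = Blue \<and> kind T (bin_of T k) = Mixed \<and> mrk T k \<noteq> None"
        have kn: "k \<noteq> n" using k mn n_def by auto
        then have kS: "k \<in> labeled S m" "k \<in> items S" using oldl k by auto
        have "bin_of S k \<noteq> B"
        proof
          assume "bin_of S k = B"
          then have "k \<in> colored S B Blue" using kS k old by auto
          then have "k = k0" using k0c by auto
          then show False using k m0 old[of k0] k0l by simp
        qed
        then show "unmarked_blue T m (bin_of T k) = {}" "card (colored T (bin_of T k) Blue) = 2"
          using okD(5)[OF kS(1)] k(2) old[OF kS(2)] e(3) ub[of "bin_of S k"] cl[of "bin_of S k"] by auto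
      next
        fix B1 B2 assume h: "card (unmarked_blue T m B1) = 1 \<and> card (unmarked_blue T m B2) = 1"
        have "B1 \<noteq> B" using h ubB2 by (cases "B1 = B") auto
        moreover have "B2 \<noteq> B" using h ubB2 by (cases "B2 = B") auto
        ultimately show "B1 = B2" using h ub okD(6) by metis
      qed
      have "T1 = T" using step1_id[OF okT st] .
      then show ?thesis using okT arT1 mn unfolding n_def by auto
    next
      case False
      have m0: "mrk S k0 \<noteq> None" using okD(2)[OF k0l(1)] k0(2) False k0l by auto
      then obtain M where M: "mrk S k0 = Some M" by auto
      have nu: "n \<in> unmarked_blue T m (bin_of T n)" using labn e mn n_def by simp
      have "inherits_mark T m n M"
        unfolding inherits_mark_def using nu k0l k0 old[of k0] M ari B_def by auto
      then obtain k M' where ih: "inherits_mark T m k M'" and T1: "T1 = set_mark {k} M' T"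
        using st unfolding mark_step1_def by (auto split: if_splits)
      have kn: "k = n"
      proof (rule ccontr)
        assume ne: "k \<noteq> n"
        have ku: "k \<in> labeled T m" "col T k = Blue" "mrk T k = None" using ih unfolding inherits_mark_def by auto
        obtain k' where k': "k' \<in> content T (bin_of T k)" "col T k' = Blue" "mrk T k' = Some M'"
          using ih unfolding inherits_mark_def by auto
        have k'n: "k' \<noteq> n" using k' mn n_def by auto
        have "k' \<in> items T" using k'(1) by simp
        then have kS: "k \<in> labeled S m" "k \<in> items S" "k' \<in> items S"
          using oldl[OF ku(1) ne] k'n ari(1) by simp_all
        have b: "bin_of S k' = bin_of S k" using k' old[OF kS(2)] old[OF kS(3)] by simp
        have "inherits_mark S m k M'"
          unfolding inherits_mark_def using ku k' kS old[OF kS(2)] old[OF kS(3)] b by auto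
        then show False using no_inherits[OF ok] by blast
      qed
      obtain k' where k': "k' \<in> content T B" "col T k' = Blue" "mrk T k' = Some M'"
        using ih unfolding inherits_mark_def kn B_def by auto
      have "k' \<noteq> n" using k' mn n_def by auto
      then have "k' = k0" using cB k' by (metis colored_iff content_iff empty_iff insert_iff)
      then have "M' \<noteq> MarkR" using k' okD(4)[OF k0l(1)] old[of k0] k0l by auto
      have T1n: "T1 = set_mark {n} M' T" using T1 kn by simp
      have sel: "col T1 = col T" "bin_of T1 = bin_of T" "kind T1 = kind S" "lab T1 = lab T"
        "mrk T1 = (\<lambda>k. if k = n then Some M' else mrk T k)" "items T1 = items T" "content T1 = content T"
        "labeled T1 = labeled T" "colored T1 = colored T"
        using e unfolding T1n by (auto simp: items_def content_def labeled_def colored_def fun_eq_iff)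
      have ub: "unmarked_blue T1 m B' = unmarked_blue S m B'" for B'
        using old ari(1,2) unfolding set_eq_iff unmarked_blue_iff labeled_iff sel by auto
      have okT: "marks_ok T1"
        unfolding marks_ok_def
      proof (intro conjI ballI allI impI)
        show "two_types T1" unfolding T1n using set_mark_two_types tT by blast
      next
        fix k assume k: "k \<in> labeled T1 m" "mrk T1 k = None"
        then have "k \<noteq> n" unfolding sel by auto
        then show "col T1 k = Uncolored \<or> col T1 k = Blue \<and> kind T1 (bin_of T1 k) = Mixed"
          using okD(2)[of k] oldl[of k] old[of k] k unfolding sel by auto
      next
        fix k assume k: "k \<in> labeled T1 m" "col T1 k = Uncolored"
        then have "k \<noteq> n" using e unfolding sel by auto
        then show "mrk T1 k = None" using okD(3)[of k] oldl[of k] old[of k] k unfolding sel by auto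
      next
        fix k assume k: "k \<in> labeled T1 m"
        show "mrk T1 k \<noteq> Some MarkR"
        proof (cases "k = n")
          case True
          then show ?thesis using \<open>M' \<noteq> MarkR\<close> unfolding sel by simp
        next
          case False
          then have "k \<in> labeled S m" using oldl k unfolding sel by simp
          then show ?thesis using okD(4) old(2)[of k] False unfolding sel by simp
        qed
      next
        fix k assume k: "k \<in> labeled T1 m" "col T1 k = Blue \<and> kind T1 (bin_of T1 k) = Mixed \<and> mrk T1 k \<noteq> None"
        have "k \<noteq> n" using k False B_def unfolding sel by auto
        then have kS: "k \<in> labeled S m" "k \<in> items S" using oldl k unfolding sel by auto
        have "bin_of S k \<noteq> B" using k False old[OF kS(2)] unfolding sel by auto
        then show "unmarked_blue T1 m (bin_of T1 k) = {}" "card (colored T1 (bin_of T1 k) Blue) = 2"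
          using okD(5)[OF kS(1)] k(2) old[OF kS(2)] ub[of "bin_of S k"] cl[of "bin_of S k"] \<open>k \<noteq> n\<close>
          unfolding sel by auto
      next
        fix B1 B2 assume "card (unmarked_blue T1 m B1) = 1 \<and> card (unmarked_blue T1 m B2) = 1"
        then show "B1 = B2" unfolding ub using okD(6) by blast
      qed
      have "arrived S p T1" using arT1 T1n by blast
      moreover have "\<exists>k\<in>items S. mrk S k = Some M" if "mrk T1 n = Some M" for M
      proof -
        have "M = M'" using that unfolding sel by simp
        then have "mrk S k0 = Some M" using k'(3) old(2)[OF k0l(3)] \<open>k' = k0\<close> by simp
        then show ?thesis using k0l(3) by blast
      qed
      ultimately show ?thesis using okT by blast
    qed
  next
    case 3
    have e: "\<nexists>B. open_bin P S Blue m B" "kind S B = Unmixed" "col T n = Blue" "kind T = (kind S)(B := Mixed)"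
      "\<exists>k\<in>content S B. col S k = Red \<and> lab S k = f"
      using 3 unfolding arrived_host_def Let_def n_def[symmetric] B_def[symmetric] by auto
    obtain r where r: "r \<in> items S" "bin_of S r = B" "col S r = Red" using e(5) by auto
    have nb: "colored S B Blue = {}"
    proof -
      have "col S k \<noteq> Blue" if "k \<in> content S B" for k
        using S.mix[of k r] that r e(2) by auto
      then show ?thesis by auto
    qed
    have ubB: "unmarked_blue T m B = {n}"
      using nb old ari(1,2) e(3) mn B_def unfolding set_eq_iff unmarked_blue_iff labeled_iff colored_iff n_def[symmetric]
      by (auto simp: labn)
    have ub: "unmarked_blue T m B' = unmarked_blue S m B'" if "B' \<noteq> B" for B'
      using old ari(1,2) B_def that unfolding set_eq_iff unmarked_blue_iff labeled_iff by auto
    have cl: "colored T B' Blue = colored S B' Blue" if "B' \<noteq> B" for B'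
      using old ari(1,2) B_def that unfolding set_eq_iff colored_iff by auto
    \<comment> \<open>A bin with a single unmarked blue item is blue-open, but a host is used only
      if no such bin exists. So the new mixed bin is the only one of this kind.\<close>
    have no1: "card (unmarked_blue S m B') \<noteq> 1" for B'
    proof
      assume c: "card (unmarked_blue S m B') = 1"
      then obtain k where k: "k \<in> unmarked_blue S m B'" by (metis card_1_singletonE insertI1)
      then have kl: "k \<in> labeled S m" "bin_of S k = B'" "col S k = Blue" "mrk S k = None" by auto
      have km: "kind S B' = Mixed" using okD(2)[OF kl(1,4)] kl by auto
      have "colored S B' Blue \<subseteq> unmarked_blue S m B'"
      proof
        fix k' assume k': "k' \<in> colored S B' Blue"
        then have kl': "k' \<in> labeled S m" using blue_mate_medium[OF tS kl(1,3), of k'] kl by auto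
        have "mrk S k' = None"
        proof (rule ccontr)
          assume "mrk S k' \<noteq> None"
          then have "unmarked_blue S m B' = {}" using okD(5)[OF kl'] k' km by auto
          then show False using k by blast
        qed
        then show "k' \<in> unmarked_blue S m B'" using kl' k' by auto
      qed
      moreover have "unmarked_blue S m B' \<subseteq> colored S B' Blue" by auto
      ultimately have "card (colored S B' Blue) = 1" using c by (metis subset_antisym)
      then have "open_bin P S Blue m B'" unfolding open_bin_card[OF tS] using kl by auto
      then show False using e(1) by blast
    qed
    have okT: "marks_ok T"
      unfolding marks_ok_def
    proof (intro conjI ballI allI impI)
      show "two_types T" by fact
    next
      fix k assume k: "k \<in> labeled T m" "mrk T k = None"
      show "col T k = Uncolored \<or> col T k = Blue \<and> kind T (bin_of T k) = Mixed"
        using e(3,4) B_def okD(2)[of k] oldl[OF k(1)] old[of k] k by (cases "k = n") auto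
    next
      fix k assume k: "k \<in> labeled T m" "col T k = Uncolored"
      show "mrk T k = None"
        using mn okD(3)[of k] oldl[OF k(1)] old[of k] k unfolding n_def[symmetric] by (cases "k = n") auto
    next
      fix k assume k: "k \<in> labeled T m"
      show "mrk T k \<noteq> Some MarkR"
        using mn okD(4)[of k] oldl[OF k(1)] old[of k] unfolding n_def[symmetric] by (cases "k = n") auto
    next
      fix k assume k: "k \<in> labeled T m" "col T k = Blue \<and> kind T (bin_of T k) = Mixed \<and> mrk T k \<noteq> None"
      have "k \<noteq> n" using k mn n_def by auto
      then have kS: "k \<in> labeled S m" "k \<in> items S" using oldl k by auto
      have bk: "bin_of S k \<noteq> B"
      proof
        assume "bin_of S k = B"
        then have "k \<in> colored S B Blue" using kS k old by auto
        then show False using nb by blast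
      qed
      then show "unmarked_blue T m (bin_of T k) = {}" "card (colored T (bin_of T k) Blue) = 2"
        using okD(5)[OF kS(1)] k(2) old[OF kS(2)] e(4) ub[of "bin_of S k"] cl[of "bin_of S k"] by auto
    next
      fix B1 B2 assume "card (unmarked_blue T m B1) = 1 \<and> card (unmarked_blue T m B2) = 1"
      then show "B1 = B2" using ub no1 by metis
    qed
    have "T1 = T" using step1_id[OF okT st] .
    then show ?thesis using okT arT1 mn unfolding n_def by auto
  qed
  then show "marks_ok T1" "arrived S p T1"
    "mrk T1 (length (sizes S)) = Some M \<Longrightarrow> \<exists>k\<in>items S. mrk S k = Some M"
    unfolding n_def by auto
  show "recolored T T1" by fact
qed

theorem medium_step:
  assumes ok: "marks_ok S" and st: "eh_step P S p S'" and p: "0 < p" "p \<le> 1" "type_of P p = m"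
  obtains T T3 where "marks_ok T" "arrived S p T" "mark_step3 P m T T3" "mark_step4 P m T3 S'"
    "marks_ok T3" "marks_ok S'" "recolored T T3" "recolored T3 S'"
    "\<And>M. mrk T (length (sizes S)) = Some M \<Longrightarrow> \<exists>k\<in>items S. mrk S k = Some M"
proof -
  have tS: "two_types S" using marks_okD(1)[OF ok] .
  obtain T0 where T0: "handle_item P S p T0" "mark_and_color_all P T0 S'"
    using st p m unfolding eh_step_def by auto
  note h = handle_medium[OF tS T0(1) p]
  obtain T T2 T3 where s: "mark_step1 m T0 T" "mark_step2 P m T T2" "mark_step3 P m T2 T3" "mark_step4 P m T3 S'"
    using mark_and_color_all_m[OF h(1) T0(2)] unfolding mark_and_color_def by auto
  note a = arrival_step1[OF ok h(2,1,3) s(1)]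
  have "T2 = T" using step2_id[OF marks_okD(1)[OF a(1)] s(2)] .
  with s have s3: "mark_step3 P m T T3" by simp
  have ok3: "marks_ok T3"
    using step3_cases[OF a(1) s3] marks_ok_step3(1)[OF a(1)] a(1) by blast
  have ok4: "marks_ok S'"
    using step4_cases[OF s(4)] marks_ok_step4(1)[OF ok3] ok3 by blast
  show thesis
    using that[OF a(1,2) s3 s(4) ok3 ok4 mark_step3_recolored[OF s3] mark_step4_recolored[OF s(4)] a(4)] by blast
qed

end

context medium_phase
begin

lemma labeled_split:
  assumes tt: "two_types S"
  shows "card (labeled S m) = card (uncolored_items S m) + card (reds S m) + card (blues S m)"
proof -
  have "col S k = Blue \<or> col S k = Red \<or> col S k = Uncolored" if "k \<in> labeled S m" for k
    using color_cases[of "col S k"] two_types_no_bonus[OF tt] that by auto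
  then have "labeled S m = (uncolored_items S m \<union> reds S m) \<union> blues S m"
    unfolding reds_def blues_def set_eq_iff by auto
  moreover have "card ((uncolored_items S m \<union> reds S m) \<union> blues S m) =
      card (uncolored_items S m \<union> reds S m) + card (blues S m)"
    by (rule card_Un_disjoint) (auto simp: reds_def blues_def)
  moreover have "card (uncolored_items S m \<union> reds S m) = card (uncolored_items S m) + card (reds S m)"
    by (rule card_Un_disjoint) (auto simp: reds_def)
  ultimately show ?thesis by simp
qed

lemma blues_le: 
  assumes tt: "two_types S"
  shows "card (blues S m) \<le> 2 * card (bin_of S ` blues S m)"
proof (rule card_le_fibre_image)
  fix k assume k: "k \<in> blues S m"
  have "{k' \<in> blues S m. bin_of S k' = bin_of S k} \<subseteq> colored S (bin_of S k) Blue"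
    unfolding blues_def by auto
  then have "card {k' \<in> blues S m. bin_of S k' = bin_of S k} \<le> card (colored S (bin_of S k) Blue)"
    by (intro card_mono) auto
  also have "\<dots> \<le> 2" using blue_le_2[OF tt, of k] k unfolding blues_def by auto
  finally show "card {k' \<in> blues S m. bin_of S k' = bin_of S k} \<le> 2" .
qed simp

subsection \<open>The red items are not too few\<close>

text \<open>An item that is neither marked nor uncolored is blue in a mixed bin. Two such items in
  one bin make it a member of \<open>pairs\<close>; a single one occurs in at most one bin, which
  accounts for the final 1.\<close>

lemma unmarked_count:
  assumes ok: "marks_ok S"
  shows "card (labeled S m) \<le> cnt_mark S m MarkN + cnt_mark S m MarkB + card (uncolored_items S m) + 2 * card (pairs S) + 1"
proof -
  note okD = marks_okD[OF ok]
  have reg: "regular P S" using okD(1) unfolding two_types_def by simp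
  define MN where "MN = {k \<in> items S. lab S k = m \<and> mrk S k = Some MarkN}"
  define MB where "MB = {k \<in> items S. lab S k = m \<and> mrk S k = Some MarkB}"
  define Q1 where "Q1 = {B. B < nbins S \<and> card (unmarked_blue S m B) = 1}"
  have fin: "finite (pairs S)" "finite Q1" unfolding pairs_def Q1_def by auto
  have Q1: "card Q1 \<le> 1"
  proof -
    have "B = B'" if "B \<in> Q1" "B' \<in> Q1" for B B'
      using okD(6)[of B B'] that unfolding Q1_def by auto
    then show ?thesis using card_le_Suc0_iff_eq[OF fin(2)] by auto
  qed
  define Z where "Z = (\<Union>B\<in>pairs S. unmarked_blue S m B) \<union> (\<Union>B\<in>Q1. unmarked_blue S m B)"
  have "labeled S m \<subseteq> ((MN \<union> MB) \<union> uncolored_items S m) \<union> Z"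
  proof
    fix k assume k: "k \<in> labeled S m"
    show "k \<in> ((MN \<union> MB) \<union> uncolored_items S m) \<union> Z"
    proof (cases "mrk S k")
      case (Some M)
      then show ?thesis using okD(4)[OF k] k unfolding MN_def MB_def by (cases M) auto
    next
      case None
      show ?thesis
      proof (cases "col S k = Uncolored")
        case False
        then have b: "col S k = Blue" "kind S (bin_of S k) = Mixed" using okD(2)[OF k None] by auto
        have ku: "k \<in> unmarked_blue S m (bin_of S k)" using b k None by simp
        have "unmarked_blue S m (bin_of S k) \<subseteq> colored S (bin_of S k) Blue" by auto
        then have "card (unmarked_blue S m (bin_of S k)) \<le> 2"
          using blue_le_2[OF okD(1) k b(1)] card_mono[OF finite_colored] by (metis le_trans)
        moreover have "card (unmarked_blue S m (bin_of S k)) \<noteq> 0" using ku by (metis card_0_eq empty_iff finite_unmarked_blue)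
        moreover have "bin_of S k < nbins S" using regular.item[OF reg] k by auto
        moreover from calculation(1,2) have "card (unmarked_blue S m (bin_of S k)) = 1 \<or> card (unmarked_blue S m (bin_of S k)) = 2"
          by linarith
        ultimately have "bin_of S k \<in> pairs S \<or> bin_of S k \<in> Q1" using b unfolding pairs_def Q1_def mem_Collect_eq by blast
        then show ?thesis using ku unfolding Z_def by blast
      qed (use k in auto)
    qed
  qed
  then have "card (labeled S m) \<le> card (((MN \<union> MB) \<union> uncolored_items S m) \<union> Z)"
    using fin unfolding Z_def MN_def MB_def by (intro card_mono) auto
  also have "\<dots> \<le> card MN + card MB + card (uncolored_items S m) + card Z"
    using card_Un_le[of "(MN \<union> MB) \<union> uncolored_items S m" Z] card_Un_le[of "MN \<union> MB" "uncolored_items S m"]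
      card_Un_le[of MN MB] by linarith
  also have "card Z \<le> (\<Sum>B\<in>pairs S. card (unmarked_blue S m B)) + (\<Sum>B\<in>Q1. card (unmarked_blue S m B))"
    unfolding Z_def
    using card_UN_le[OF fin(1), of "unmarked_blue S m"] card_UN_le[OF fin(2), of "unmarked_blue S m"]
      card_Un_le[of "\<Union>B\<in>pairs S. unmarked_blue S m B" "\<Union>B\<in>Q1. unmarked_blue S m B"] by linarith
  also have "(\<Sum>B\<in>pairs S. card (unmarked_blue S m B)) = 2 * card (pairs S)"
    unfolding pairs_def by simp
  also have "(\<Sum>B\<in>Q1. card (unmarked_blue S m B)) \<le> 1"
    using Q1 unfolding Q1_def by simp
  finally show ?thesis unfolding cnt_mark_def MN_def MB_def by simp
qed

text \<open>The sum of the two idle inequalities. Their item counts cover all of type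
  \<open>m\<close>, because \<open>2 * u - 1 \<ge> u\<close> for \<open>u \<ge> 1\<close> uncolored
  items; each inequality contributes 1 to the slack of 2.\<close>

lemma idle_bound:
  assumes ok: "marks_ok S" and i3: "idle3 S" and i4: "idle4 S" and U: "uncolored_items S m \<noteq> {}"
  shows "\<alpha> * real (card (labeled S m)) < real (card (reds S m)) + 2"
proof -
  have u: "1 \<le> card (uncolored_items S m)" using U by (simp add: Suc_le_eq card_gt_0_iff)
  have "cnt_red_mark S m MarkN + cnt_red_mark S m MarkB \<le> card (reds S m)"
  proof -
    have "cnt_red_mark S m MarkN + cnt_red_mark S m MarkB = card ({k \<in> items S. lab S k = m \<and> mrk S k = Some MarkN \<and> col S k = Red}
      \<union> {k \<in> items S. lab S k = m \<and> mrk S k = Some MarkB \<and> col S k = Red})"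
      unfolding cnt_red_mark_def by (subst card_Un_disjoint) auto
    also have "\<dots> \<le> card (reds S m)" unfolding reds_def by (intro card_mono) auto
    finally show ?thesis .
  qed
  moreover have "real (card (labeled S m)) \<le> real (cnt_mark S m MarkB + 2 * card (pairs S) + 1) +
     (real (cnt_mark S m MarkN) + 2 * real (card (uncolored_items S m)) - 1)"
    using unmarked_count[OF ok] u by linarith
  then have "\<alpha> * real (card (labeled S m)) \<le> \<alpha> * (real (cnt_mark S m MarkB + 2 * card (pairs S) + 1) +
     (real (cnt_mark S m MarkN) + 2 * real (card (uncolored_items S m)) - 1))"
    using alpha by (intro mult_left_mono) auto
  then have "\<alpha> * real (card (labeled S m)) \<le> real (cnt_mark S m MarkB + 2 * card (pairs S) + 1) * \<alpha> +
     (real (cnt_mark S m MarkN) + 2 * real (card (uncolored_items S m)) - 1) * \<alpha>"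
    by (simp only: distrib_left mult.commute[of \<alpha>])
  ultimately show ?thesis using i3 i4 unfolding idle3_def idle4_def by linarith
qed

text \<open>The counter rises in case A, when the arriving item is still uncolored. Either a marking
  step colors some item red in the same round, or both steps are idle in the presence of an
  uncolored item and \<open>idle_bound\<close> gives the claim directly.\<close>

lemma step_reds:
  assumes ok: "marks_ok S" and st: "eh_step P S p S'" and p: "0 < p" "p \<le> 1" "type_of P p = m"
    and IH: "cnt_red S m \<le> card (reds S m) + 2"
  shows "cnt_red S' m \<le> card (reds S' m) + 2"
proof -
  obtain T T3 where s: "marks_ok T" "arrived S p T" "mark_step3 P m T T3" "mark_step4 P m T3 S'"
    "marks_ok T3" "marks_ok S'" "recolored T T3" "recolored T3 S'"
    using medium_step[OF ok st p] by metis
  define n where "n = length (sizes S)"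
  have ar: "\<forall>k\<in>items S. col T k = col S k" "cnt_red T = (if case_A P S m then (cnt_red S)(m := Suc (cnt_red S m)) else cnt_red S)"
    using s(2) unfolding arrived_def by auto
  note ari = arrived_items[OF s(2), folded n_def]
  have "reds S m \<subseteq> reds T m" using ar(1) ari unfolding reds_def by auto
  then have r0: "card (reds S m) \<le> card (reds T m)" by (intro card_mono) auto
  have c: "cnt_red S' = cnt_red T" using s(7,8) unfolding recolored_def by simp
  have r3: "T3 = T \<and> (uncolored_items T m \<noteq> {} \<longrightarrow> idle3 T) \<or> card (reds T3 m) = Suc (card (reds T m))"
    using step3_cases[OF s(1,3)] marks_ok_step3(2,3)[OF s(1)] by fastforce
  have r4: "S' = T3 \<and> (uncolored_items T3 m \<noteq> {} \<longrightarrow> idle4 T3) \<or> card (reds S' m) = Suc (card (reds T3 m))"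
    using step4_cases[OF s(4)] marks_ok_step4(2,3)[OF s(5)] by fastforce
  show ?thesis
  proof (cases "case_A P S m")
    case False
    then show ?thesis using ar(2) c IH r0 r3 r4 by auto
  next
    case True
    then have new: "arrived_new S T" using s(2) unfolding arrived_def arrived_open_def arrived_host_def Let_def by auto
    have U: "n \<in> uncolored_items T m" using new ari unfolding arrived_new_def n_def by auto
    show ?thesis
    proof (cases "S' = T \<and> idle3 T \<and> idle4 T")
      case False
      then have "card (reds T3 m) = Suc (card (reds T m)) \<or> card (reds S' m) = Suc (card (reds T3 m))"
        using r3 r4 U by fastforce
      moreover have "card (reds T m) \<le> card (reds T3 m)" using r3 by auto
      moreover have "card (reds T3 m) \<le> card (reds S' m)" using r4 by auto
      ultimately have "Suc (card (reds S m)) \<le> card (reds S' m)" using r0 by linarith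
      then show ?thesis using True ar(2) c IH by simp
    next
      case id: True
      have ne: "uncolored_items T m \<noteq> {}" using U by blast
      interpret regular P S' using marks_okD(1)[OF s(6)] unfolding two_types_def by simp
      have "\<alpha> * real (card (labeled S' m)) < real (card (reds S' m)) + 2"
        using idle_bound[OF s(1)] id ne by simp
      moreover have "int (cnt_red S' m) = \<lfloor>\<alpha> * real (card (labeled S' m))\<rfloor>"
        using cnt_red[of m] m unfolding cnt by simp
      ultimately have "real (cnt_red S' m) < real (card (reds S' m)) + 2" by linarith
      then show ?thesis by simp
    qed
  qed
qed

subsection \<open>The red items are not too many if there are only medium items\<close>

text \<open>Blue bins count double, as in the term \<open>2 * x\<close> of step 4: a bin with one
  blue item can receive a second one with the same mark. In these states all colored items have mark
  \<open>MarkN\<close>, so the sum in the last clause is the number that step 4 tests when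
  \<open>x\<close> is one less than the number of uncolored items.\<close>

definition balanced :: "eh_state \<Rightarrow> bool" where
  "balanced S \<longleftrightarrow> marks_ok S \<and> (\<forall>k\<in>items S. lab S k = m \<and> mrk S k \<noteq> Some MarkB) \<and>
     real (card (reds S m)) \<le> \<alpha> * (real (card (reds S m)) + 2 * real (card (bin_of S ` blues S m))) \<and>
     (uncolored_items S m = {} \<or>
      \<alpha> * (real (card (labeled S m)) + real (card (uncolored_items S m)) - 1) < real (card (reds S m)) + 1)"

lemma only_medium_not_mixed:
  assumes tt: "two_types S" and l: "\<forall>k\<in>items S. lab S k = m" and B: "B < nbins S"
  shows "kind S B \<noteq> Mixed"
proof
  assume "kind S B = Mixed"
  then obtain k k' where k: "k \<in> colored S B Blue" "k' \<in> colored S B Red"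
    using regular.mixed[of P S B] tt B unfolding two_types_def by blast
  then have "content S (bin_of S k') = {k'}" using red_medium_alone(1)[OF tt, of k'] l by auto
  moreover have "k \<in> content S (bin_of S k')" using k by auto
  ultimately have "k = k'" by (metis singletonD)
  then show False using k by simp
qed

lemma only_medium_marks:
  assumes ok: "marks_ok S" and l: "\<forall>k\<in>items S. lab S k = m \<and> mrk S k \<noteq> Some MarkB"
  shows "card (labeled S m) = cnt_mark S m MarkN + card (uncolored_items S m)"
    "cnt_red_mark S m MarkN = card (reds S m)" "pairs S = {}" "cnt_mark S m MarkB = 0"
proof -
  note okD = marks_okD[OF ok]
  have reg: "regular P S" using okD(1) unfolding two_types_def by simp
  have nm: "kind S B \<noteq> Mixed" if "B < nbins S" for B
    using only_medium_not_mixed[OF okD(1) _ that] l by simp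
  then show "pairs S = {}" unfolding pairs_def by auto
  have N: "mrk S k = Some MarkN \<longleftrightarrow> col S k \<noteq> Uncolored" if k: "k \<in> labeled S m" for k
  proof (cases "mrk S k")
    case None
    then show ?thesis using okD(2)[OF k None] nm regular.item[OF reg, of k] k by auto
  next
    case (Some M)
    then show ?thesis using okD(3,4)[OF k] l k by (cases M) auto
  qed
  have "labeled S m = {k \<in> items S. lab S k = m \<and> mrk S k = Some MarkN} \<union> uncolored_items S m"
    using N unfolding set_eq_iff by auto
  then have "card (labeled S m) = card ({k \<in> items S. lab S k = m \<and> mrk S k = Some MarkN} \<union> uncolored_items S m)"
    by simp
  also have "\<dots> = cnt_mark S m MarkN + card (uncolored_items S m)"
    unfolding cnt_mark_def using N by (intro card_Un_disjoint) auto
  finally show "card (labeled S m) = cnt_mark S m MarkN + card (uncolored_items S m)" .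
  have "{k \<in> items S. lab S k = m \<and> mrk S k = Some MarkN \<and> col S k = Red} = reds S m"
    using N unfolding reds_def set_eq_iff by auto
  then show "cnt_red_mark S m MarkN = card (reds S m)" unfolding cnt_red_mark_def by simp
  show "cnt_mark S m MarkB = 0" unfolding cnt_mark_def using l by auto
qed

text \<open>The item either stays uncolored in a new bin or joins a blue item, which changes neither
  the red items nor the number of blue bins. Step 3 is idle: there are no pairs, and with no item
  marked \<open>MarkB\<close> its test reads \<open>0 < \<lfloor>\<alpha>\<rfloor>\<close>.\<close>

lemma step_balanced:
  assumes b: "balanced S" and st: "eh_step P S p S'" and p: "0 < p" "p \<le> 1" "type_of P p = m"
  shows "balanced S'"
proof -
  have ok: "marks_ok S" and l: "\<forall>k\<in>items S. lab S k = m \<and> mrk S k \<noteq> Some MarkB"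
    using b unfolding balanced_def by auto
  obtain T T3 where s: "marks_ok T" "arrived S p T" "mark_step3 P m T T3" "mark_step4 P m T3 S'"
    "marks_ok T3" "marks_ok S'" "recolored T T3" "recolored T3 S'"
    and sm: "\<And>M. mrk T (length (sizes S)) = Some M \<Longrightarrow> \<exists>k\<in>items S. mrk S k = Some M"
    using medium_step[OF ok st p] by metis
  define n where "n = length (sizes S)"
  note tS = marks_okD(1)[OF ok]
  interpret S: regular P S using tS unfolding two_types_def by simp
  note ari = arrived_items[OF s(2), folded n_def]
  have ar: "\<forall>k\<in>items S. col T k = col S k \<and> mrk T k = mrk S k" "lab T = (lab S)(n := m)"
    "bin_of T = (bin_of S)(n := bin_of T n)"
    using s(2) unfolding arrived_def n_def by auto
  have binS: "bin_of T k = bin_of S k" if "k \<in> items S" for k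
    using ar(3) ari(2) that by (metis fun_upd_other)
  have nhost: "\<not> arrived_host S T" using l m_f unfolding arrived_host_def Let_def by auto
  have oldcol: "col T k = col S k" if "k \<in> items S" for k using ar(1) that by blast
  have split: "{k \<in> insert n (labeled S m). col T k = c} = (if col T n = c then {n} else {}) \<union> {k \<in> labeled S m. col S k = c}" for c
    using oldcol by auto
  have lT1: "\<forall>k\<in>items T. lab T k = m" using ari(1) ar(2) l by auto
  have okT: "two_types T" using marks_okD(1)[OF s(1)] .
  have nred: "col T n \<noteq> Red"
    using s(2) nhost unfolding arrived_def arrived_new_def arrived_open_def n_def by auto
  have redT: "reds T m = reds S m"
    unfolding reds_def ari(4) split using nred by simp
  define U where "U = card (uncolored_items S m)"
  define R where "R = card (reds S m)"
  define BN where "BN = card (bin_of S ` blues S m)"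
  define L where "L = card (labeled S m)"
  have LT: "card (labeled T m) = Suc L" unfolding ari(4) L_def using ari(2) by simp
  have UT: "(card (uncolored_items T m) = Suc U \<or> card (uncolored_items T m) = U) \<and> card (bin_of T ` blues T m) = BN"
  proof (cases "arrived_new S T")
    case True
    then have c: "col T n = Uncolored" unfolding arrived_new_def n_def by simp
    have "uncolored_items T m = insert n (uncolored_items S m)"
      unfolding uncolored_items_alt ari(4) split using c by simp
    moreover have "blues T m = blues S m" unfolding blues_def ari(4) split using c by simp
    moreover have "bin_of T ` blues S m = bin_of S ` blues S m" using binS unfolding blues_def by auto
    ultimately show ?thesis using ari(2) unfolding U_def BN_def by simp
  next
    case False
    then have op: "arrived_open S T" using s(2) nhost unfolding arrived_def by blast
    then have c: "col T n = Blue" "open_bin P S Blue m (bin_of T n)" unfolding arrived_open_def n_def by auto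
    obtain k0 where k0: "k0 \<in> items S" "bin_of S k0 = bin_of T n" "col S k0 = Blue" "lab S k0 = m"
      using c(2) unfolding open_bin_def by auto
    have "uncolored_items T m = uncolored_items S m"
      unfolding uncolored_items_alt ari(4) split using c by simp
    moreover have "blues T m = insert n (blues S m)"
      unfolding blues_def ari(4) split using c by simp
    moreover have "bin_of T ` insert n (blues S m) = bin_of S ` blues S m"
    proof -
      have "bin_of T ` blues S m = bin_of S ` blues S m" using binS unfolding blues_def by auto
      moreover have "bin_of T n \<in> bin_of S ` blues S m" using k0 unfolding blues_def by force
      ultimately show ?thesis by auto
    qed
    ultimately show ?thesis unfolding U_def BN_def by simp
  qed
  have lT: "\<forall>k\<in>items T. lab T k = m \<and> mrk T k \<noteq> Some MarkB"
  proof
    fix k assume k: "k \<in> items T"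
    have "mrk T k \<noteq> Some MarkB"
    proof (cases "k = n")
      case True
      then show ?thesis using sm[of MarkB] l unfolding n_def by blast
    next
      case False
      then show ?thesis using k ari(1) ar(1) l by auto
    qed
    then show "lab T k = m \<and> mrk T k \<noteq> Some MarkB" using lT1 k by simp
  qed
  note omT = only_medium_marks[OF s(1) lT]
  have T3: "T3 = T"
  proof -
    have False if "u \<in> uncolored_items T m" "Bs \<subseteq> pairs T"
      "Bs = {} \<longrightarrow> \<lfloor>real (cnt_mark T m MarkB + 1) * \<alpha>\<rfloor> > int (cnt_red_mark T m MarkB)" for u Bs
    proof -
      have "\<lfloor>real (cnt_mark T m MarkB + 1) * \<alpha>\<rfloor> > int (cnt_red_mark T m MarkB)"
        using that(2,3) omT(3) by blast
      then have "int (cnt_red_mark T m MarkB) < \<lfloor>\<alpha>\<rfloor>" using omT(4) by simp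
      then show False using alpha by linarith
    qed
    then show ?thesis using step3_cases[OF s(1,3)] by blast
  qed
  define UT where "UT = card (uncolored_items T m)"
  have cN: "cnt_mark T m MarkN + UT = Suc L" using omT(1) LT unfolding UT_def by simp
  have R: "card (reds T m) = R" "cnt_red_mark T m MarkN = R" using redT omT(2) unfolding R_def by auto
  have BNT: "card (bin_of T ` blues T m) = BN" using UT by simp
  have a3: "real R \<le> \<alpha> * (real R + 2 * real BN)" and
    a4: "U = 0 \<or> \<alpha> * (real L + real U - 1) < real R + 1"
    using b unfolding balanced_def R_def BN_def U_def L_def by auto
  have NR: "cnt_mark T m MarkN \<le> R + 2 * BN"
    using labeled_split[OF okT] blues_le[OF okT] cN LT R(1) BNT unfolding UT_def by linarith
  from step4_cases[OF s(4)[unfolded T3]] show ?thesis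
  proof (elim disjE conjE exE)
    assume S': "S' = T" and i4: "uncolored_items T m \<noteq> {} \<longrightarrow> idle4 T"
    have "\<alpha> * (real (Suc L) + real UT - 1) < real R + 1" if "uncolored_items T m \<noteq> {}"
    proof -
      have "(real (cnt_mark T m MarkN) + 2 * real UT - 1) * \<alpha> < real R + 1"
        using i4 that unfolding idle4_def R UT_def by simp
      moreover have eq: "real (cnt_mark T m MarkN) + 2 * real UT - 1 = real (Suc L) + real UT - 1"
        using cN by linarith
      ultimately show ?thesis unfolding eq by (simp only: mult.commute)
    qed
    then show ?thesis
      unfolding balanced_def S' R BNT LT UT_def[symmetric] using s(1) lT a3 by blast
  next
    fix u X assume u: "u \<in> uncolored_items T m" and X: "X \<subseteq> uncolored_items T m - {u}"
      and S': "S' = set_color {u} Red (set_color X Blue (set_mark (insert u X) MarkN T))"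
      and le: "real (cnt_red_mark T m MarkN) + 1 \<le> real (cnt_mark T m MarkN + 2 * card X + 1) * \<alpha>"
    have fX: "finite X" using X finite_subset by fastforce
    have cuX: "card (insert u X) = Suc (card X)" using X fX by (subst card_insert_disjoint) auto
    have sub: "insert u X \<subseteq> uncolored_items T m" using u X by auto
    have le': "real R + 1 \<le> \<alpha> * (real (cnt_mark T m MarkN) + 2 * real (card X) + 1)"
    proof -
      have "real (cnt_mark T m MarkN + 2 * card X + 1) = real (cnt_mark T m MarkN) + 2 * real (card X) + 1" by simp
      then show ?thesis using le unfolding R by (simp only: mult.commute)
    qed
    \<comment> \<open>Otherwise at least \<open>card X + 1\<close> uncolored items were available
      before the arrival, and by the last clause of \<open>balanced\<close> that did not suffice. So
      step 4 uses up all uncolored items when it fires.\<close>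
    have "UT \<le> Suc (card X)"
    proof (rule ccontr)
      assume n: "\<not> UT \<le> Suc (card X)"
      then have "real (cnt_mark T m MarkN) + 2 * real (card X) + 1 \<le> real L + real U - 1"
        using cN UT unfolding UT_def[symmetric] by linarith
      then have "real R + 1 \<le> \<alpha> * (real L + real U - 1)"
        using le' alpha by (meson less_imp_le mult_left_mono order_trans)
      moreover have "U \<noteq> 0" using n UT unfolding UT_def[symmetric] by linarith
      ultimately show False using a4 by linarith
    qed
    then have all: "insert u X = uncolored_items T m"
      using card_seteq[OF finite_uncolored_items sub] cuX unfolding UT_def by simp
    have rc: "recolored T S'" using s(8) T3 by simp
    have it: "items S' = items T" "labeled S' = labeled T" using recolored_items[OF rc] by auto
    have sel: "bin_of S' = bin_of T" "lab S' = lab T"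
      "\<And>k. col S' k = (if k = u then Red else if k \<in> X then Blue else col T k)"
      "\<And>k. mrk S' k = (if k = u \<or> k \<in> X then Some MarkN else mrk T k)"
      unfolding S' by auto
    have e: "uncolored_items S' m = {}"
    proof -
      have "k \<notin> uncolored_items S' m" for k
      proof (cases "k \<in> insert u X")
        case True
        then show ?thesis unfolding uncolored_items_iff sel(3) by auto
      next
        case False
        then have "k \<notin> uncolored_items T m" using all by blast
        then show ?thesis using False unfolding uncolored_items_iff sel(3) it by simp
      qed
      then show ?thesis by blast
    qed
    have bl: "blues S' m = blues T m \<union> X"
    proof -
      have "k \<in> labeled T m" "k \<noteq> u" if "k \<in> X" for k using X that by auto
      moreover have "col T u \<noteq> Blue" using u by simp
      ultimately show ?thesis unfolding blues_def it sel(3) set_eq_iff Un_iff mem_Collect_eq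
        by (simp del: labeled_iff)
    qed
    have alone: "k' = k" if "k \<in> X" "k' \<in> labeled T m" "bin_of T k' = bin_of T k" for k k'
    proof -
      have "k \<in> uncolored_items T m" using sub that(1) by blast
      then have "content T (bin_of T k) = {k}"
        using uncolored_unmixed(1)[OF okT, of k] by simp
      moreover have "k' \<in> content T (bin_of T k)" using that by simp
      ultimately show ?thesis by blast
    qed
    have Xl: "X \<subseteq> labeled T m" using sub by auto
    have "card (bin_of S' ` blues S' m) = card (bin_of T ` blues T m \<union> bin_of T ` X)"
      unfolding bl sel(1) image_Un ..
    also have "\<dots> = card (bin_of T ` blues T m) + card (bin_of T ` X)"
    proof (rule card_Un_disjoint)
      show "bin_of T ` blues T m \<inter> bin_of T ` X = {}"
      proof (rule ccontr)
        assume "bin_of T ` blues T m \<inter> bin_of T ` X \<noteq> {}"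
        then obtain k k' where k: "k \<in> X" "k' \<in> blues T m" "bin_of T k' = bin_of T k" by blast
        then have "k' = k" using alone[of k k'] unfolding blues_def by auto
        then show False using k sub unfolding blues_def by auto
      qed
    qed (use fX in auto)
    also have "card (bin_of T ` X) = card X"
    proof (rule card_image)
      show "inj_on (bin_of T) X" using alone Xl unfolding inj_on_def by (metis subsetD)
    qed
    finally have bn: "card (bin_of S' ` blues S' m) = BN + card X" using BNT by simp
    have rd: "card (reds S' m) = Suc R"
      using marks_ok_step4(2,3)[OF s(1) u X S'] R(1) by simp
    have "real (Suc R) \<le> \<alpha> * (real (Suc R) + 2 * real (BN + card X))"
    proof -
      have "real (cnt_mark T m MarkN) + 2 * real (card X) + 1 \<le> real (Suc R) + 2 * real (BN + card X)"
        using NR by simp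
      then have "\<alpha> * (real (cnt_mark T m MarkN) + 2 * real (card X) + 1) \<le> \<alpha> * (real (Suc R) + 2 * real (BN + card X))"
        using alpha by (intro mult_left_mono) auto
      then show ?thesis using le' by simp
    qed
    moreover have "\<forall>k\<in>items S'. lab S' k = m \<and> mrk S' k \<noteq> Some MarkB"
      using lT unfolding it sel by simp
    ultimately show ?thesis
      unfolding balanced_def rd bn using s(6) e by simp
  qed
qed

text \<open>Up to \<open>1 / \<alpha>\<close> items, all are covered by the red items and the
  doubled blue bins, and at most the fraction \<open>\<alpha>\<close> of this total is red.\<close>

lemma balanced_blue_bins:
  assumes b: "balanced S"
  shows "(1 - \<alpha>) / 2 * (real (card (labeled S m)) - 1 / \<alpha>) \<le> real (card (bin_of S ` blues S m))"
proof -
  define U where "U = card (uncolored_items S m)"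
  define R where "R = real (card (reds S m))"
  define BN where "BN = real (card (bin_of S ` blues S m))"
  define L where "L = real (card (labeled S m))"
  have tt: "two_types S" using b marks_okD(1) unfolding balanced_def by blast
  have a3: "R \<le> \<alpha> * (R + 2 * BN)" and a4: "U = 0 \<or> \<alpha> * (L + real U - 1) < R + 1"
    using b unfolding balanced_def R_def BN_def U_def L_def by auto
  have "L \<le> real U + R + 2 * BN"
    using labeled_split[OF tt] blues_le[OF tt] unfolding L_def U_def R_def BN_def by linarith
  moreover have "L \<le> R + 2 * BN + 1 / \<alpha>" if "U \<noteq> 0"
  proof -
    have "\<alpha> * L \<le> \<alpha> * (L + real U - 1)" using that alpha by (intro mult_left_mono) auto
    also have "\<dots> \<le> \<alpha> * (R + 2 * BN) + 1" using a3 a4 that by linarith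
    finally show ?thesis using alpha by (simp add: field_simps)
  qed
  moreover have "0 < 1 / \<alpha>" using alpha by simp
  ultimately have "L - 1 / \<alpha> \<le> R + 2 * BN" by (cases "U = 0") (auto simp del: zero_less_divide_iff zero_less_divide_1_iff)
  then have "(1 - \<alpha>) * (L - 1 / \<alpha>) \<le> (1 - \<alpha>) * (R + 2 * BN)"
    using alpha by (intro mult_left_mono) auto
  also have "\<dots> \<le> 2 * BN" using a3 by (simp add: algebra_simps)
  finally show ?thesis unfolding L_def BN_def by simp
qed

lemma balanced_init: "balanced init_state"
proof -
  have e: "items init_state = {}" unfolding items_def init_state_def by simp
  have "two_types init_state" unfolding two_types_def using regular_init e by simp
  moreover have "unmarked_blue init_state m B = {}" for B unfolding unmarked_blue_def content_def e by simp
  moreover have "labeled init_state m = {}" unfolding labeled_def e by simp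
  moreover have "uncolored_items init_state m = {}" unfolding uncolored_items_def e by simp
  ultimately show ?thesis unfolding balanced_def marks_ok_def reds_def blues_def e by simp
qed

end

section \<open>The adversary for medium items\<close>

locale medium_run = eh_run + medium_phase +
  fixes r s :: real
  assumes r: "0 < r" "r \<le> 1" "type_of P r = m" and s: "0 < s" "s \<le> 1" "type_of P s = m" and r_s: "r \<noteq> s"
begin

definition free_host :: "eh_state \<Rightarrow> bool" where
  "free_host S \<longleftrightarrow> (\<exists>k\<in>items S. kind S (bin_of S k) = Unmixed \<and> col S k = Red \<and> needs P (lab S k) \<le> leaves P m)"

text \<open>A forecast from the state alone. It is valid for both sizes, as they have the same type
  and no large item is present; so the adversary can pick the size according to the outcome.\<close>

definition opens_bin :: "eh_state \<Rightarrow> bool" where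
  "opens_bin S \<longleftrightarrow> case_A P S m \<or> (\<nexists>B. open_bin P S Blue m B) \<and> \<not> free_host S"

fun adversary :: "real list \<Rightarrow> nat \<Rightarrow> real list" where
  "adversary \<sigma> 0 = \<sigma>"
| "adversary \<sigma> (Suc k) = adversary \<sigma> k @ [if opens_bin (A (adversary \<sigma> k)) then r else s]"

definition of_size :: "eh_state \<Rightarrow> real \<Rightarrow> nat set" where
  "of_size S x = {k \<in> labeled S m. sizes S ! k = x}"

text \<open>Items of size \<open>r\<close> open bins, hence never share one with each other. Items
  of size \<open>s\<close> join bins, hence are blue and lie beside an item of size \<open>r\<close>
  or in a bin with a red item of type \<open>f\<close>. The last clause holds because, as long as a
  free host exists, only case A leads to a new bin, and case A raises the red counter.\<close>

definition adv_inv :: "eh_state \<Rightarrow> bool" where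
  "adv_inv S \<longleftrightarrow> marks_ok S \<and> cnt_red S m \<le> card (reds S m) + 2 \<and>
     (\<forall>k\<in>labeled S m. sizes S ! k = r \<or> sizes S ! k = s) \<and>
     (\<forall>k\<in>of_size S r. kind S (bin_of S k) \<noteq> Mixed) \<and>
     (\<forall>k\<in>of_size S r. \<forall>k'\<in>of_size S r. bin_of S k = bin_of S k' \<longrightarrow> k = k') \<and>
     (\<forall>k\<in>of_size S s. col S k = Blue \<and>
        (kind S (bin_of S k) = Mixed \<or> (\<exists>k'\<in>of_size S r. bin_of S k' = bin_of S k))) \<and>
     (free_host S \<longrightarrow> card (of_size S r) \<le> cnt_red S m)"

lemma adv_invD:
  assumes "adv_inv S"
  shows "marks_ok S" "cnt_red S m \<le> card (reds S m) + 2"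
    "k \<in> labeled S m \<Longrightarrow> sizes S ! k = r \<or> sizes S ! k = s"
    "k \<in> of_size S r \<Longrightarrow> kind S (bin_of S k) \<noteq> Mixed"
    "k \<in> of_size S r \<Longrightarrow> k' \<in> of_size S r \<Longrightarrow> bin_of S k = bin_of S k' \<Longrightarrow> k = k'"
    "k \<in> of_size S s \<Longrightarrow> col S k = Blue"
    "k \<in> of_size S s \<Longrightarrow> kind S (bin_of S k) \<noteq> Mixed \<Longrightarrow> \<exists>k'\<in>of_size S r. bin_of S k' = bin_of S k"
    "free_host S \<Longrightarrow> card (of_size S r) \<le> cnt_red S m"
  using assms unfolding adv_inv_def by blast+

lemma of_size_iff: "k \<in> of_size S x \<longleftrightarrow> k \<in> labeled S m \<and> sizes S ! k = x"
  unfolding of_size_def by simp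

lemma finite_of_size [simp]: "finite (of_size S x)" unfolding of_size_def by simp

lemma adv_inv_step:
  assumes inv: "adv_inv S" and st: "eh_step P S p S'" and p: "p = (if opens_bin S then r else s)"
  shows "adv_inv S'"
proof -
  note I = adv_invD[OF inv]
  have pm: "0 < p" "p \<le> 1" "type_of P p = m" using p r s by auto
  obtain T T3 where st: "marks_ok T" "arrived S p T" "marks_ok S'" "recolored T T3" "recolored T3 S'"
    and red: "cnt_red S' m \<le> card (reds S' m) + 2"
    using medium_step[OF I(1) st pm] step_reds[OF I(1) st pm I(2)] by metis
  have rc: "recolored T S'" using recolored_trans st(4,5) by blast
  define n where "n = length (sizes S)"
  define B where "B = bin_of T n"
  note tS = marks_okD(1)[OF I(1)] and tT = marks_okD(1)[OF st(1)]
  interpret S: regular P S using tS unfolding two_types_def by simp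
  note ari = arrived_items[OF st(2), folded n_def B_def]
  have aT: "sizes T = sizes S @ [p]" "lab T = (lab S)(n := m)" "\<And>k. k \<in> items S \<Longrightarrow> col T k = col S k"
    "bin_of T = (bin_of S)(n := B)"
    "cnt_red T = (if case_A P S m then (cnt_red S)(m := Suc (cnt_red S m)) else cnt_red S)"
    "arrived_new S T \<or> arrived_open S T \<or> arrived_host S T"
    using st(2) unfolding arrived_def n_def[symmetric] B_def[symmetric] by auto
  have eq: "sizes S' = sizes T" "bin_of S' = bin_of T" "kind S' = kind T" "lab S' = lab T" "cnt_red S' = cnt_red T"
    "items S' = items T" "labeled S' = labeled T"
    using rc recolored_items[OF rc] unfolding recolored_def by auto
  have kn: "k \<noteq> n" if "k \<in> items S" for k using ari(2) that by auto
  have szS: "sizes S' ! k = sizes S ! k" if "k \<in> items S" for k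
    using that unfolding eq aT(1) items_def by (simp add: nth_append)
  have szn: "sizes S' ! n = p" unfolding eq aT(1) n_def by simp
  have binS: "bin_of S' k = bin_of S k" if "k \<in> items S" for k using kn[OF that] unfolding eq aT(4) by simp
  have binn: "bin_of S' n = B" unfolding eq aT(4) by simp
  have os: "of_size S' x = (if x = p then insert n (of_size S x) else of_size S x)" for x
    unfolding set_eq_iff of_size_iff eq(7) ari(4) using szS szn by (auto simp: of_size_iff)
  have osI: "k \<in> items S" if "k \<in> of_size S x" for k x using that unfolding of_size_iff by simp
  have colB: "col S' k = Blue" if "k \<in> items S" "col S k = Blue" for k
    using recolored_color[OF rc, of k] aT(3)[OF that(1)] that by simp
  have nos: "n \<notin> of_size S x" for x using ari(2) unfolding of_size_iff by auto
  have size2: "sizes S' ! k = r \<or> sizes S' ! k = s" if "k \<in> labeled S' m" for k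
    using that I(3)[of k] szS szn p unfolding eq(7) ari(4) by auto
  have mixed_keep: "kind S' (bin_of S' k) = Mixed" if "k \<in> items S" "kind S (bin_of S k) = Mixed" for k
  proof -
    have "bin_of S k \<noteq> nbins S" using S.item[OF that(1)] by simp
    then show ?thesis
      using aT(6) that(2) unfolding binS[OF that(1)] eq(3) arrived_new_def arrived_open_def arrived_host_def Let_def by auto
  qed
  \<comment> \<open>Medium items create no hosts: a red host is not of type \<open>m\<close>, so it
    was there, red and unmixed, before the arrival.\<close>
  have fh: "free_host S" if h: "free_host S'"
  proof -
    obtain k where k: "k \<in> items S'" "kind S' (bin_of S' k) = Unmixed" "col S' k = Red" "needs P (lab S' k) \<le> leaves P m"
      using h unfolding free_host_def by blast
    have lk: "lab S' k \<noteq> m" using k(4) m_not_hosted[of m] by auto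
    then have ks: "k \<in> items S" "k \<noteq> n" using k(1) unfolding eq aT(2) ari(1) by auto
    have lS: "lab S k = f" using lk tS ks unfolding eq aT(2) two_types_def by auto
    have "col S k \<noteq> Uncolored" using uncolored_unmixed(3)[OF tS ks(1)] lS m_f by auto
    then have "col S k = Red" using recolored_color[OF rc, of k] aT(3)[OF ks(1)] k(3) by simp
    moreover have "kind S (bin_of S k) = Unmixed"
    proof -
      have b: "bin_of S k \<noteq> nbins S" using S.item[OF ks(1)] by simp
      then show ?thesis
        using aT(6) k(2) unfolding binS[OF ks(1)] eq(3) arrived_new_def arrived_open_def arrived_host_def Let_def
        by (auto split: if_splits)
    qed
    ultimately show ?thesis using ks k(4) unfolding free_host_def eq aT(2) by auto
  qed
  have main: "(\<forall>k\<in>of_size S' r. kind S' (bin_of S' k) \<noteq> Mixed) \<and>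
     (\<forall>k\<in>of_size S' r. \<forall>k'\<in>of_size S' r. bin_of S' k = bin_of S' k' \<longrightarrow> k = k') \<and>
     (\<forall>k\<in>of_size S' s. col S' k = Blue \<and>
        (kind S' (bin_of S' k) = Mixed \<or> (\<exists>k'\<in>of_size S' r. bin_of S' k' = bin_of S' k))) \<and>
     (free_host S' \<longrightarrow> card (of_size S' r) \<le> cnt_red S' m)"
  proof (cases "arrived_new S T")
    case True
    have op: "opens_bin S" using True unfolding opens_bin_def free_host_def arrived_new_def by blast
    then have pr: "p = r" using p by simp
    have osr: "of_size S' r = insert n (of_size S r)" "of_size S' s = of_size S s" using os pr r_s by auto
    have e: "B = nbins S" "kind T = (kind S)(nbins S := Unmixed)"
      using True unfolding arrived_new_def n_def B_def by auto
    have bk: "bin_of S k \<noteq> B" if "k \<in> items S" for k using S.item[OF that] e by simp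
    have kk: "kind S' (bin_of S' k) = kind S (bin_of S k)" if "k \<in> items S" for k
      using bk[OF that] unfolding binS[OF that] unfolding eq(3) e(2) using e(1) by simp
    have kn': "kind S' (bin_of S' n) \<noteq> Mixed" unfolding binn eq(3) e by simp
    have 1: "kind S' (bin_of S' k) \<noteq> Mixed" if "k \<in> of_size S' r" for k
      using that kn' kk osI I(4) unfolding osr by auto
    have 2: "k = k'" if k: "k \<in> of_size S' r" "k' \<in> of_size S' r" "bin_of S' k = bin_of S' k'" for k k'
    proof -
      consider "k = n" "k' = n" | "k = n" "k' \<in> of_size S r" | "k' = n" "k \<in> of_size S r" | "k \<in> of_size S r" "k' \<in> of_size S r"
        using k unfolding osr by auto
      then show ?thesis
      proof cases
        case 2 then show ?thesis using k(3) binn binS[OF osI] bk[OF osI] by metis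
      next
        case 3 then show ?thesis using k(3) binn binS[OF osI] bk[OF osI] by metis
      next
        case 4 then show ?thesis using k(3) I(5) binS[OF osI] by metis
      qed auto
    qed
    have 3: "col S' k = Blue \<and> (kind S' (bin_of S' k) = Mixed \<or> (\<exists>k'\<in>of_size S' r. bin_of S' k' = bin_of S' k))"
      if "k \<in> of_size S' s" for k
    proof -
      have ks: "k \<in> of_size S s" "k \<in> items S" using that osI unfolding osr by auto
      have "kind S' (bin_of S' k) = Mixed \<or> (\<exists>k'\<in>of_size S' r. bin_of S' k' = bin_of S' k)"
      proof (cases "kind S (bin_of S k) = Mixed")
        case True then show ?thesis using kk[OF ks(2)] by simp
      next
        case False
        then obtain k' where "k' \<in> of_size S r" "bin_of S k' = bin_of S k" using I(7)[OF ks(1)] by blast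
        then show ?thesis using binS[OF osI] binS[OF ks(2)] unfolding osr by (metis insertI2)
      qed
      then show ?thesis using colB[OF ks(2)] I(6)[OF ks(1)] by blast
    qed
    have 4: "card (of_size S' r) \<le> cnt_red S' m" if "free_host S'"
    proof -
      have f: "free_host S" using fh[OF that] .
      have cA: "case_A P S m" using op f unfolding opens_bin_def by blast
      have "card (of_size S' r) = Suc (card (of_size S r))" unfolding osr using nos by simp
      also have "\<dots> \<le> Suc (cnt_red S m)" using I(8)[OF f] by simp
      also have "\<dots> = cnt_red S' m" unfolding eq aT(5) using cA by simp
      finally show ?thesis .
    qed
    show ?thesis using 1 2 3 4 by blast
  next
    case False
    then have oh: "arrived_open S T \<or> arrived_host S T" using aT(6) by blast
    have nA: "\<not> case_A P S m" using oh unfolding arrived_open_def arrived_host_def Let_def by auto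
    have nop: "\<not> opens_bin S"
      using oh unfolding opens_bin_def free_host_def arrived_open_def arrived_host_def Let_def by auto
    then have ps: "p = s" using p by simp
    have osr: "of_size S' r = of_size S r" "of_size S' s = insert n (of_size S s)" using os ps r_s by auto
    have cn: "col S' n = Blue"
      using oh recolored_color[OF rc, of n] unfolding arrived_open_def arrived_host_def Let_def n_def by auto
    have cr: "cnt_red S' m = cnt_red S m" unfolding eq aT(5) using nA by simp
    have rk: "kind S' (bin_of S' k) \<noteq> Mixed" if k: "k \<in> of_size S r" for k
    proof (cases "arrived_open S T")
      case True
      then show ?thesis using I(4)[OF k] binS[OF osI[OF k]] unfolding eq(3) arrived_open_def by simp
    next
      case False
      then have h: "arrived_host S T" using oh by blast
      then obtain k0 where k0: "k0 \<in> content S B" "col S k0 = Red" "lab S k0 = f" and ku: "kind S B = Unmixed" "kind T = (kind S)(B := Mixed)"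
        unfolding arrived_host_def Let_def n_def[symmetric] B_def[symmetric] by auto
      have ki: "k \<in> items S" "lab S k = m" using k unfolding of_size_iff by auto
      have "bin_of S k \<noteq> B"
      proof
        assume b: "bin_of S k = B"
        have kc: "k0 \<in> content S (bin_of S k)" using b k0 by simp
        have "col S k \<noteq> Red"
        proof
          assume "col S k = Red"
          then have "content S (bin_of S k) = {k}" using red_medium_alone(1)[OF tS, of k] ki by simp
          then have "k0 = k" using kc by blast
          then show False using k0 ki m_f by simp
        qed
        moreover have "col S k \<noteq> Uncolored"
        proof
          assume "col S k = Uncolored"
          then have "content S (bin_of S k) = {k}" using uncolored_unmixed(1)[OF tS ki(1)] by simp
          then have "k0 = k" using kc by blast
          then show False using k0 ki m_f by simp
        qed
        moreover have "col S k \<noteq> Blue" using S.mix[of k k0] ki k0 b ku by auto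
        ultimately show False using color_cases[of "col S k"] S.item[OF ki(1)] by blast
      qed
      then show ?thesis using I(4)[OF k] binS[OF ki(1)] unfolding eq(3) ku(2) by simp
    qed
    have 2: "k = k'" if k: "k \<in> of_size S' r" "k' \<in> of_size S' r" "bin_of S' k = bin_of S' k'" for k k'
      using that I(5) binS[OF osI] unfolding osr by metis
    have 3: "col S' k = Blue \<and> (kind S' (bin_of S' k) = Mixed \<or> (\<exists>k'\<in>of_size S' r. bin_of S' k' = bin_of S' k))"
      if "k \<in> of_size S' s" for k
    proof (cases "k = n")
      case kn: True
      show ?thesis
      proof (cases "arrived_open S T")
        case True
        then have o: "open_bin P S Blue m B" "kind T = kind S" unfolding arrived_open_def n_def B_def by auto
        then obtain k0 where k0: "k0 \<in> items S" "bin_of S k0 = B" "col S k0 = Blue" "lab S k0 = m"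
          unfolding open_bin_def by auto
        have k0l: "k0 \<in> labeled S m" using k0 by simp
        have "kind S' (bin_of S' n) = Mixed \<or> (\<exists>k'\<in>of_size S r. bin_of S k' = B)"
        proof (cases "sizes S ! k0 = r")
          case True
          then have "k0 \<in> of_size S r" using k0l unfolding of_size_iff by blast
          then show ?thesis using k0 by blast
        next
          case False
          then have k0s: "k0 \<in> of_size S s" using I(3)[OF k0l] k0l unfolding of_size_iff by blast
          show ?thesis
          proof (cases "kind S B = Mixed")
            case True
            then show ?thesis using o(2) unfolding binn eq(3) by simp
          next
            case False
            then show ?thesis using I(7)[OF k0s] k0(2) by simp
          qed
        qed
        then show ?thesis using cn kn binn binS[OF osI] unfolding osr by metis
      next
        case False
        then have "kind T = (kind S)(B := Mixed)"
          using oh unfolding arrived_host_def Let_def n_def[symmetric] B_def[symmetric] by auto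
        then show ?thesis using cn kn binn unfolding eq(3) by simp
      qed
    next
      case False
      then have ks: "k \<in> of_size S s" using that unfolding osr by simp
      have ki: "k \<in> items S" using osI[OF ks] .
      have "kind S' (bin_of S' k) = Mixed \<or> (\<exists>k'\<in>of_size S' r. bin_of S' k' = bin_of S' k)"
      proof (cases "kind S (bin_of S k) = Mixed")
        case True
        then show ?thesis using mixed_keep[OF ki] by blast
      next
        case False
        then obtain k' where "k' \<in> of_size S r" "bin_of S k' = bin_of S k" using I(7)[OF ks] by blast
        then show ?thesis using binS[OF osI] binS[OF ki] unfolding osr by metis
      qed
      then show ?thesis using colB[OF ki] I(6)[OF ks] by blast
    qed
    have 4: "card (of_size S' r) \<le> cnt_red S' m" if "free_host S'"
      using I(8)[OF fh[OF that]] unfolding osr cr .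
    show ?thesis using rk 2 3 4 unfolding osr(1) by blast
  qed
  show ?thesis unfolding adv_inv_def using st(3) red size2 main by blast
qed

definition host_bins :: "eh_state \<Rightarrow> nat set" where
  "host_bins S = {B \<in> bin_of S ` labeled S m. kind S B = Mixed}"

lemma adv_counts:
  assumes inv: "adv_inv S"
  shows "card (of_size S r) + card (host_bins S) \<le> card (bin_of S ` labeled S m)"
    "card (of_size S s) + card (reds S m) \<le> card (of_size S r) + 2 * card (host_bins S)"
    "card (labeled S m) = card (of_size S r) + card (of_size S s)"
    "\<And>k. k \<in> labeled S m \<Longrightarrow> col S k \<noteq> Blue \<Longrightarrow> sizes S ! k = r"
proof -
  note I = adv_invD[OF inv]
  note tS = marks_okD(1)[OF I(1)]
  have lab: "k \<in> labeled S m" if "k \<in> of_size S x" for k x using that unfolding of_size_iff by blast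
  have inj: "inj_on (bin_of S) (of_size S r)" using I(5) unfolding inj_on_def by blast
  have fh: "finite (host_bins S)" unfolding host_bins_def by simp
  have dj: "bin_of S ` of_size S r \<inter> host_bins S = {}" using I(4) unfolding host_bins_def by auto
  have "card (of_size S r) + card (host_bins S) = card (bin_of S ` of_size S r \<union> host_bins S)"
    using card_image[OF inj] dj fh by (simp add: card_Un_disjoint)
  also have "\<dots> \<le> card (bin_of S ` labeled S m)"
    using lab by (intro card_mono) (auto simp: host_bins_def)
  finally show "card (of_size S r) + card (host_bins S) \<le> card (bin_of S ` labeled S m)" .
  have "labeled S m = of_size S r \<union> of_size S s"
    using I(3) unfolding set_eq_iff Un_iff of_size_iff by blast
  moreover have "of_size S r \<inter> of_size S s = {}" using r_s unfolding of_size_def by auto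
  ultimately show "card (labeled S m) = card (of_size S r) + card (of_size S s)"
    by (simp add: card_Un_disjoint)
  show "sizes S ! k = r" if "k \<in> labeled S m" "col S k \<noteq> Blue" for k
    using I(3)[OF that(1)] I(6)[of k] that unfolding of_size_iff by blast
  have redr: "reds S m \<subseteq> of_size S r"
    using I(3,6) unfolding reds_def of_size_def by fastforce
  define BR where "BR = {k \<in> of_size S r. col S k = Blue}"
  define E1 where "E1 = {k \<in> of_size S s. kind S (bin_of S k) = Mixed}"
  define E2 where "E2 = {k \<in> of_size S s. kind S (bin_of S k) \<noteq> Mixed}"
  have two: "card Z \<le> 2" if Z: "Z \<subseteq> colored S (bin_of S k) Blue" and k: "k \<in> labeled S m" "col S k = Blue" for Z k
    using card_mono[OF finite_colored Z] blue_le_2[OF tS k] by simp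
  have "card E1 \<le> 2 * card (bin_of S ` E1)"
  proof (rule card_le_fibre_image)
    fix k assume k: "k \<in> E1"
    have "{k' \<in> E1. bin_of S k' = bin_of S k} \<subseteq> colored S (bin_of S k) Blue"
      using I(6) lab unfolding E1_def by auto
    then show "card {k' \<in> E1. bin_of S k' = bin_of S k} \<le> 2"
      using two[of _ k] k I(6) lab unfolding E1_def by blast
  qed (simp add: E1_def)
  also have "card (bin_of S ` E1) \<le> card (host_bins S)"
    using lab fh unfolding E1_def host_bins_def by (intro card_mono) auto
  finally have e1: "card E1 \<le> 2 * card (host_bins S)" by simp
  have mate: "\<exists>k'\<in>BR. bin_of S k' = bin_of S k" if k: "k \<in> E2" for k
  proof -
    obtain k' where k': "k' \<in> of_size S r" "bin_of S k' = bin_of S k"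
      using I(7)[of k] k unfolding E2_def by blast
    have kl: "k \<in> labeled S m" "sizes S ! k = s" using k lab unfolding E2_def of_size_iff by auto
    have k'l: "k' \<in> labeled S m" "k' \<noteq> k" using lab k' r_s kl unfolding of_size_iff by auto
    have kc: "k \<in> content S (bin_of S k')" using kl k' by simp
    have na: "content S (bin_of S k') \<noteq> {k'}" using kc k'l(2) by (metis singletonD)
    then have "col S k' \<noteq> Red" using red_medium_alone(1)[OF tS k'l(1)] by blast
    moreover have "col S k' \<noteq> Uncolored" using uncolored_unmixed(1)[OF tS, of k'] na k'l by auto
    ultimately have "col S k' = Blue"
      using color_cases[of "col S k'"] two_types_no_bonus[OF tS] k'l by auto
    then show ?thesis using k' unfolding BR_def by blast
  qed
  have inj2: "inj_on (bin_of S) E2"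
  proof (rule inj_onI)
    fix k k2 assume k: "k \<in> E2" "k2 \<in> E2" "bin_of S k = bin_of S k2"
    obtain k' where k': "k' \<in> BR" "bin_of S k' = bin_of S k" using mate[OF k(1)] by blast
    have b: "col S k = Blue" "col S k2 = Blue" "col S k' = Blue" using I(6) k k' unfolding E2_def BR_def by auto
    have l: "k \<in> labeled S m" "k2 \<in> labeled S m" "k' \<in> labeled S m" using lab k k' unfolding E2_def BR_def by auto
    have ne: "k' \<noteq> k" "k' \<noteq> k2" using k k' r_s unfolding E2_def BR_def of_size_def by auto
    show "k = k2"
    proof (rule ccontr)
      assume "k \<noteq> k2"
      then have "card {k, k2, k'} = 3" using ne by auto
      moreover have "{k, k2, k'} \<subseteq> colored S (bin_of S k) Blue" using b l k k' by auto
      then have "card {k, k2, k'} \<le> 2" using two l(1) b(1) by blast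
      ultimately show False by simp
    qed
  qed
  have "card E2 = card (bin_of S ` E2)" using card_image[OF inj2] by simp
  also have "\<dots> \<le> card (bin_of S ` BR)"
  proof (rule card_mono)
    show "bin_of S ` E2 \<subseteq> bin_of S ` BR" using mate by (metis image_subset_iff image_eqI)
  qed (simp add: BR_def)
  also have "\<dots> \<le> card BR" by (rule card_image_le) (simp add: BR_def)
  finally have e2: "card E2 \<le> card BR" .
  have "card BR + card (reds S m) = card (BR \<union> reds S m)"
    by (subst card_Un_disjoint) (auto simp: BR_def reds_def)
  also have "\<dots> \<le> card (of_size S r)" using redr by (intro card_mono) (auto simp: BR_def)
  finally have br: "card BR + card (reds S m) \<le> card (of_size S r)" .
  have "of_size S s = E1 \<union> E2" unfolding E1_def E2_def by auto
  moreover have "card (E1 \<union> E2) = card E1 + card E2"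
    by (rule card_Un_disjoint) (auto simp: E1_def E2_def)
  ultimately have "card (of_size S s) = card E1 + card E2" by simp
  then show "card (of_size S s) + card (reds S m) \<le> card (of_size S r) + 2 * card (host_bins S)"
    using e1 e2 br by linarith
qed

text \<open>A mixed bin contains a red item, which must be of type \<open>f\<close> because red
  items of type \<open>m\<close> stay unmixed.\<close>

lemma host_bins_le:
  assumes inv: "adv_inv S"
  shows "card (host_bins S) \<le> card (reds S f)"
proof -
  note tS = marks_okD(1)[OF adv_invD(1)[OF inv]]
  interpret regular P S using tS unfolding two_types_def by simp
  have "host_bins S \<subseteq> bin_of S ` reds S f"
  proof
    fix B assume B: "B \<in> host_bins S"
    then have "B < nbins S" "kind S B = Mixed" using item unfolding host_bins_def by auto
    then obtain k where k: "k \<in> items S" "bin_of S k = B" "col S k = Red" using mixed by fastforce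
    have "lab S k \<noteq> m" using red_medium_alone(2)[OF tS, of k] k \<open>kind S B = Mixed\<close> by auto
    then have "k \<in> reds S f" using k tS unfolding reds_def two_types_def by auto
    then show "B \<in> bin_of S ` reds S f" using k by blast
  qed
  then have "card (host_bins S) \<le> card (bin_of S ` reds S f)" by (intro card_mono) auto
  also have "\<dots> \<le> card (reds S f)" by (rule card_image_le) simp
  finally show ?thesis .
qed

text \<open>With \<open>redfit\<close> 1 the red items of type \<open>f\<close> are in distinct
  bins. If no host is free, all these bins are mixed, and their blue items are of type
  \<open>m\<close> since type \<open>f\<close> cannot host itself.\<close>

lemma host_bins_ge:
  assumes inv: "adv_inv S" and nofree: "\<not> free_host S" and h: "needs P f \<le> leaves P m" and f1: "redfit P f = 1"
    and ff: "redfrac P f > 0 \<Longrightarrow> \<not> needs P f \<le> leaves P f"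
  shows "card (reds S f) \<le> card (host_bins S)"
proof -
  note tS = marks_okD(1)[OF adv_invD(1)[OF inv]]
  interpret regular P S using tS unfolding two_types_def by simp
  have rl: "k \<in> items S" "lab S k = f" "col S k = Red" if "k \<in> reds S f" for k using that unfolding reds_def by auto
  have inj: "inj_on (bin_of S) (reds S f)"
  proof (rule inj_onI)
    fix k k' assume k: "k \<in> reds S f" "k' \<in> reds S f" "bin_of S k = bin_of S k'"
    have "card (colored S (bin_of S k) Red) \<le> 1"
      using cap[OF rl(1)[OF k(1)]] rl[OF k(1)] f1 unfolding capacity_for_def by simp
    moreover have "{k, k'} \<subseteq> colored S (bin_of S k) Red" using rl[OF k(1)] rl[OF k(2)] k(3) by auto
    ultimately show "k = k'" by (metis card_le_Suc0_iff_eq finite_colored insert_subset One_nat_def)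
  qed
  have "bin_of S ` reds S f \<subseteq> host_bins S"
  proof
    fix B assume "B \<in> bin_of S ` reds S f"
    then obtain k where k: "k \<in> reds S f" "B = bin_of S k" by blast
    note kr = rl[OF k(1)]
    have "kind S B \<noteq> Unmixed" using nofree h kr k(2) unfolding free_host_def by auto
    moreover have "kind S B \<noteq> PureBlue" using pure[OF kr(1)] kr k(2) by auto
    ultimately have M: "kind S B = Mixed" by (cases "kind S B") auto
    then obtain k' where k': "k' \<in> items S" "bin_of S k' = B" "col S k' = Blue"
      using mixed[of B] item[OF kr(1)] k(2) by auto
    have "hosts P S k' k" using mix[of k' k] k' kr k(2) by simp
    then have "needs P f \<le> leaves P (lab S k')"
      using two_types_not_large[OF tS k'(1)] kr unfolding hosts_def by simp
    then have "lab S k' \<noteq> f" using ff red[OF kr(1,3)] kr(2) by auto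
    then have "k' \<in> labeled S m" using tS k'(1) unfolding two_types_def by auto
    then show "B \<in> host_bins S" using M k'(2) unfolding host_bins_def by blast
  qed
  moreover have "finite (host_bins S)" unfolding host_bins_def by simp
  ultimately have "card (bin_of S ` reds S f) \<le> card (host_bins S)" by (intro card_mono) auto
  then show ?thesis using card_image[OF inj] by simp
qed

end

section \<open>Costs\<close>

context eh_parameters
begin

lemma blues_reds_count:
  assumes r: "regular P S" and i: "1 \<le> i" "i < N" "\<not> medium_type P i"
  shows "card (labeled S i) = card (blues S i) + card (reds S i)"
    "real (card (reds S i)) \<le> redfrac P i * real (card (labeled S i))"
    "redfrac P i * real (card (labeled S i)) - 1 \<le> real (card (reds S i))"
proof -
  interpret regular P S by fact
  have c: "col S k = Blue \<or> col S k = Red" if "k \<in> labeled S i" for k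
    using color_cases[of "col S k"] item[of k] unc[of k] that i(3) medium_type_of[of "sizes S ! k"] by auto
  have "labeled S i = blues S i \<union> reds S i" using c unfolding blues_def reds_def by blast
  moreover have "card (blues S i \<union> reds S i) = card (blues S i) + card (reds S i)"
    by (rule card_Un_disjoint) (auto simp: blues_def reds_def)
  ultimately show "card (labeled S i) = card (blues S i) + card (reds S i)" by simp
  have "int (card (reds S i)) = \<lfloor>redfrac P i * real (card (labeled S i))\<rfloor>"
    using red_cnt[OF i(3)] cnt_red[OF i(1,2)] unfolding reds_def cnt by simp
  then show "real (card (reds S i)) \<le> redfrac P i * real (card (labeled S i))"
    "redfrac P i * real (card (labeled S i)) - 1 \<le> real (card (reds S i))" by linarith+
qed

lemma blue_le_bins:
  assumes r: "regular P S"
  shows "card (blues S i) \<le> bluefit P i * card (bin_of S ` blues S i)"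
proof (rule card_le_fibre_image)
  fix k assume k: "k \<in> blues S i"
  have "{k' \<in> blues S i. bin_of S k' = bin_of S k} \<subseteq> colored S (bin_of S k) Blue"
    unfolding blues_def by auto
  then have "card {k' \<in> blues S i. bin_of S k' = bin_of S k} \<le> card (colored S (bin_of S k) Blue)"
    by (intro card_mono) auto
  also have "\<dots> \<le> bluefit P i"
    using regular.cap[OF r, of k] k unfolding blues_def capacity_for_def by auto
  finally show "card {k' \<in> blues S i. bin_of S k' = bin_of S k} \<le> bluefit P i" .
qed simp

lemma blue_bins:
  assumes r: "regular P S" and i: "1 \<le> i" "i < N" "\<not> medium_type P i" and b: "bluefit P i \<le> b"
  shows "(1 - redfrac P i) * real (card (labeled S i)) \<le> real b * real (card (bin_of S ` blues S i))"
proof -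
  have "card (blues S i) \<le> bluefit P i * card (bin_of S ` blues S i)" by (rule blue_le_bins[OF r])
  also have "\<dots> \<le> b * card (bin_of S ` blues S i)" using b by (rule mult_right_mono) simp
  finally have "real (card (blues S i)) \<le> real b * real (card (bin_of S ` blues S i))"
    by (metis of_nat_le_iff of_nat_mult)
  then show ?thesis using blues_reds_count[OF r i] by (simp add: algebra_simps)
qed

lemma red_bins:
  assumes r: "regular P S" and i: "1 \<le> i" "i < N" "\<not> medium_type P i" and b: "redfrac P i > 0 \<Longrightarrow> redfit P i \<le> b"
  shows "redfrac P i * real (card (labeled S i)) - 1 \<le> real b * real (card (bin_of S ` reds S i))"
proof -
  have "card (reds S i) \<le> b * card (bin_of S ` reds S i)"
  proof (rule card_le_fibre_image)
    fix k assume k: "k \<in> reds S i"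
    have "{k' \<in> reds S i. bin_of S k' = bin_of S k} \<subseteq> colored S (bin_of S k) Red"
      unfolding reds_def by auto
    then have "card {k' \<in> reds S i. bin_of S k' = bin_of S k} \<le> card (colored S (bin_of S k) Red)"
      by (intro card_mono) auto
    also have "\<dots> \<le> redfit P i"
      using regular.cap[OF r, of k] k unfolding reds_def capacity_for_def by auto
    also have "\<dots> \<le> b"
      using b regular.red[OF r, of k] k unfolding reds_def by auto
    finally show "card {k' \<in> reds S i. bin_of S k' = bin_of S k} \<le> b" .
  qed simp
  then have "real (card (reds S i)) \<le> real b * real (card (bin_of S ` reds S i))"
    by (metis of_nat_le_iff of_nat_mult)
  then show ?thesis using blues_reds_count(3)[OF r i] by linarith
qed

lemma disjoint_same_color:
  assumes r: "regular P S" and "i \<noteq> j"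
  shows "bin_of S ` blues S i \<inter> bin_of S ` blues S j = {}" "bin_of S ` reds S i \<inter> bin_of S ` reds S j = {}"
proof -
  have "bin_of S k \<noteq> bin_of S k'"
    if "k \<in> labeled S i" "k' \<in> labeled S j" "col S k = col S k'" for k k'
    using regular.same[OF r, of k k'] that assms(2) by auto
  then show "bin_of S ` blues S i \<inter> bin_of S ` blues S j = {}" "bin_of S ` reds S i \<inter> bin_of S ` reds S j = {}"
    unfolding blues_def reds_def by fastforce+
qed

lemma disjoint_blue_red:
  assumes r: "regular P S" and nl: "\<forall>k\<in>items S. \<not> large (sizes S ! k)"
    and h: "blues S i \<noteq> {} \<Longrightarrow> reds S j \<noteq> {} \<Longrightarrow> redfrac P j > 0 \<Longrightarrow> \<not> needs P j \<le> leaves P i"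
  shows "bin_of S ` blues S i \<inter> bin_of S ` reds S j = {}"
proof (rule ccontr)
  assume "bin_of S ` blues S i \<inter> bin_of S ` reds S j \<noteq> {}"
  then obtain k k' where k: "k \<in> blues S i" "k' \<in> reds S j" "bin_of S k = bin_of S k'" by auto
  then have k2: "k \<in> items S" "lab S k = i" "col S k = Blue" "k' \<in> items S" "lab S k' = j" "col S k' = Red"
    unfolding blues_def reds_def by auto
  have "hosts P S k k'" using regular.mix[OF r k2(1,4) k(3) k2(3,6)] by simp
  then have "needs P j \<le> leaves P i" using nl k2 unfolding hosts_def by auto
  moreover have "redfrac P j > 0" using regular.red[OF r k2(4,6)] k2 by simp
  ultimately show False using h k by blast
qed

end

lemma card_labeled:
  assumes "regular P S" "sizes S = \<sigma>"
  shows "card (labeled S i) = length (filter (\<lambda>p. type_of P p = i) \<sigma>)"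
proof -
  have "labeled S i = {k. k < length \<sigma> \<and> type_of P (\<sigma> ! k) = i}"
    using regular.item[OF assms(1)] assms(2) unfolding set_eq_iff labeled_iff items_def by auto
  then show ?thesis unfolding length_filter_conv_card by simp
qed

lemma mset_concat_replicate: "mset (concat (replicate n b)) = repeat_mset n (mset b)"
  by (induction n) auto

lemma repeat_replicate_mset: "repeat_mset n (replicate_mset k x) = replicate_mset (n * k) x"
  by (rule multiset_eqI) simp

lemma packable_two_patterns:
  assumes "mset \<sigma> = repeat_mset n (mset b) + repeat_mset k (mset c)" "sum_list b \<le> 1" "sum_list c \<le> 1"
  shows "packable \<sigma> (n + k)"
  using packable_bins[of \<sigma> "replicate n b @ replicate k c"] assms
  by (auto simp: mset_concat_replicate)

lemma sum_list_replicate': "sum_list (replicate n x) = real n * x" for x :: real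
  by (simp add: sum_list_replicate)

lemma filter_replicate': "filter Q (replicate n x) = (if Q x then replicate n x else [])"
  by simp

section \<open>The inputs\<close>

abbreviation (input) "R \<equiv> (1.5762 :: real)"

text \<open>The number \<open>e\<close> serves both as grain size of the sand and as excess of the
  sizes over 1/2, 1/3, 1/4, 1/7. Its total effect per offline bin is a few multiples of
  \<open>e\<close>, at most a few millionths, which the rounding of the constants absorbs.\<close>

locale instance_sizes = eh_run +
  fixes m f g :: nat and e :: real
  assumes m: "1 \<le> m" "m < N" "medium (t m)" "t (Suc m) \<le> 1/3" "1/3 + 2 * e \<le> t m"
    and f: "1 \<le> f" "f < N" "t f \<le> 1/3" "t (Suc f) \<le> 1/4" "1/4 + e \<le> t f"
    and g: "1 \<le> g" "g < N" "t g \<le> t f" "t (Suc g) \<le> 1/7" "1/7 + e \<le> t g"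
    and e: "0 < e" "e \<le> 1/10^6" "e \<le> t N"
begin

abbreviation "xr \<equiv> 1/3 + 2 * e"
abbreviation "xs \<equiv> 1/3 + e"
abbreviation "xf \<equiv> 1/4 + e"
abbreviation "xg \<equiv> 1/7 + e"
abbreviation "x1 \<equiv> 1/2 + e"
text \<open>Equal to \<open>1 - xs\<close>: such an item fits exactly with size \<open>xs\<close>
  and misses size \<open>xr\<close> by \<open>e\<close>.\<close>

abbreviation "x2 \<equiv> 2/3 - e"
abbreviation "\<mu> \<equiv> redfrac P m"
abbreviation "\<beta> \<equiv> redfrac P f"
abbreviation "\<gamma> \<equiv> redfrac P g"

lemma types [simp]: "type_of P xr = m" "type_of P xs = m" "type_of P xf = f" "type_of P xg = g"
  "type_of P x1 = 2" "type_of P x2 = 2"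
proof -
  have 2: "t (Suc 2) = 1/2" using thr_3 by (simp add: numeral_3_eq_3)
  show "type_of P xr = m" "type_of P xs = m" "type_of P xf = f" "type_of P xg = g"
    by (rule type_of_eqI; use m f g e in simp)+
  show "type_of P x1 = 2" "type_of P x2 = 2"
    by (rule type_of_eqI; use 2 thr_2 N_ge e in simp)+
qed

lemma type_neq: "m \<noteq> 2" "f \<noteq> 2" "g \<noteq> 2" "m \<noteq> f" "m \<noteq> g" and not_medium: "\<not> medium_type P f" "\<not> medium_type P g" "\<not> medium_type P 2"
  and m_med: "medium_type P m"
  using m f g thr_2 unfolding medium_def medium_type_def by auto

lemma two_N: "1 \<le> (2::nat)" "2 < N" using N_ge by auto

lemma size_classes: "\<not> large xr" "\<not> large xs" "\<not> large xf" "\<not> large xg" "\<not> medium xf" "\<not> medium xg" "\<not> medium x1" "\<not> medium x2"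
  using e unfolding large_def medium_def by auto

lemma bounds: "0 < xr" "xr \<le> 1" "0 < xs" "xs \<le> 1" "0 < xf" "xf \<le> 1" "0 < xg" "xg \<le> 1" "0 < x1" "x1 \<le> 1" "0 < x2" "x2 \<le> 1"
  using e by auto

lemma alpha: "0 \<le> \<mu>" "\<mu> < 1/3" and beta: "0 \<le> \<beta>" "\<beta> < 1/3" and gamma: "0 \<le> \<gamma>" "\<gamma> < 1/3"
  using redfrac_nonneg redfrac_less m f g by auto

lemma plainI:
  assumes "set \<sigma> \<subseteq> {xr, xs, xf, xg}" "set \<tau> \<subseteq> {xf, xg, x1, x2}"
  shows "plain (\<sigma> @ \<tau>)"
proof -
  have "\<forall>p\<in>set (\<sigma> @ \<tau>). 0 < p \<and> p \<le> 1 \<and> type_of P p < N"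
    using assms bounds m f g two_N by auto
  moreover have "\<forall>x\<in>set \<sigma>. \<not> large x" "\<forall>x\<in>set \<tau>. \<not> medium x" using assms size_classes by auto
  then have "sorted_wrt (\<lambda>x y. large x \<longrightarrow> \<not> medium y) (\<sigma> @ \<tau>)"
    unfolding sorted_wrt_append by (auto simp: sorted_wrt_iff_nth_less)
  ultimately show ?thesis unfolding plain_def by blast
qed

lemma plain_small: "set \<sigma> \<subseteq> {xr, xs, xf, xg} \<Longrightarrow> plain \<sigma>"
  using plainI[of \<sigma> "[]"] by simp

lemma bluefit_f: "bluefit P f = 3"
proof -
  have "\<lfloor>1 / t f\<rfloor> = 3"
    using f e by (intro floor_unique) (auto simp: field_simps)
  then show ?thesis unfolding bluefit_def by simp
qed

lemma bluefit_g: "bluefit P g \<le> 6"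
proof -
  have "1 / t g < 7" using g e by (simp add: field_simps)
  then show ?thesis unfolding bluefit_def by linarith
qed

lemma bluefit_2: "bluefit P 2 \<le> 1"
  using bluefit_large[of 2] two_N thr_2 by simp

lemma redfit_le:
  assumes "1 \<le> j" "j < N" "t j \<le> 1/3" "redfrac P j > 0" "1/3 < real (Suc n) * t j"
  shows "redfit P j \<le> n"
proof -
  have "small_type P j" using assms thr_pos[of j] unfolding small_type_def small_def by simp
  then have "real (redfit P j) * t j \<le> 1/3"
    using redfit_mult[of j] small_needs[of j] assms by simp
  then have "real (redfit P j) * t j < real (Suc n) * t j" using assms by linarith
  then have "real (redfit P j) < real (Suc n)" using thr_pos[of j] assms by (simp add: mult_less_cancel_right)
  then show ?thesis by simp
qed

lemma redfit_f: "\<beta> > 0 \<Longrightarrow> redfit P f = 1"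
  using redfit_le[of f 1] redfit_ge_1[of f] f e by simp

text \<open>The red space of a small type is at most 1/3, less than three items above 1/7. The two
  remaining values are the final case distinction of the proof.\<close>

lemma redfit_g: "\<gamma> > 0 \<Longrightarrow> redfit P g = 1 \<or> redfit P g = 2"
  using redfit_le[of g 2] redfit_ge_1[of g] f g e by (cases "redfit P g = 1") auto

text \<open>Rounding down wastes at most one grain per offline bin, which is the origin of the terms
  \<open>gap - e\<close>.\<close>

definition per_bin :: "real \<Rightarrow> nat" where
  "per_bin gap = nat \<lfloor>gap / e\<rfloor>"

definition sand :: "nat \<Rightarrow> real \<Rightarrow> real list" where
  "sand n gap = replicate (n * per_bin gap) e"

lemma per_bin:
  assumes "0 \<le> gap"
  shows "real (per_bin gap) * e \<le> gap" "gap - e \<le> real (per_bin gap) * e"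
proof -
  have r: "real (per_bin gap) = real_of_int \<lfloor>gap / e\<rfloor>"
    using assms e unfolding per_bin_def by simp
  have "real (per_bin gap) \<le> gap / e" "gap / e - 1 \<le> real (per_bin gap)" unfolding r by linarith+
  then show "real (per_bin gap) * e \<le> gap" "gap - e \<le> real (per_bin gap) * e"
    using e by (simp_all add: field_simps)
qed

lemma sand_cost:
  assumes "plain \<sigma>" "0 \<le> gap"
  shows "real (bins_used (A \<sigma>)) + real n * (gap - e) \<le> real (bins_used (A (\<sigma> @ sand n gap)))"
proof -
  have "real n * (gap - e) \<le> real n * (real (per_bin gap) * e)"
    using per_bin(2)[OF assms(2)] by (intro mult_left_mono) auto
  also have "\<dots> = sum_list (sand n gap)" unfolding sand_def sum_list_replicate' by simp
  finally show ?thesis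
    using sand_bins[OF assms(1), of "sand n gap"] e unfolding sand_def by force
qed

lemma valid_sand: "plain \<sigma> \<Longrightarrow> valid_input (\<sigma> @ sand n gap)"
  using e thr_N_less unfolding plain_def valid_input_def sand_def by auto

lemma mset_sand: "mset (sand n gap) = repeat_mset n (replicate_mset (per_bin gap) e)"
  unfolding sand_def repeat_replicate_mset by simp

text \<open>The volume condition makes the optimum unbounded, and for large \<open>n\<close> the
  linear surplus \<open>d * n\<close> outweighs the constant \<open>K\<close>.\<close>

lemma winI:
  assumes "\<And>n. 0 < n \<Longrightarrow> \<exists>\<sigma> w. valid_input \<sigma> \<and> packable \<sigma> w \<and> real n / 10 \<le> sum_list \<sigma> \<and>
      R * real w + d * real n - K \<le> real (bins_used (A \<sigma>))"
    and d: "d > 0"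
  shows "ereal R \<le> asymptotic_ratio (\<lambda>\<sigma>. bins_used (A \<sigma>))"
proof (rule asymptotic_ratio_geI)
  fix n0 :: nat
  obtain n :: nat where n: "max (K / d) (10 * real n0 + 1) < real n" using reals_Archimedean2 by blast
  then have "0 < n" by (auto simp: max_def split: if_splits)
  then obtain \<sigma> w where s: "valid_input \<sigma>" "packable \<sigma> w" "real n / 10 \<le> sum_list \<sigma>"
    "R * real w + d * real n - K \<le> real (bins_used (A \<sigma>))" using assms(1) by blast
  have "K \<le> d * real n" using n d by (simp add: field_simps)
  moreover have "R * real (opt \<sigma>) \<le> R * real w" using opt_le[OF s(2)] by simp
  ultimately have "R * real (opt \<sigma>) \<le> real (bins_used (A \<sigma>))" using s(4) by linarith
  moreover have "real n0 \<le> real (opt \<sigma>)" using sum_list_le_opt[OF s(2)] s(3) n by simp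
  ultimately show "\<exists>\<sigma>. valid_input \<sigma> \<and> n0 \<le> opt \<sigma> \<and> R * real (opt \<sigma>) \<le> real (bins_used (A \<sigma>))"
    using s(1) by auto
qed

text \<open>Offline, the input consists of \<open>n\<close> equal bins with pattern
  \<open>b\<close>, filled up with sand. Per such bin the algorithm pays \<open>v\<close> for the
  pattern and at least \<open>gap - e\<close> for the sand.\<close>

lemma winI_uniform:
  assumes "\<And>n. 0 < n \<Longrightarrow> plain (\<sigma> n) \<and> mset (\<sigma> n) = repeat_mset n (mset b) \<and>
       v * real n - K \<le> real (bins_used (A (\<sigma> n)))"
    and gap: "gap = 1 - sum_list b" "0 \<le> gap" "gap \<le> 9/10" and v: "R < v + gap - e"
  shows "ereal R \<le> asymptotic_ratio (\<lambda>\<sigma>. bins_used (A \<sigma>))"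
proof (rule winI)
  show "0 < v + gap - e - R" using v by simp
  fix n :: nat assume "0 < n"
  note a = assms(1)[OF this]
  have ms: "mset (\<sigma> n @ sand n gap) = repeat_mset n (mset (b @ replicate (per_bin gap) e)) + repeat_mset 0 (mset [])"
    using a by (simp add: mset_sand)
  have "packable (\<sigma> n @ sand n gap) n"
    using packable_two_patterns[OF ms] per_bin(1)[OF gap(2)] gap by (simp add: sum_list_replicate')
  moreover have "real n / 10 \<le> sum_list (\<sigma> n @ sand n gap)"
  proof -
    have "sum_list (\<sigma> n) = sum_list (concat (replicate n b))"
      using a mset_concat_replicate[of n b] by (metis sum_mset_sum_list)
    also have "\<dots> = real n * sum_list b"
      by (induction n) (simp_all add: algebra_simps)
    also have "\<dots> \<ge> real n * (1/10)" using gap by (intro mult_left_mono) auto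
    finally have "real n / 10 \<le> sum_list (\<sigma> n)" by simp
    moreover have "0 \<le> sum_list (sand n gap)" unfolding sand_def using e by (intro sum_list_nonneg) auto
    ultimately show ?thesis by simp
  qed
  moreover have "R * real n + (v + gap - e - R) * real n - K \<le> real (bins_used (A (\<sigma> n @ sand n gap)))"
  proof -
    have "real (bins_used (A (\<sigma> n))) + real n * (gap - e) \<le> real (bins_used (A (\<sigma> n @ sand n gap)))"
      using sand_cost a gap(2) by blast
    then show ?thesis using a by (simp add: algebra_simps)
  qed
  ultimately show "\<exists>\<sigma> w. valid_input \<sigma> \<and> packable \<sigma> w \<and> real n / 10 \<le> sum_list \<sigma> \<and>
      R * real w + (v + gap - e - R) * real n - K \<le> real (bins_used (A \<sigma>))"
    using valid_sand a by blast
qed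

end

section \<open>Lower bounds on the cost of the individual inputs\<close>

lemma bins_used_ge:
  assumes "sorted_wrt (\<lambda>X Y. bin_of S ` X \<inter> bin_of S ` Y = {}) Xs" "\<And>X. X \<in> set Xs \<Longrightarrow> X \<subseteq> items S"
  shows "real (sum_list (map (\<lambda>X. card (bin_of S ` X)) Xs)) \<le> real (bins_used S)"
proof -
  have "finite X \<and> X \<subseteq> items S" if "X \<in> set Xs" for X
    using assms(2)[OF that] finite_subset[OF _ finite_items] by simp
  from sum_card_image_le[OF assms(1) this finite_items] show ?thesis
    unfolding bins_used_def of_nat_le_iff .
qed

context instance_sizes
begin

lemma run_state:
  assumes "plain \<sigma>"
  shows "regular P (A \<sigma>)" "sizes (A \<sigma>) = \<sigma>" "items (A \<sigma>) = {..<length \<sigma>}"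
    "card (labeled (A \<sigma>) i) = length (filter (\<lambda>p. type_of P p = i) \<sigma>)"
  using run_regular[OF assms] card_labeled[of P "A \<sigma>" \<sigma> i] unfolding items_def by auto

text \<open>The bound for blue medium bins is proved for runs with medium items only. It remains
  available afterwards because colors and positions of blue items are permanent.\<close>

lemma keep_blue:
  assumes "plain (\<sigma> @ \<tau>)"
  shows "bin_of (A \<sigma>) ` blues (A \<sigma>) i \<subseteq> bin_of (A (\<sigma> @ \<tau>)) ` blues (A (\<sigma> @ \<tau>)) i"
proof
  fix B assume "B \<in> bin_of (A \<sigma>) ` blues (A \<sigma>) i"
  then obtain k where k: "k \<in> items (A \<sigma>)" "lab (A \<sigma>) k = i" "col (A \<sigma>) k = Blue" "B = bin_of (A \<sigma>) k"
    unfolding blues_def by auto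
  note s1 = run_state[OF plain_prefix[OF assms]] and s2 = run_state[OF assms]
  have kl: "k < length \<sigma>" using k(1) s1(3) by simp
  then have ki: "k \<in> items (A (\<sigma> @ \<tau>))" using s2(3) by simp
  have "lab (A (\<sigma> @ \<tau>)) k = i"
    using regular.item[OF s2(1) ki] regular.item[OF s1(1) k(1)] s1(2) s2(2) k(2) kl by (simp add: nth_append)
  then have "k \<in> blues (A (\<sigma> @ \<tau>)) i" "bin_of (A (\<sigma> @ \<tau>)) k = B"
    using run_keep[OF assms kl] k ki unfolding blues_def by auto
  then show "B \<in> bin_of (A (\<sigma> @ \<tau>)) ` blues (A (\<sigma> @ \<tau>)) i" by blast
qed

lemma medium_phase_here: "\<mu> > 0 \<Longrightarrow> medium_phase P m f"
  using m f by unfold_locales auto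

lemma medium_run_here: "\<mu> > 0 \<Longrightarrow> medium_run P A m f xr xs"
proof -
  assume a: "\<mu> > 0"
  interpret medium_phase P m f using medium_phase_here[OF a] .
  show ?thesis using bounds e by unfold_locales auto
qed

text \<open>For \<open>\<mu> = 0\<close> all items are blue, and \<open>1 / 0 = 0\<close> turns the
  bound into \<open>n / 2\<close>.\<close>

lemma medium_blue_bins:
  "(1 - \<mu>) / 2 * (real n - 1 / \<mu>) \<le> real (card (bin_of (A (replicate n xs)) ` blues (A (replicate n xs)) m))"
proof (cases "\<mu> > 0")
  case True
  interpret mp: medium_phase P m f using medium_phase_here[OF True] .
  have pl: "plain (replicate n xs)" for n by (rule plain_small) auto
  have "mp.balanced (A (replicate n xs))"
  proof (induction n)
    case 0
    then show ?case using mp.balanced_init start by simp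
  next
    case (Suc n)
    have "plain (replicate n xs @ [xs])" using pl[of "Suc n"] by (simp add: replicate_append_same)
    then show ?case
      using mp.step_balanced[OF Suc run_step(1) bounds(3,4) types(2)] by (simp add: replicate_append_same)
  qed
  then show ?thesis
    using mp.balanced_blue_bins[of "A (replicate n xs)"] run_state(4)[OF pl, of n m] by simp
next
  case False
  then have a0: "\<mu> = 0" using alpha by simp
  define S where "S = A (replicate n xs)"
  have pl: "plain (replicate n xs)" by (rule plain_small) auto
  note s = run_state[OF pl, folded S_def]
  have "blues S m = labeled S m"
    using regular.unc[OF s(1)] regular.red[OF s(1)] regular.item[OF s(1)] color_cases a0
    unfolding blues_def by fastforce
  then have "card (blues S m) = n" using s(4)[of m] by simp
  moreover have "bluefit P m \<le> 2"
  proof -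
    have "1 / t m < 3" using m(3) unfolding medium_def by (simp add: field_simps)
    then show ?thesis unfolding bluefit_def by linarith
  qed
  then have "bluefit P m * card (bin_of S ` blues S m) \<le> 2 * card (bin_of S ` blues S m)" by (rule mult_right_mono) simp
  ultimately have "n \<le> 2 * card (bin_of S ` blues S m)" using blue_le_bins[OF s(1), of m] by linarith
  then show ?thesis unfolding a0 S_def by simp
qed

text \<open>Only blue bins are counted, since red items may share bins with blue ones here, whereas
  blue bins of different types are always distinct. The number \<open>z\<close> tells whether the
  offline bins contain an item \<open>xg\<close>.\<close>

lemma input_A:
  assumes z: "z \<le> (1::nat)" and b: "bluefit P g \<le> b" "0 < b"
    and w: "R < 1 + (1 - \<mu>) / 2 + real z * ((1 - \<gamma>) / real b) + (1 - (x1 + xs + real z * xg)) - e"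
  shows "ereal R \<le> asymptotic_ratio (\<lambda>\<sigma>. bins_used (A \<sigma>))"
proof (rule winI_uniform[where b = "[x1, xs] @ replicate z xg" and v = "1 + (1 - \<mu>) / 2 + real z * ((1 - \<gamma>) / real b)"
      and gap = "1 - (x1 + xs + real z * xg)" and K = "(1 - \<mu>) / 2 * (1 / \<mu>)"
      and \<sigma> = "\<lambda>n. replicate n xs @ (replicate (n * z) xg @ replicate n x1)"])
  have zc: "z = 0 \<or> z = 1" using z by auto
  show "1 - (x1 + xs + real z * xg) = 1 - sum_list ([x1, xs] @ replicate z xg)"
    by (simp add: sum_list_replicate')
  show "0 \<le> 1 - (x1 + xs + real z * xg)" "1 - (x1 + xs + real z * xg) \<le> 9/10" using zc e by auto
  show "R < 1 + (1 - \<mu>) / 2 + real z * ((1 - \<gamma>) / real b) + (1 - (x1 + xs + real z * xg)) - e" by fact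
  fix n :: nat assume "0 < n"
  define \<sigma> where "\<sigma> = replicate n xs @ (replicate (n * z) xg @ replicate n x1)"
  have pl: "plain \<sigma>" unfolding \<sigma>_def by (rule plainI) auto
  define S where "S = A \<sigma>"
  note s = run_state[OF pl, folded S_def]
  have "card (labeled S 2) = n" "card (labeled S g) = n * z"
    using s(4) type_neq unfolding \<sigma>_def by simp_all
  then have l: "real n \<le> real (card (bin_of S ` blues S 2))"
    and g': "(1 - \<gamma>) * real (n * z) \<le> real b * real (card (bin_of S ` blues S g))"
    using blue_bins[OF s(1) two_N not_medium(3) bluefit_2] blue_bins[OF s(1) g(1,2) not_medium(2) b(1)] redfrac_2
    by simp_all
  have g2: "real n * (real z * ((1 - \<gamma>) / real b)) \<le> real (card (bin_of S ` blues S g))"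
    using g' b(2) by (simp add: field_simps)
  have "card (bin_of (A (replicate n xs)) ` blues (A (replicate n xs)) m) \<le> card (bin_of S ` blues S m)"
    using keep_blue[of "replicate n xs" "replicate (n * z) xg @ replicate n x1" m] pl
    unfolding S_def \<sigma>_def by (intro card_mono) auto
  then have mm: "(1 - \<mu>) / 2 * (real n - 1 / \<mu>) \<le> real (card (bin_of S ` blues S m))"
    using medium_blue_bins[of n] by linarith
  have tot: "real (sum_list (map (\<lambda>X. card (bin_of S ` X)) [blues S 2, blues S m, blues S g])) \<le> real (bins_used S)"
    using disjoint_same_color(1)[OF s(1)] type_neq by (intro bins_used_ge) (auto simp: blues_def)
  have "(1 + (1 - \<mu>) / 2 + real z * ((1 - \<gamma>) / real b)) * real n - (1 - \<mu>) / 2 * (1 / \<mu>) \<le> real (bins_used S)"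
  proof -
    have ring: "(1 + a + z' * d) * n' - a * c = n' + a * (n' - c) + n' * (z' * d)" for a z' d n' c :: real
      by (simp add: algebra_simps)
    have "(1 + (1 - \<mu>) / 2 + real z * ((1 - \<gamma>) / real b)) * real n - (1 - \<mu>) / 2 * (1 / \<mu>) =
      real n + (1 - \<mu>) / 2 * (real n - 1 / \<mu>) + real n * (real z * ((1 - \<gamma>) / real b))"
      by (rule ring)
    moreover have "real (card (bin_of S ` blues S 2)) + real (card (bin_of S ` blues S m)) +
      real (card (bin_of S ` blues S g)) \<le> real (bins_used S)" using tot by simp
    ultimately show ?thesis using l g2 mm by linarith
  qed
  moreover have "mset \<sigma> = repeat_mset n (mset ([x1, xs] @ replicate z xg))"
    unfolding \<sigma>_def by (rule multiset_eqI) (simp add: algebra_simps)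
  ultimately show "plain (replicate n xs @ (replicate (n * z) xg @ replicate n x1)) \<and>
    mset (replicate n xs @ (replicate (n * z) xg @ replicate n x1)) = repeat_mset n (mset ([x1, xs] @ replicate z xg)) \<and>
    (1 + (1 - \<mu>) / 2 + real z * ((1 - \<gamma>) / real b)) * real n - (1 - \<mu>) / 2 * (1 / \<mu>) \<le>
      real (bins_used (A (replicate n xs @ (replicate (n * z) xg @ replicate n x1))))"
    using pl unfolding S_def \<sigma>_def by blast
qed

lemma self_host: "1 \<le> j \<Longrightarrow> j < N \<Longrightarrow> redfrac P j > 0 \<Longrightarrow> 1 \<le> i \<Longrightarrow> i < N \<Longrightarrow> t i \<le> t j \<Longrightarrow> \<not> needs P j \<le> leaves P i"
proof (rule no_small_host)
  assume a: "1 \<le> j" "j < N" "redfrac P j > 0" "t i \<le> t j"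
  have "1 * t j \<le> real (redfit P j) * t j"
    using redfit_ge_1[of j] thr_pos[of j] a by (intro mult_right_mono) auto
  then show "t i \<le> real (redfit P j) * t j" using a by simp
qed auto

text \<open>There are no large items, and blue items of these types do not host the red ones, so red
  items occupy bins of their own. An item \<open>xf\<close> then costs 1/3 if blue and 1 if red, an
  item \<open>xg\<close> costs at least 1/6 or \<open>1 / \<rho>\<close>. The only incompatibility
  not implied by the order of the sizes is that of red \<open>g\<close> with blue \<open>f\<close>,
  hence the assumption \<open>h\<close>.\<close>

lemma input_C:
  assumes fg: "f \<noteq> g" and \<rho>: "0 < \<rho>" "\<gamma> > 0 \<Longrightarrow> redfit P g \<le> \<rho>"
    and h: "a = 0 \<or> b = 0 \<or> (\<gamma> > 0 \<longrightarrow> \<not> needs P g \<le> leaves P f)"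
    and gap: "gap = 1 - (real a * xf + real b * xg)" "0 \<le> gap" "gap \<le> 9/10"
    and w: "R < real a * ((1 - \<beta>) / 3 + \<beta>) + real b * ((1 - \<gamma>) / 6 + \<gamma> / real \<rho>) + gap - e"
  shows "ereal R \<le> asymptotic_ratio (\<lambda>\<sigma>. bins_used (A \<sigma>))"
proof (rule winI_uniform[where b = "replicate a xf @ replicate b xg" and gap = gap and K = 2
      and v = "real a * ((1 - \<beta>) / 3 + \<beta>) + real b * ((1 - \<gamma>) / 6 + \<gamma> / real \<rho>)"
      and \<sigma> = "\<lambda>n. replicate (n * a) xf @ replicate (n * b) xg"])
  show "gap = 1 - sum_list (replicate a xf @ replicate b xg)" using gap by (simp add: sum_list_replicate')
  show "0 \<le> gap" "gap \<le> 9/10"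
    "R < real a * ((1 - \<beta>) / 3 + \<beta>) + real b * ((1 - \<gamma>) / 6 + \<gamma> / real \<rho>) + gap - e" by fact+
  fix n :: nat assume "0 < n"
  define \<sigma> where "\<sigma> = replicate (n * a) xf @ replicate (n * b) xg"
  have pl: "plain \<sigma>" unfolding \<sigma>_def by (rule plain_small) auto
  define S where "S = A \<sigma>"
  note s = run_state[OF pl, folded S_def]
  have cl: "card (labeled S f) = n * a" "card (labeled S g) = n * b"
    using s(4) fg unfolding \<sigma>_def by simp_all
  have bf: "(1 - \<beta>) * real (n * a) \<le> real 3 * real (card (bin_of S ` blues S f))"
    using blue_bins[OF s(1) f(1,2) not_medium(1), of 3] bluefit_f cl by simp
  have bg: "(1 - \<gamma>) * real (n * b) \<le> real 6 * real (card (bin_of S ` blues S g))"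
    using blue_bins[OF s(1) g(1,2) not_medium(2) bluefit_g] cl by simp
  have rf: "\<beta> * real (n * a) - 1 \<le> real 1 * real (card (bin_of S ` reds S f))"
    using red_bins[OF s(1) f(1,2) not_medium(1), of 1] redfit_f cl by simp
  have rg: "\<gamma> * real (n * b) - 1 \<le> real \<rho> * real (card (bin_of S ` reds S g))"
    using red_bins[OF s(1) g(1,2) not_medium(2) \<rho>(2)] cl by simp
  have rg': "\<gamma> / real \<rho> * real (n * b) - 1 \<le> real (card (bin_of S ` reds S g))"
  proof -
    have "\<gamma> / real \<rho> * real (n * b) - 1 / real \<rho> \<le> real (card (bin_of S ` reds S g))"
      using rg \<rho>(1) by (simp add: field_simps)
    moreover have "1 / real \<rho> \<le> 1" using \<rho>(1) by simp
    ultimately show ?thesis by linarith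
  qed
  have nl: "\<forall>k\<in>items S. \<not> large (sizes S ! k)"
  proof
    fix k assume "k \<in> items S"
    then have "sizes S ! k \<in> set \<sigma>" using s(2,3) by simp
    then show "\<not> large (sizes S ! k)" using size_classes unfolding \<sigma>_def by auto
  qed
  have e: "blues S f = {}" if "a = 0" using cl(1) that by (auto simp: blues_def card_eq_0_iff set_eq_iff)
  have e': "reds S g = {}" if "b = 0" using cl(2) that by (auto simp: reds_def card_eq_0_iff set_eq_iff)
  have d1: "bin_of S ` blues S f \<inter> bin_of S ` reds S f = {}"
    by (rule disjoint_blue_red[OF s(1) nl]) (use self_host f in auto)
  have d2: "bin_of S ` blues S g \<inter> bin_of S ` reds S f = {}"
    by (rule disjoint_blue_red[OF s(1) nl]) (use self_host f g in auto)
  have d3: "bin_of S ` blues S g \<inter> bin_of S ` reds S g = {}"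
    by (rule disjoint_blue_red[OF s(1) nl]) (use self_host g in auto)
  have d4: "bin_of S ` blues S f \<inter> bin_of S ` reds S g = {}"
    by (rule disjoint_blue_red[OF s(1) nl]) (use h e e' in auto)
  have tot: "real (sum_list (map (\<lambda>X. card (bin_of S ` X)) [blues S f, blues S g, reds S f, reds S g])) \<le> real (bins_used S)"
    using disjoint_same_color[OF s(1) fg] d1 d2 d3 d4 by (intro bins_used_ge) (auto simp: blues_def reds_def)
  have "(real a * ((1 - \<beta>) / 3 + \<beta>) + real b * ((1 - \<gamma>) / 6 + \<gamma> / real \<rho>)) * real n - 2 \<le> real (bins_used S)"
  proof -
    have "(a' * ((1 - \<beta>) / 3 + \<beta>) + b' * ((1 - \<gamma>) / 6 + d)) * n' =
       (1 - \<beta>) * (n' * a') / 3 + \<beta> * (n' * a') + (1 - \<gamma>) * (n' * b') / 6 + d * (n' * b')" for a' b' d n' :: real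
      by (simp add: field_simps)
    from this[of "real a" "real b" "\<gamma> / real \<rho>" "real n"]
    have eq: "(real a * ((1 - \<beta>) / 3 + \<beta>) + real b * ((1 - \<gamma>) / 6 + \<gamma> / real \<rho>)) * real n =
      (1 - \<beta>) * real (n * a) / 3 + \<beta> * real (n * a) + (1 - \<gamma>) * real (n * b) / 6 + \<gamma> / real \<rho> * real (n * b)"
      by simp
    have "real (card (bin_of S ` blues S f)) + real (card (bin_of S ` blues S g)) + real (card (bin_of S ` reds S f)) +
      real (card (bin_of S ` reds S g)) \<le> real (bins_used S)" using tot by simp
    then show ?thesis unfolding eq using bf bg rf rg' by linarith
  qed
  moreover have "mset \<sigma> = repeat_mset n (mset (replicate a xf @ replicate b xg))"
    unfolding \<sigma>_def by (rule multiset_eqI) (simp add: algebra_simps)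
  ultimately show "plain (replicate (n * a) xf @ replicate (n * b) xg) \<and>
    mset (replicate (n * a) xf @ replicate (n * b) xg) = repeat_mset n (mset (replicate a xf @ replicate b xg)) \<and>
    (real a * ((1 - \<beta>) / 3 + \<beta>) + real b * ((1 - \<gamma>) / 6 + \<gamma> / real \<rho>)) * real n - 2 \<le>
      real (bins_used (A (replicate (n * a) xf @ replicate (n * b) xg)))"
    using pl unfolding S_def \<sigma>_def by blast
qed

end

lemma (in medium_phase) marks_ok_start:
  assumes "two_types S" "labeled S m = {}"
  shows "marks_ok S" "cnt_red S m \<le> card (reds S m) + 2"
proof -
  interpret regular P S using assms unfolding two_types_def by simp
  have "unmarked_blue S m B = {}" for B using assms(2) unfolding set_eq_iff unmarked_blue_iff by blast
  then show "marks_ok S" using assms unfolding marks_ok_def by simp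
  show "cnt_red S m \<le> card (reds S m) + 2" using cnt_red[of m] m cnt[of m] assms(2) by simp
qed

context instance_sizes
begin

lemma two_types_here:
  assumes "\<mu> > 0" "plain \<sigma>" "set \<sigma> \<subseteq> {xr, xs, xf}"
  shows "medium_phase.two_types P m f (A \<sigma>)"
proof -
  interpret mp: medium_phase P m f using medium_phase_here[OF assms(1)] .
  note s = run_state[OF assms(2)]
  have "lab (A \<sigma>) k = m \<or> lab (A \<sigma>) k = f" if k: "k \<in> items (A \<sigma>)" for k
  proof -
    have "sizes (A \<sigma>) ! k \<in> {xr, xs, xf}" using assms(3) s(2,3) k nth_mem by fastforce
    then have "type_of P (sizes (A \<sigma>) ! k) = m \<or> type_of P (sizes (A \<sigma>) ! k) = f" by auto
    then show ?thesis using regular.item[OF s(1) k] by simp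
  qed
  then show ?thesis unfolding mp.two_types_def using s(1) by blast
qed

text \<open>A blue medium item costs at least 1/2, and a red or uncolored one is alone in its bin,
  so the two medium items of an offline bin cost about \<open>1 + \<mu>\<close>. By \<open>h\<close>
  the red items of type \<open>f\<close> find no partner either.\<close>

lemma input_B:
  assumes pos: "\<mu> > 0" and h: "\<not> needs P f \<le> leaves P m"
    and w: "R < 1 + \<mu> + (1 - \<beta>) / 3 + \<beta> + (1 - (2 * xs + xf)) - e"
  shows "ereal R \<le> asymptotic_ratio (\<lambda>\<sigma>. bins_used (A \<sigma>))"
proof (rule winI_uniform[where b = "[xs, xs, xf]" and gap = "1 - (2 * xs + xf)" and K = 3
      and v = "1 + \<mu> + (1 - \<beta>) / 3 + \<beta>" and \<sigma> = "\<lambda>n. replicate n xf @ replicate (2 * n) xs"])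
  interpret mp: medium_phase P m f using medium_phase_here[OF pos] .
  show "1 - (2 * xs + xf) = 1 - sum_list [xs, xs, xf]" by simp
  show "0 \<le> 1 - (2 * xs + xf)" "1 - (2 * xs + xf) \<le> 9/10" using e by auto
  show "R < 1 + \<mu> + (1 - \<beta>) / 3 + \<beta> + (1 - (2 * xs + xf)) - e" by fact
  fix n :: nat assume "0 < n"
  define \<sigma> where "\<sigma> = replicate n xf @ replicate (2 * n) xs"
  have pl: "plain (replicate n xf @ replicate k xs)" for k by (rule plain_small) auto
  have inv: "mp.marks_ok (A (replicate n xf @ replicate k xs)) \<and>
    cnt_red (A (replicate n xf @ replicate k xs)) m \<le> card (reds (A (replicate n xf @ replicate k xs)) m) + 2" for k
  proof (induction k)
    case 0
    have p0: "plain (replicate n xf)" by (rule plain_small) auto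
    have "labeled (A (replicate n xf)) m = {}"
      using run_state(4)[OF p0, of m] type_neq by (simp add: filter_replicate' card_eq_0_iff)
    then show ?case
      using mp.marks_ok_start[OF two_types_here[OF pos p0]] by (simp add: set_replicate_conv_if)
  next
    case (Suc k)
    have "plain ((replicate n xf @ replicate k xs) @ [xs])"
      using pl[of "Suc k"] by (simp add: replicate_append_same)
    note st = run_step(1)[OF this]
    obtain T T3 where "mp.marks_ok (A ((replicate n xf @ replicate k xs) @ [xs]))"
      using mp.medium_step[OF conjunct1[OF Suc] st bounds(3,4) types(2)] by metis
    moreover note mp.step_reds[OF conjunct1[OF Suc] st bounds(3,4) types(2) conjunct2[OF Suc]]
    ultimately show ?case by (simp add: replicate_append_same)
  qed
  have pls: "plain \<sigma>" using pl unfolding \<sigma>_def .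
  define S where "S = A \<sigma>"
  have ok: "mp.marks_ok S" and cr: "cnt_red S m \<le> card (reds S m) + 2"
    using inv unfolding S_def \<sigma>_def by auto
  note s = run_state[OF pls, folded S_def]
  note tt = mp.marks_okD(1)[OF ok]
  interpret regular P S by (rule s(1))
  have cl: "card (labeled S f) = n" "card (labeled S m) = 2 * n"
    using s(4) type_neq unfolding \<sigma>_def by simp_all
  have nl: "\<forall>k\<in>items S. \<not> large (sizes S ! k)" using mp.two_types_not_large[OF tt] by blast
  define X where "X = uncolored_items S m \<union> reds S m"
  have al: "content S (bin_of S k) = {k}" if "k \<in> X" for k
    using that mp.red_medium_alone(1)[OF tt, of k] mp.uncolored_unmixed(1)[OF tt, of k]
    unfolding X_def reds_def by auto
  have Xi: "X \<subseteq> items S" unfolding X_def reds_def by auto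
  have alone: "k' = k" if "k \<in> X" "k' \<in> items S" "bin_of S k' = bin_of S k" for k k'
  proof -
    have "k' \<in> content S (bin_of S k)" using that by simp
    then show ?thesis using al[OF that(1)] by blast
  qed
  have "inj_on (bin_of S) X" using alone Xi unfolding inj_on_def by blast
  then have cX: "card (bin_of S ` X) = card X" by (rule card_image)
  have "card X = card (uncolored_items S m) + card (reds S m)"
    unfolding X_def by (rule card_Un_disjoint) (auto simp: reds_def)
  moreover have "2 * n = card (uncolored_items S m) + card (reds S m) + card (blues S m)"
    using mp.labeled_split[OF tt] cl by simp
  moreover have "card (blues S m) \<le> 2 * card (bin_of S ` blues S m)" by (rule mp.blues_le[OF tt])
  ultimately have mb: "2 * n + card (reds S m) \<le> 2 * card (bin_of S ` X) + 2 * card (bin_of S ` blues S m)"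
    unfolding cX by linarith
  have "int (cnt_red S m) = \<lfloor>\<mu> * real (2 * n)\<rfloor>" using cnt_red[of m] m cnt cl by simp
  \<comment> \<open>The constant is the lag of 2 behind the counter plus 1 for the floor.\<close>
  then have rb: "2 * \<mu> * real n - 3 \<le> real (card (reds S m))" using cr by linarith
  have bf: "(1 - \<beta>) * real n \<le> real 3 * real (card (bin_of S ` blues S f))"
    using blue_bins[OF s(1) f(1,2) not_medium(1), of 3] bluefit_f cl by simp
  have rf: "\<beta> * real n - 1 \<le> real 1 * real (card (bin_of S ` reds S f))"
    using red_bins[OF s(1) f(1,2) not_medium(1), of 1] redfit_f cl by simp
  have dX: "bin_of S ` X \<inter> bin_of S ` Y = {}" if "Y \<subseteq> items S" "X \<inter> Y = {}" for Y
    using alone that by fastforce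
  have d: "bin_of S ` X \<inter> bin_of S ` blues S m = {}" "bin_of S ` X \<inter> bin_of S ` blues S f = {}"
    "bin_of S ` X \<inter> bin_of S ` reds S f = {}"
    using type_neq by (intro dX; auto simp: X_def blues_def reds_def)+
  have d1: "bin_of S ` blues S f \<inter> bin_of S ` reds S f = {}"
    by (rule disjoint_blue_red[OF s(1) nl]) (use self_host f in auto)
  have d2: "bin_of S ` blues S m \<inter> bin_of S ` reds S f = {}"
    by (rule disjoint_blue_red[OF s(1) nl]) (use h in auto)
  have d3: "bin_of S ` blues S m \<inter> bin_of S ` blues S f = {}" using disjoint_same_color(1)[OF s(1)] type_neq by blast
  have "real (sum_list (map (\<lambda>X. card (bin_of S ` X)) [X, blues S m, blues S f, reds S f])) \<le> real (bins_used S)"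
    using d d1 d2 d3 Xi by (intro bins_used_ge) (auto simp: blues_def reds_def)
  then have "real (card (bin_of S ` X)) + real (card (bin_of S ` blues S m)) + real (card (bin_of S ` blues S f)) +
     real (card (bin_of S ` reds S f)) \<le> real (bins_used S)" by simp
  moreover have "2 * real n + real (card (reds S m)) \<le> 2 * real (card (bin_of S ` X)) + 2 * real (card (bin_of S ` blues S m))"
    using mb by linarith
  moreover have "(1 + \<mu> + (1 - \<beta>) / 3 + \<beta>) * real n = real n + \<mu> * real n + (1 - \<beta>) * real n / 3 + \<beta> * real n"
    by (simp add: field_simps)
  ultimately have "(1 + \<mu> + (1 - \<beta>) / 3 + \<beta>) * real n - 3 \<le> real (bins_used S)"
    using rb bf rf by linarith
  moreover have "mset \<sigma> = repeat_mset n (mset [xs, xs, xf])"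
    unfolding \<sigma>_def by (rule multiset_eqI) simp
  ultimately show "plain (replicate n xf @ replicate (2 * n) xs) \<and>
    mset (replicate n xf @ replicate (2 * n) xs) = repeat_mset n (mset [xs, xs, xf]) \<and>
    (1 + \<mu> + (1 - \<beta>) / 3 + \<beta>) * real n - 3 \<le> real (bins_used (A (replicate n xf @ replicate (2 * n) xs)))"
    using pls unfolding S_def \<sigma>_def by blast
qed

end

context medium_run
begin

definition openers :: "real list \<Rightarrow> nat \<Rightarrow> nat" where
  "openers \<sigma> k = card {j. j < k \<and> opens_bin (A (adversary \<sigma> j))}"

lemma openers_Suc: "openers \<sigma> (Suc k) = openers \<sigma> k + (if opens_bin (A (adversary \<sigma> k)) then 1 else 0)"
proof -
  have "{j. j < Suc k \<and> opens_bin (A (adversary \<sigma> j))} =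
     (if opens_bin (A (adversary \<sigma> k)) then insert k {j. j < k \<and> opens_bin (A (adversary \<sigma> j))}
      else {j. j < k \<and> opens_bin (A (adversary \<sigma> j))})"
    by (auto simp: less_Suc_eq)
  then show ?thesis unfolding openers_def by simp
qed

lemma openers_0 [simp]: "openers \<sigma> 0 = 0"
  unfolding openers_def by simp

lemma openers_le: "openers \<sigma> k \<le> k"
  by (induction k) (auto simp: openers_Suc)

lemma mset_adversary:
  "mset (adversary \<sigma> k) = mset \<sigma> + replicate_mset (openers \<sigma> k) r + replicate_mset (k - openers \<sigma> k) s"
proof (induction k)
  case (Suc k)
  then show ?case using openers_le[of \<sigma> k] by (auto simp: openers_Suc Suc_diff_le)
qed simp

lemma set_adversary: "set (adversary \<sigma> k) \<subseteq> set \<sigma> \<union> {r, s}"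
  by (induction k) auto

lemma adv_inv_run:
  assumes "\<And>k. plain (adversary \<sigma> k)" "adv_inv (A \<sigma>)"
  shows "adv_inv (A (adversary \<sigma> k))"
proof (induction k)
  case (Suc k)
  then show ?case
    using adv_inv_step[OF Suc run_step(1), of "if opens_bin (A (adversary \<sigma> k)) then r else s"] assms(1)[of "Suc k"] by simp
qed (use assms in simp)

end

lemma count_mset_filter: "count (mset xs) x = length (filter (\<lambda>y. y = x) xs)"
  by (induction xs) auto

context instance_sizes
begin

text \<open>After \<open>q\<close> items \<open>xf\<close> come \<open>2 * q\<close> openers and
  \<open>E\<close> joiners, then \<open>E\<close> items \<open>x2\<close>. Medium items use at least
  \<open>2 * q + h'\<close> bins, where \<open>h'\<close> counts the host bins, and none of these
  takes an item \<open>x2\<close>. Offline \<open>E + q\<close> bins suffice. So \<open>E\<close>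
  has the negative weight \<open>1 - R\<close> and is bounded above through the number of red items,
  while \<open>h'\<close> is bounded below by about \<open>\<beta> * q\<close>. \<open>?F\<close> is
  the resulting surplus per \<open>q\<close>.\<close>

lemma input_B2:
  assumes mu: "9/50 \<le> \<mu>" and h: "needs P f \<le> leaves P m"
    and F: "0 < 2 + (1 - \<beta>) / 3 + 1/12 - 6 * e - R + \<beta> - 2 * ((R - 1) / (1 + \<mu>)) * (1 - \<mu> + \<beta>)" (is "0 < ?F")
  shows "ereal R \<le> asymptotic_ratio (\<lambda>\<sigma>. bins_used (A \<sigma>))"
proof (rule winI[where d = ?F and K = 2])
  show "0 < ?F" by (rule F)
  have pos: "\<mu> > 0" using mu by simp
  interpret mr: medium_run P A m f xr xs using medium_run_here[OF pos] .
  fix q :: nat assume q: "0 < q"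
  define base where "base = replicate q xf"
  define adv where "adv = mr.adversary base"
  have setadv: "set (adv k) \<subseteq> {xr, xs, xf}" for k
    using mr.set_adversary[of base k] unfolding adv_def base_def by (auto split: if_splits)
  have pl: "plain (adv k)" for k
    using setadv[of k] by (intro plain_small) auto
  have p0: "plain base" using pl[of 0] unfolding adv_def by simp
  have lab0: "labeled (A base) m = {}"
    using run_state(4)[OF p0, of m] type_neq unfolding base_def by (simp add: filter_replicate' card_eq_0_iff)
  have inv0: "mr.adv_inv (A base)"
  proof -
    have tt: "mr.two_types (A base)"
      using two_types_here[OF pos p0] unfolding base_def by (simp add: set_replicate_conv_if)
    have "mr.of_size (A base) x = {}" for x unfolding mr.of_size_def lab0 by simp
    then show ?thesis unfolding mr.adv_inv_def using mr.marks_ok_start[OF tt lab0] lab0 by simp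
  qed
  have inv: "mr.adv_inv (A (adv k))" for k
    using mr.adv_inv_run[of base k] pl inv0 unfolding adv_def by blast
  have adv_mset: "mset (adv k) = replicate_mset q xf + replicate_mset (mr.openers base k) xr + replicate_mset (k - mr.openers base k) xs" for k
    using mr.mset_adversary[of base k] unfolding adv_def base_def by simp
  have os: "card (mr.of_size (A (adv k)) x) = count (mset (adv k)) x" if "type_of P x = m" for k x
  proof -
    note s = run_state[OF pl[of k]]
    have "mr.of_size (A (adv k)) x = {j. j < length (adv k) \<and> adv k ! j = x}"
      using regular.item[OF s(1)] s(2,3) that unfolding set_eq_iff mr.of_size_iff by auto
    then show ?thesis unfolding count_mset_filter length_filter_conv_card by simp
  qed
  have cO: "card (mr.of_size (A (adv k)) xr) = mr.openers base k" for k
    unfolding os[OF types(1)] adv_mset using e by simp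
  have cE: "card (mr.of_size (A (adv k)) xs) = k - mr.openers base k" for k
    unfolding os[OF types(2)] adv_mset using e by simp
  have cf: "card (labeled (A (adv k)) f) = q" for k
  proof -
    have "card (labeled (A (adv k)) f) = size (filter_mset (\<lambda>p. type_of P p = f) (mset (adv k)))"
      unfolding run_state(4)[OF pl] by (metis mset_filter size_mset)
    moreover have "filter_mset Q (replicate_mset n x) = (if Q x then replicate_mset n x else {#})" for Q n and x :: real
      by (induction n) auto
    ultimately show ?thesis unfolding adv_mset using type_neq by simp
  qed
  have redf: "real (card (reds (A (adv k)) f)) \<le> \<beta> * real q" "\<beta> * real q - 1 \<le> real (card (reds (A (adv k)) f))" for k
    using blues_reds_count(2,3)[OF run_state(1)[OF pl[of k]] f(1,2) not_medium(1)] cf[of k] by simp_all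
  have hle: "real (card (mr.host_bins (A (adv k)))) \<le> \<beta> * real q" for k
    using mr.host_bins_le[OF inv[of k]] redf(1)[of k] by linarith
  have bq: "\<beta> * real q \<le> real q / 3"
    using mult_right_mono[of \<beta> "1/3" "real q"] beta by simp
  \<comment> \<open>The adversary stops at \<open>2 * q\<close> openers, a pair for each item
    \<open>xf\<close>. It gets there within \<open>6 * q\<close> arrivals, because joiners outnumber
    openers by at most two per host bin, and there are at most \<open>q / 3\<close> of
    these.\<close>
  define k where "k = (LEAST k. 2 * q \<le> mr.openers base k)"
  have "2 * q \<le> mr.openers base (6 * q)"
  proof -
    have "real (6 * q - mr.openers base (6 * q)) \<le> real (mr.openers base (6 * q)) + 2 * (real q / 3)"
      using mr.adv_counts(2)[OF inv[of "6 * q"]] hle[of "6 * q"] bq unfolding cO cE by linarith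
    then show ?thesis using mr.openers_le[of base "6 * q"] by (simp add: of_nat_diff)
  qed
  then have k1: "2 * q \<le> mr.openers base k" unfolding k_def by (rule LeastI)
  have k0: "k \<noteq> 0" using k1 q by (cases k) auto
  have "\<not> 2 * q \<le> mr.openers base (k - 1)"
    using not_less_Least[of "k - 1" "\<lambda>k. 2 * q \<le> mr.openers base k"] k0 unfolding k_def by auto
  then have O: "mr.openers base k = 2 * q"
    using k1 mr.openers_Suc[of base "k - 1"] k0 by (auto split: if_splits)
  define E where "E = k - 2 * q"
  have kE: "k = 2 * q + E" using mr.openers_le[of base k] O unfolding E_def by simp
  define S where "S = A (adv k)"
  define h' where "h' = card (mr.host_bins S)"
  note s = run_state[OF pl[of k], folded S_def]
  have invS: "mr.adv_inv S" using inv unfolding S_def .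
  note I = mr.adv_invD[OF invS]
  note tt = mr.marks_okD(1)[OF I(1)]
  have c1: "2 * q + h' \<le> card (bin_of S ` labeled S m)"
    using mr.adv_counts(1)[OF invS] cO[of k] O unfolding h'_def S_def by simp
  have c2: "E + card (reds S m) \<le> 2 * q + 2 * h'"
    using mr.adv_counts(2)[OF invS] cO[of k] cE[of k] O unfolding h'_def S_def E_def by simp
  have clm: "card (labeled S m) = k"
    using mr.adv_counts(3)[OF invS] cO[of k] cE[of k] O unfolding S_def kE by simp
  have crk: "int (cnt_red S m) = \<lfloor>\<mu> * real k\<rfloor>"
    using regular.cnt_red[OF s(1), of m] m regular.cnt[OF s(1), of m] clm by simp
  have h1: "real h' \<le> \<beta> * real q" using hle[of k] unfolding h'_def S_def .
  \<comment> \<open>With a free host left, the \<open>2 * q\<close> openers would be bounded by the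
    red counter, hence by a third of all medium items. That means \<open>E \<ge> 4 * q\<close>, but
    \<open>E\<close> is at most \<open>2 * q + 2 * q / 3\<close>.\<close>
  have nofree: "\<not> mr.free_host S"
  proof
    assume "mr.free_host S"
    then have "2 * q \<le> cnt_red S m" using I(8) cO[of k] O unfolding S_def by simp
    then have "real (2 * q) \<le> \<mu> * real k" using crk by linarith
    also have "\<dots> \<le> 1/3 * real k" using alpha by (intro mult_right_mono) auto
    finally have "4 * real q \<le> real E" unfolding kE by simp
    moreover have "real E \<le> 2 * real q + 2 * (real q / 3)" using c2 h1 bq by linarith
    ultimately show False using q by simp
  qed
  have h2: "\<beta> * real q - 1 \<le> real h'"
  proof (cases "\<beta> > 0")
    case True
    have "card (reds S f) \<le> h'"
      unfolding h'_def
      using mr.host_bins_ge[OF invS nofree h redfit_f[OF True]] self_host[OF f(1,2) True f(1,2)] by simp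
    then show ?thesis using redf(2)[of k] unfolding S_def by linarith
  qed (use beta in auto)
  define \<sigma> where "\<sigma> = adv k @ replicate E x2"
  have pls: "plain \<sigma>" unfolding \<sigma>_def using setadv[of k] by (intro plainI) auto
  define T where "T = A \<sigma>"
  note sT = run_state[OF pls, folded T_def]
  have keep: "bin_of T j = bin_of S j" "col S j \<noteq> Uncolored \<Longrightarrow> col T j = col S j" "j \<in> items T" "lab T j = lab S j"
    "sizes T ! j = sizes S ! j" if "j \<in> items S" for j
  proof -
    have jl: "j < length (adv k)" using that s(3) by simp
    show "bin_of T j = bin_of S j" "col S j \<noteq> Uncolored \<Longrightarrow> col T j = col S j"
      using run_keep[of "adv k" "replicate E x2" j] pls jl unfolding T_def S_def \<sigma>_def by auto
    show jT: "j \<in> items T" using jl sT(3) unfolding \<sigma>_def by simp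
    show sz: "sizes T ! j = sizes S ! j" using jl s(2) sT(2) unfolding \<sigma>_def by (simp add: nth_append)
    show "lab T j = lab S j" using regular.item[OF sT(1) jT] regular.item[OF s(1) that] sz by simp
  qed
  have l2: "card (labeled T 2) = E"
  proof -
    have "filter (\<lambda>p. type_of P p = 2) (adv k) = []"
      using setadv[of k] type_neq types by (auto simp: filter_empty_conv)
    then show ?thesis using sT(4)[of 2] unfolding \<sigma>_def by (simp add: filter_replicate')
  qed
  then have b2: "real E \<le> real (card (bin_of T ` blues T 2))"
    using blue_bins[OF sT(1) two_N not_medium(3) bluefit_2] redfrac_2 by simp
  have lf: "card (labeled T f) = q"
    using sT(4)[of f] s(4)[of f] cf[of k] type_neq unfolding \<sigma>_def S_def by (simp add: filter_replicate')
  then have bf: "(1 - \<beta>) * real q \<le> real 3 * real (card (bin_of T ` blues T f))"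
    using blue_bins[OF sT(1) f(1,2) not_medium(1), of 3] bluefit_f by simp
  have Mi: "labeled S m \<subseteq> items S" by auto
  have Mbins: "bin_of T ` labeled S m = bin_of S ` labeled S m" using keep(1) by auto
  \<comment> \<open>A medium item in such a bin would have to be red and hosted by
    \<open>j'\<close>. By type this is impossible; by size \<open>j'\<close> is an item
    \<open>x2\<close>. But a medium item that was not blue before the large items has size
    \<open>xr\<close>, and \<open>x2 + xr = 1 + e\<close>.\<close>
  have clash: "bin_of T j \<noteq> bin_of T j'"
    if j: "j \<in> labeled S m" and j': "j' \<in> blues T i" and i: "i = 2 \<or> i = f" for j j' i
  proof
    assume b: "bin_of T j = bin_of T j'"
    have jS: "j \<in> items S" "lab S j = m" using j by auto
    note kj = keep[OF jS(1)]
    have j'T: "j' \<in> items T" "lab T j' = i" "col T j' = Blue" using j' unfolding blues_def by auto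
    have mi: "m \<noteq> i" using i type_neq by auto
    have nB: "col T j \<noteq> Blue" using regular.same[OF sT(1) kj(3) j'T(1) b] j'T kj(4) jS(2) mi by auto
    have nU: "col T j \<noteq> Uncolored"
    proof
      assume "col T j = Uncolored"
      then have "content T (bin_of T j) = {j}" using regular.unc[OF sT(1) kj(3)] by simp
      moreover have "j' \<in> content T (bin_of T j)" using j'T b by simp
      ultimately have "j' = j" by blast
      then show False using nB j'T(3) by simp
    qed
    have rT: "col T j = Red" using nB nU color_cases[of "col T j"] regular.item[OF sT(1) kj(3)] by blast
    have "hosts P T j' j" using regular.mix[OF sT(1) j'T(1) kj(3) b[symmetric] j'T(3) rT] by simp
    moreover have "\<not> needs P m \<le> leaves P i"
      using no_medium_host[of i m] i f m m_med pos two_N by auto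
    ultimately have lg: "large (sizes T ! j')" "sizes T ! j' + sizes T ! j \<le> 1"
      using j'T(2) kj(4) jS(2) unfolding hosts_def by auto
    have "sizes T ! j' \<in> set \<sigma>" using j'T(1) sT(2,3) by simp
    then have "sizes T ! j' = x2" using lg(1) setadv[of k] size_classes unfolding \<sigma>_def by auto
    moreover have "col S j \<noteq> Blue" using kj(2) nB by auto
    then have "sizes S ! j = xr" using mr.adv_counts(4)[OF invS j] by blast
    ultimately show False using lg(2) kj(5) e by simp
  qed
  have "real (sum_list (map (\<lambda>X. card (bin_of T ` X)) [labeled S m, blues T 2, blues T f])) \<le> real (bins_used T)"
  proof (rule bins_used_ge)
    have "bin_of T ` labeled S m \<inter> bin_of T ` blues T 2 = {}" "bin_of T ` labeled S m \<inter> bin_of T ` blues T f = {}"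
      using clash by blast+
    then show "sorted_wrt (\<lambda>X Y. bin_of T ` X \<inter> bin_of T ` Y = {}) [labeled S m, blues T 2, blues T f]"
      using disjoint_same_color(1)[OF sT(1)] type_neq by simp
    show "X \<subseteq> items T" if "X \<in> set [labeled S m, blues T 2, blues T f]" for X
      using that keep(3) unfolding blues_def by auto
  qed
  then have cost: "real (card (bin_of S ` labeled S m)) + real (card (bin_of T ` blues T 2)) + real (card (bin_of T ` blues T f)) \<le> real (bins_used T)"
    unfolding Mbins[symmetric] by simp
  define gap where "gap = 1 - (2 * xr + xf)"
  have gap: "0 \<le> gap" "gap = 1/12 - 5 * e" using e unfolding gap_def by auto
  have total: "2 * real q + real h' + real E + (1 - \<beta>) * real q / 3 + real q * (gap - e) \<le> real (bins_used (A (\<sigma> @ sand q gap)))"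
    using sand_cost[OF pls gap(1), of q] cost c1 b2 bf unfolding T_def by linarith
  have pack: "packable (\<sigma> @ sand q gap) (E + q)"
  proof (rule packable_two_patterns)
    show "mset (\<sigma> @ sand q gap) = repeat_mset E (mset [x2, xs]) + repeat_mset q (mset ([xr, xr, xf] @ replicate (per_bin gap) e))"
      unfolding \<sigma>_def mset_append adv_mset O E_def[symmetric] mset_sand
      by (rule multiset_eqI) (simp add: algebra_simps)
    show "sum_list [x2, xs] \<le> 1" by simp
    show "sum_list ([xr, xr, xf] @ replicate (per_bin gap) e) \<le> 1"
      using per_bin(1)[OF gap(1)] unfolding gap_def by (simp add: sum_list_replicate')
  qed
  have vol: "real q / 10 \<le> sum_list (\<sigma> @ sand q gap)"
  proof -
    have "sum_list (adv k) = real q * xf + real (2 * q) * xr + real E * xs"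
    proof -
      have "sum_list (adv k) = sum_mset (mset (adv k))" by (simp add: sum_mset_sum_list)
      then show ?thesis unfolding adv_mset O E_def[symmetric] by (simp add: sum_mset_replicate_mset)
    qed
    moreover have "real q * (1/4) \<le> real q * xf" using e by (intro mult_left_mono) auto
    moreover have "0 \<le> real (2 * q) * xr" "0 \<le> real E * xs" "0 \<le> real E * x2"
      using e by simp_all
    moreover have "0 \<le> sum_list (sand q gap)" unfolding sand_def using e by (intro sum_list_nonneg) auto
    ultimately show ?thesis unfolding \<sigma>_def by (simp add: sum_list_replicate')
  qed
  \<comment> \<open>The factor that turns the bound on \<open>E * (1 + \<mu>)\<close> into one on
    \<open>(R - 1) * E\<close>. By \<open>2 * c \<le> 1\<close>, which follows from
    \<open>9/50 \<le> \<mu>\<close>, the net weight \<open>1 - 2 * c\<close> of a host bin is not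
    negative.\<close>
  define c where "c = (R - 1) / (1 + \<mu>)"
  have c: "0 < c" "c * (1 + \<mu>) = R - 1" "2 * c \<le> 1" using mu unfolding c_def by (auto simp: field_simps)
  have "real E * (1 + \<mu>) \<le> 2 * real q * (1 - \<mu>) + 2 * real h' + 3"
  proof -
    have "\<mu> * real k < real (cnt_red S m) + 1" using crk by linarith
    then have "\<mu> * real k \<le> real (card (reds S m)) + 3" using I(2) by linarith
    then have "real E + \<mu> * (2 * real q + real E) \<le> 2 * real q + 2 * real h' + 3"
      using c2 unfolding kE by simp
    then show ?thesis by (simp add: algebra_simps)
  qed
  then have "c * (real E * (1 + \<mu>)) \<le> c * (2 * real q * (1 - \<mu>) + 2 * real h' + 3)"
    using c(1) by (intro mult_left_mono) auto
  moreover have "c * (real E * (1 + \<mu>)) = (R - 1) * real E" unfolding c(2)[symmetric] by simp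
  ultimately have cE: "(R - 1) * real E \<le> 2 * c * (1 - \<mu>) * real q + 2 * c * real h' + 3 * c"
    by (simp add: algebra_simps)
  have hc: "(1 - 2 * c) * (\<beta> * real q - 1) \<le> (1 - 2 * c) * real h'"
    using h2 c(3) by (intro mult_left_mono) auto
  have "R * real (E + q) + ?F * real q - 2 \<le> real (bins_used (A (\<sigma> @ sand q gap)))"
  proof -
    have "?F * real q = 2 * real q + (1 - \<beta>) * real q / 3 + real q * (gap - e) - R * real q + (1 - 2 * c) * (\<beta> * real q)
        - 2 * c * (1 - \<mu>) * real q"
      unfolding gap(2) c_def[symmetric] by (simp add: field_simps)
    moreover have "(1 - 2 * c) * (\<beta> * real q) = (1 - 2 * c) * (\<beta> * real q - 1) + (1 - 2 * c)"
      "(1 - 2 * c) * real h' = real h' - 2 * c * real h'" "R * real (E + q) = (R - 1) * real E + real E + R * real q"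
      by (simp_all add: algebra_simps)
    ultimately show ?thesis using total cE hc c(1,3) by linarith
  qed
  then show "\<exists>\<sigma> w. valid_input \<sigma> \<and> packable \<sigma> w \<and> real q / 10 \<le> sum_list \<sigma> \<and>
      R * real w + ?F * real q - 2 \<le> real (bins_used (A \<sigma>))"
    using valid_sand[OF pls] pack vol by blast
qed

section \<open>The contradiction between the bounds on \<open>\<mu>\<close>, \<open>\<beta>\<close>
  and \<open>\<gamma>\<close>\<close>

lemma e6: "e \<le> 1/1000000"
  using e by simp

theorem ratio_ge: "ereal R \<le> asymptotic_ratio (\<lambda>\<sigma>. bins_used (A \<sigma>))"
proof (rule ccontr)
  assume no: "\<not> ?thesis"
  \<comment> \<open>From \<open>5/3 - \<mu> / 2 \<le> R\<close> up to terms in \<open>e\<close>; the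
    exact threshold \<open>2 * (5/3 - R)\<close> is 0.18093.\<close>
  have A0: "1809/10000 \<le> \<mu>"
  proof (rule ccontr)
    assume "\<not> 1809/10000 \<le> \<mu>"
    then have "\<mu> < 1809/10000" by simp
    moreover have "1 + (1 - \<mu>) / 2 + (1 - (x1 + xs)) - e = 5/3 - \<mu> / 2 - 3 * e" by (simp add: field_simps)
    ultimately have "R < 1 + (1 - \<mu>) / 2 + (1 - (x1 + xs)) - e"
      using e6 by simp
    then have "R < 1 + (1 - \<mu>) / 2 + real 0 * ((1 - \<gamma>) / real 6) + (1 - (x1 + xs + real 0 * xg)) - e"
      by simp
    from input_A[of 0 6, OF _ bluefit_g _ this] no show False by simp
  qed
  \<comment> \<open>If both sizes had the same type, only three blue items \<open>xg\<close> would
    share a bin. Then the pattern \<open>x1\<close>, \<open>xs\<close>, \<open>xg\<close> costs more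
    than 1 + 1/3 + 2/9 + 1/42 = 1.579..., up to terms in \<open>e\<close>, even with red fractions
    close to 1/3.\<close>
  have fg: "f \<noteq> g"
  proof
    assume fg: "f = g"
    have "7881/5000 < 1 + (1 - \<mu>) / 2 + (1 - \<gamma>) / 3 + (1 - (x1 + xs + xg)) - e"
      using e6 alpha(2) gamma(2) by (simp add: field_simps)
    then have "R < 1 + (1 - \<mu>) / 2 + real 1 * ((1 - \<gamma>) / real 3) + (1 - (x1 + xs + real 1 * xg)) - e"
      by simp
    then show False using no input_A[of 1 3] bluefit_f fg by simp
  qed
  \<comment> \<open>The gap of the pattern is 1 - 1/2 - 1/3 - 1/7 = 1/42. Effectively this is a
    lower bound on \<open>3 * \<mu> + \<gamma>\<close>.\<close>
  have A7: "(1 - \<mu>) / 2 + (1 - \<gamma>) / 6 + 1/42 - 4 * e \<le> R - 1"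
  proof (rule ccontr)
    assume "\<not> ?thesis"
    then have "R < 1 + (1 - \<mu>) / 2 + real 1 * ((1 - \<gamma>) / real 6) + (1 - (x1 + xs + real 1 * xg)) - e"
      by (simp add: field_simps)
    from input_A[of 1 6, OF _ bluefit_g _ this] no show False by simp
  qed
  \<comment> \<open>Otherwise \<open>input_B\<close> yields at least 1 + 0.1809 + 1/3 + 1/12, which
    exceeds 1.597, up to terms in \<open>e\<close>.\<close>
  have hosted: "needs P f \<le> leaves P m"
  proof (rule ccontr)
    assume h: "\<not> needs P f \<le> leaves P m"
    have "R < 1 + \<mu> + (1 - \<beta>) / 3 + \<beta> + (1 - (2 * xs + xf)) - e"
      using A0 beta(1) e6 by (simp add: field_simps)
    from input_B[OF _ h this] A0 no show False by simp
  qed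
  have B2: "2 + (1 - \<beta>) / 3 + 1/12 - 6 * e - R + \<beta> - 2 * ((R - 1) / (1 + \<mu>)) * (1 - \<mu> + \<beta>) \<le> 0"
    using no input_B2 A0 hosted by force
  \<comment> \<open>The inequality \<open>B2\<close> times \<open>1 + \<mu>\<close>: 0.8404 is
    slightly below 2 + 1/3 + 1/12 - \<open>R\<close>, and 1.1524 is
    \<open>2 * (R - 1)\<close>.\<close>
  have B2': "(1 + \<mu>) * (8404/10000 + 2/3 * \<beta>) - 11524/10000 * (1 - \<mu> + \<beta>) \<le> 0"
  proof -
    have "(1 + \<mu>) * (8404/10000 + 2/3 * \<beta>) \<le> (1 + \<mu>) * (2 + (1 - \<beta>) / 3 + 1/12 - 6 * e - R + \<beta>)"
    proof (rule mult_left_mono)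
      show "8404/10000 + 2/3 * \<beta> \<le> 2 + (1 - \<beta>) / 3 + 1/12 - 6 * e - R + \<beta>"
        using e6 by (simp add: field_simps)
    qed (use alpha in simp)
    moreover have "(1 + \<mu>) * (2 + (1 - \<beta>) / 3 + 1/12 - 6 * e - R + \<beta> - 2 * ((R - 1) / (1 + \<mu>)) * (1 - \<mu> + \<beta>)) \<le> 0"
      using B2 alpha by (intro mult_nonneg_nonpos) auto
    moreover have "(1 + \<mu>) * (2 + (1 - \<beta>) / 3 + 1/12 - 6 * e - R + \<beta> - 2 * ((R - 1) / (1 + \<mu>)) * (1 - \<mu> + \<beta>)) =
      (1 + \<mu>) * (2 + (1 - \<beta>) / 3 + 1/12 - 6 * e - R + \<beta>) - 11524/10000 * (1 - \<mu> + \<beta>)"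
    proof -
      have "(1 + \<mu>) * (X - 2 * ((R - 1) / (1 + \<mu>)) * Y) = (1 + \<mu>) * X - 11524/10000 * Y" for X Y :: real
        using alpha by (simp add: field_simps)
      then show ?thesis .
    qed
    ultimately show ?thesis by linarith
  qed
  \<comment> \<open>The left side decreases in \<open>\<beta>\<close>, as
    \<open>2/3 * (1 + \<mu>)\<close> is below 8/9. Hence any upper bound on \<open>\<beta>\<close>
    may be inserted.\<close>
  have bound: "(1 + \<mu>) * (8404/10000 + 2/3 * b) - 11524/10000 * (1 - \<mu> + b) \<le> 0" if "\<beta> \<le> b" for b
  proof -
    have "(b - \<beta>) * (2/3 * (1 + \<mu>) - 11524/10000) \<le> 0"
      using that alpha by (intro mult_nonneg_nonpos) auto
    moreover have "(1 + \<mu>) * (8404/10000 + 2/3 * b) - 11524/10000 * (1 - \<mu> + b) =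
      (1 + \<mu>) * (8404/10000 + 2/3 * \<beta>) - 11524/10000 * (1 - \<mu> + \<beta>) + (b - \<beta>) * (2/3 * (1 + \<mu>) - 11524/10000)"
      by (simp add: field_simps)
    ultimately show ?thesis using B2' by linarith
  qed
  show False
  \<comment> \<open>If red items \<open>xg\<close> are packed singly, they are so expensive that
    \<open>\<gamma>\<close> must be small. If they are packed in twos, the twos do not fit beside
    blue items of type \<open>f\<close>, and items \<open>xf\<close> and \<open>xg\<close> can be
    combined in one input.\<close>
  proof (cases "\<gamma> > 0 \<and> redfit P g = 1")
    case True
    \<comment> \<open>Three items \<open>xf\<close> per offline bin:
      \<open>1 + 2 * \<beta> + 1/4 \<le> R\<close> up to terms in \<open>e\<close>.\<close>
    have C1: "\<beta> \<le> 1632/10000"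
    proof (rule ccontr)
      assume "\<not> ?thesis"
      then have w: "R < real 3 * ((1 - \<beta>) / 3 + \<beta>) + real 0 * ((1 - \<gamma>) / 6 + \<gamma> / real 1) + (1 - 3 * xf) - e"
        using e6 by (simp add: field_simps)
      show False
        using no by (rule notE) (rule input_C[OF fg, of 1 3 0 "1 - 3 * xf"]; use True e w in simp)
    qed
    \<comment> \<open>Six items \<open>xg\<close> per offline bin:
      \<open>1 + 5 * \<gamma> + 1/7 \<le> R\<close> up to terms in \<open>e\<close>.\<close>
    have C2: "\<gamma> \<le> 868/10000"
    proof (rule ccontr)
      assume "\<not> ?thesis"
      then have w: "R < real 0 * ((1 - \<beta>) / 3 + \<beta>) + real 6 * ((1 - \<gamma>) / 6 + \<gamma> / real 1) + (1 - 6 * xg) - e"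
        using e6 by (simp add: field_simps)
      show False
        using no by (rule notE) (rule input_C[OF fg, of 1 0 6 "1 - 6 * xg"]; use True e w in simp)
    qed
    have "1995/10000 \<le> \<mu>" using A7 C2 e6 by (simp add: field_simps)
    then show False using bound[OF C1] by (simp add: field_simps)
  next
    case False
    \<comment> \<open>Two items of the top size of type \<open>g\<close> need more than 2/7, whereas
      three of type \<open>f\<close> leave less than 1/4.\<close>
    have nh: "\<not> needs P g \<le> leaves P f" if "\<gamma> > 0"
    proof
      assume le: "needs P g \<le> leaves P f"
      have "redfit P g = 2" using False redfit_g that by blast
      then have "2 * t g \<le> redspace P (needs P g)" using redfit_mult[of g] g that by simp
      then show False
        using redspace_le_leaves(1,2)[OF f(1) less_imp_le[OF f(2)] g(1) less_imp_le[OF g(2)] that le] bluefit_f f g e by simp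
    qed
    have rg: "\<gamma> > 0 \<Longrightarrow> redfit P g \<le> 2" using redfit_g by auto
    \<comment> \<open>Three items \<open>xf\<close> and one \<open>xg\<close> per offline bin, with
      gap 1 - 3/4 - 1/7 = 3/28.\<close>
    have C: "2 * \<beta> + \<gamma> / 3 + 1/6 + 3/28 - 5 * e \<le> R - 1"
    proof (rule ccontr)
      assume "\<not> ?thesis"
      then have w: "R < real 3 * ((1 - \<beta>) / 3 + \<beta>) + real 1 * ((1 - \<gamma>) / 6 + \<gamma> / real 2) + (1 - (3 * xf + xg)) - e"
        by (simp add: field_simps)
      show False
        using no by (rule notE) (rule input_C[OF fg, of 2 3 1 "1 - (3 * xf + xg)"]; use rg nh e w in simp)
    qed
    \<comment> \<open>Twice \<open>A7\<close> bounds \<open>\<gamma> / 3\<close> below by a constant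
      minus \<open>\<mu>\<close>, and \<open>C\<close> turns this into a bound on
      \<open>\<beta>\<close>.\<close>
    have b: "\<beta> \<le> 3694/100000 + \<mu> / 2" using C A7 e6 by (simp add: field_simps)
    \<comment> \<open>Inserting the bound on \<open>\<beta>\<close> gives about
      \<open>\<mu> * \<mu> / 3 + 1.7746 * \<mu> - 0.3299\<close>, which is only 0.002 at
      \<open>\<mu>\<close> = 0.1809. The square contributes 0.011 and cannot be dropped.\<close>
    have "1809/10000 * (1809/10000) \<le> \<mu> * \<mu>" using A0 by (intro mult_mono) auto
    then show False using A0 bound[OF b] by (simp add: field_simps)
  qed
qed

end

lemma (in eh_run) ratio: "ereal R \<le> asymptotic_ratio (\<lambda>\<sigma>. bins_used (A \<sigma>))"
proof -
  have tN: "t N < 1/100" "0 < t N" using thr_N_less thr_N_pos by auto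
  obtain m where m: "1 \<le> m" "m < N" "t (Suc m) \<le> 1/3" "1/3 < t m" using exists_type_above[of "1/3"] tN by auto
  obtain f where f: "1 \<le> f" "f < N" "t (Suc f) \<le> 1/4" "1/4 < t f" using exists_type_above[of "1/4"] tN by auto
  obtain g where g: "1 \<le> g" "g < N" "t (Suc g) \<le> 1/7" "1/7 < t g" using exists_type_above[of "1/7"] tN by auto
  \<comment> \<open>As 1/3 is not an inner point, it is a threshold. Together with the threshold
    \<open>t 3 = 1/2\<close> this makes the type just above 1/3 medium.\<close>
  have third: "t (Suc m) = 1/3" using no_inner[of "1/3" m] m by auto
  have "3 \<le> m"
  proof (rule ccontr)
    assume "\<not> 3 \<le> m"
    then have "t 3 \<le> t (Suc m)" using thr_antimono[of "Suc m" 3] N_ge by simp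
    then show False using thr_3 m by simp
  qed
  then have "t m \<le> 1/2" using thr_antimono[of 3 m] thr_3 m by simp
  then have med: "medium (t m)" using m unfolding medium_def by simp
  have "Suc m \<le> f"
  proof (rule ccontr)
    assume "\<not> Suc m \<le> f"
    then have "t (Suc m) \<le> t (Suc f)" using thr_antimono[of "Suc f" "Suc m"] m by simp
    then show False using third f by simp
  qed
  then have tf: "t f \<le> 1/3" using thr_antimono[of "Suc m" f] third f by simp
  have "f \<le> g"
  proof (rule ccontr)
    assume "\<not> f \<le> g"
    then have "t f \<le> t (Suc g)" using thr_antimono[of "Suc g" f] f by simp
    then show False using f g by simp
  qed
  then have tg: "t g \<le> t f" using thr_antimono[of f g] f g by simp
  \<comment> \<open>Small enough for all sizes to have the intended types and for the grains to be
    sand; the half accounts for \<open>xr\<close>, whose excess is \<open>2 * e\<close>.\<close>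
  define e where "e = Min {1/10^6, (t m - 1/3) / 2, t f - 1/4, t g - 1/7, t N}"
  have e: "0 < e" "e \<le> 1/10^6" "e \<le> (t m - 1/3) / 2" "e \<le> t f - 1/4" "e \<le> t g - 1/7" "e \<le> t N"
  proof -
    show "0 < e" unfolding e_def using m f g tN by simp
    have le: "e \<le> x" if "x \<in> {1/10^6, (t m - 1/3) / 2, t f - 1/4, t g - 1/7, t N}" for x
      unfolding e_def using that by (intro Min_le) auto
    show "e \<le> 1/10^6" "e \<le> (t m - 1/3) / 2" "e \<le> t f - 1/4" "e \<le> t g - 1/7" "e \<le> t N"
      by (rule le; simp)+
  qed
  have "instance_sizes P A m f g e"
    using e m f g med tf tg by unfold_locales auto
  then show ?thesis by (rule instance_sizes.ratio_ge)
qed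

theorem mainTheorem3:
  fixes A :: "real list \<Rightarrow> eh_state"
  assumes "extreme_harmonic A"
  shows "asymptotic_ratio (\<lambda>\<sigma>. bins_used (A \<sigma>)) \<ge> ereal 1.5762"
proof -
  obtain P where P: "eh_params_ok P" "A [] = init_state"
    "\<And>\<sigma> p. valid_input (\<sigma> @ [p]) \<Longrightarrow> eh_step P (A \<sigma>) p (A (\<sigma> @ [p]))"
    using assms unfolding extreme_harmonic_def by blast
  interpret eh_run P A using P by unfold_locales
  show ?thesis by (rule ratio)
qed

end
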